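(* Let $1<p<\infty$, and let $E$ be a quasibarrelled space such that $E'_\beta$ is an $\ell_\infty$-$V_p$-barrelled space. Then for a bounded subset $A$ of $E$ the following assertions are equivalent: (i) $A$ is a $p$-$(V^\ast)$ set; (ii) $T(A)$ is relatively compact whenever $Y$ is a Banach space and $T:E\to Y$ is an operator whose adjoint operator $T^\ast:Y'_\beta\to E'_\beta$ is weakly sequentially $p$-precompact; (iii) $T(A)$ is relatively compact in $\ell_p$ for every operator $T:E\to\ell_p$.
   Context: All locally convex spaces are Hausdorff, over $\mathbb{F}\in\{\mathbb{R},\mathbb{C}\}$. An operator is a continuous linear map. $E'_\beta$ is the dual $E'$ with the strong topology $\beta(E',E)$. $E$ is quasibarrelled if every $\beta(E',E)$-bounded subset of $E'$ is equicontinuous. The set $A$ is non-empty. A sequence $\{x_n\}_{n\in\omega}$ in a locally convex space $F$ is weakly $p$-summable if $(\langle\chi,x_n\rangle)_n\in\ell_p$ for every $\chi\in F'$; it is weakly $p$-Cauchy if for each pair of strictly increasing sequences $(k_n),(j_n)\subseteq\omega$ the sequence $\{x_{k_n}-x_{j_n}\}_n$ is weakly $p$-summable. A non-empty subset $A$ of $E$ is a $p$-$(V^\ast)$ set if $\lim_n\sup_{a\in A}|\langle\chi_n,a\rangle|=0$ for every weakly $p$-summable sequence $\{\chi_n\}$ in $E'_\beta$. For a locally convex space $F$, a non-empty $B\subseteq F'$ is a $p$-$(V)$ set if $\lim_n\sup_{\chi\in B}|\langle\chi,x_n\rangle|=0$ for every weakly $p$-summable sequence $\{x_n\}$ in $F$;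 $F$ is $\ell_\infty$-$V_p$-barrelled if every sequence in $F'$ which is (as a set) a $p$-$(V)$ set is equicontinuous. A subset of $F$ is weakly sequentially $p$-precompact if every sequence from it has a weakly $p$-Cauchy subsequence; an operator $S:Z\to F$ is weakly sequentially $p$-precompact if $S(U)$ is weakly sequentially $p$-precompact in $F$ for some neighborhood $U$ of zero in $Z$. *)

theory Defs
  imports
    "HOL-Analysis.Analysis"
    "HOL-Library.Function_Algebras"
begin

section \<open>Scalars\<close>

text \<open>The scalar field is \<open>\<real>\<close> or \<open>\<complex>\<close> with the usual absolute value. The class has (up to
  isometric isomorphism) exactly these two members.\<close>

class real_or_complex = real_normed_field +
  assumes real_or_complex:
    "(\<forall>z. \<exists>a. z = a *\<^sub>R 1) \<or>
     (\<exists>i. i * i = - 1 \<and>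
        (\<forall>z. \<exists>a b. z = a *\<^sub>R 1 + b *\<^sub>R i \<and> norm z = sqrt (a\<^sup>2 + b\<^sup>2)))"

instance real :: real_or_complex
  by standard auto

instance complex :: real_or_complex
proof
  have "z = Re z *\<^sub>R 1 + Im z *\<^sub>R \<i> \<and> norm z = sqrt ((Re z)\<^sup>2 + (Im z)\<^sup>2)"
    for z :: complex
    by (simp add: complex_eq_iff cmod_def)
  moreover have "\<i> * \<i> = - 1"
    by simp
  ultimately show "(\<forall>z::complex. \<exists>a. z = a *\<^sub>R 1) \<or>
     (\<exists>i::complex. i * i = - 1 \<and>
        (\<forall>z. \<exists>a b. z = a *\<^sub>R 1 + b *\<^sub>R i \<and> norm z = sqrt (a\<^sup>2 + b\<^sup>2)))"
    by blast
qed


section \<open>Locally convex spaces\<close>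

text \<open>Duals and Banach spaces that are quantified inside formulas cannot be types, so spaces are
  given by carrier sets: addition is that of the ambient type, the scalar multiplication is a
  parameter. A topological vector space is a pair \<open>(s, \<tau>)\<close> of a scalar multiplication and a
  topology, its underlying set being \<open>topspace \<tau>\<close>.\<close>

locale vector_space_on =
  fixes V :: "'v::ab_group_add set" and s :: "'k::real_or_complex \<Rightarrow> 'v \<Rightarrow> 'v"
  assumes zero_mem: "0 \<in> V"
    and add_mem: "x \<in> V \<Longrightarrow> y \<in> V \<Longrightarrow> x + y \<in> V"
    and scale_mem: "x \<in> V \<Longrightarrow> s c x \<in> V"
    and scale_add_right: "x \<in> V \<Longrightarrow> y \<in> V \<Longrightarrow> s c (x + y) = s c x + s c y"
    and scale_add_left: "x \<in> V \<Longrightarrow> s (c + d) x = s c x + s d x"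
    and scale_scale: "x \<in> V \<Longrightarrow> s c (s d x) = s (c * d) x"
    and scale_one: "x \<in> V \<Longrightarrow> s 1 x = x"

definition convex_in :: "('k::real_or_complex \<Rightarrow> 'v::ab_group_add \<Rightarrow> 'v) \<Rightarrow> 'v set \<Rightarrow> bool" where
  "convex_in s C \<longleftrightarrow>
    (\<forall>x\<in>C. \<forall>y\<in>C. \<forall>t::real. 0 \<le> t \<and> t \<le> 1 \<longrightarrow> s (of_real (1 - t)) x + s (of_real t) y \<in> C)"

locale locally_convex_space = vector_space_on "topspace \<tau>" s
  for s :: "'k::real_or_complex \<Rightarrow> 'v::ab_group_add \<Rightarrow> 'v" and \<tau> :: "'v topology" +
  assumes Hausdorff: "Hausdorff_space \<tau>"
    and continuous_add: "continuous_map (prod_topology \<tau> \<tau>) \<tau> (\<lambda>(x, y). x + y)"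
    and continuous_scale: "continuous_map (prod_topology euclidean \<tau>) \<tau> (\<lambda>(c, x). s c x)"
    and locally_convex: "neighbourhood_base_at 0 (convex_in s) \<tau>"

definition "operator" ::
  "('k::real_or_complex \<Rightarrow> 'v::ab_group_add \<Rightarrow> 'v) \<Rightarrow> 'v topology \<Rightarrow>
   ('k \<Rightarrow> 'w::ab_group_add \<Rightarrow> 'w) \<Rightarrow> 'w topology \<Rightarrow> ('v \<Rightarrow> 'w) \<Rightarrow> bool" where
  "operator s \<tau> s' \<tau>' T \<longleftrightarrow>
     continuous_map \<tau> \<tau>' T \<and>
     (\<forall>x\<in>topspace \<tau>. \<forall>y\<in>topspace \<tau>. T (x + y) = T x + T y) \<and>
     (\<forall>c. \<forall>x\<in>topspace \<tau>. T (s c x) = s' c (T x))"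

definition bounded_in ::
  "('k::real_or_complex \<Rightarrow> 'v::ab_group_add \<Rightarrow> 'v) \<Rightarrow> 'v topology \<Rightarrow> 'v set \<Rightarrow> bool" where
  "bounded_in s \<tau> B \<longleftrightarrow>
     B \<subseteq> topspace \<tau> \<and>
     (\<forall>U. openin \<tau> U \<and> 0 \<in> U \<longrightarrow> (\<exists>r>0. \<forall>c. norm c \<ge> r \<longrightarrow> B \<subseteq> s c ` U))"

definition relatively_compact_in :: "'v topology \<Rightarrow> 'v set \<Rightarrow> bool" where
  "relatively_compact_in \<tau> S \<longleftrightarrow> S \<subseteq> topspace \<tau> \<and> compactin \<tau> (\<tau> closure_of S)"


section \<open>The strong dual\<close>

text \<open>Functions form an additive group by \<^theory>\<open>HOL-Library.Function_Algebras\<close>; this is the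
  matching scalar multiplication.\<close>

definition fscale :: "'k::real_or_complex \<Rightarrow> ('i \<Rightarrow> 'k) \<Rightarrow> 'i \<Rightarrow> 'k" where
  "fscale c f = (\<lambda>x. c * f x)"

text \<open>A functional is represented by the function that extends it by 0 outside the carrier, so
  that equal functionals are equal functions.\<close>

definition dual ::
  "('k::real_or_complex \<Rightarrow> 'v::ab_group_add \<Rightarrow> 'v) \<Rightarrow> 'v topology \<Rightarrow> ('v \<Rightarrow> 'k) set" where
  "dual s \<tau> = {f. operator s \<tau> (*) euclidean f \<and> (\<forall>x. x \<notin> topspace \<tau> \<longrightarrow> f x = 0)}"

text \<open>The topology of uniform convergence on bounded sets.\<close>

definition strong_topology ::
  "('k::real_or_complex \<Rightarrow> 'v::ab_group_add \<Rightarrow> 'v) \<Rightarrow> 'v topology \<Rightarrow> ('v \<Rightarrow> 'k) topology" where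
  "strong_topology s \<tau> = topology (\<lambda>W. W \<subseteq> dual s \<tau> \<and>
     (\<forall>f\<in>W. \<exists>B \<epsilon>. bounded_in s \<tau> B \<and> \<epsilon> > 0 \<and>
        {g \<in> dual s \<tau>. \<forall>x\<in>B. norm (g x - f x) < \<epsilon>} \<subseteq> W))"

lemma bounded_in_empty: "bounded_in s \<tau> {}"
  unfolding bounded_in_def by (auto intro: exI[of _ 1])

lemma bounded_in_Un:
  assumes "bounded_in s \<tau> A" "bounded_in s \<tau> B"
  shows "bounded_in s \<tau> (A \<union> B)"
  unfolding bounded_in_def
proof (intro conjI allI impI)
  show "A \<union> B \<subseteq> topspace \<tau>"
    using assms by (simp add: bounded_in_def)
next
  fix U assume U: "openin \<tau> U \<and> 0 \<in> U"
  obtain r where r: "r > 0" "\<forall>c. norm c \<ge> r \<longrightarrow> A \<subseteq> s c ` U"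
    using assms(1) U unfolding bounded_in_def by blast
  obtain q where q: "q > 0" "\<forall>c. norm c \<ge> q \<longrightarrow> B \<subseteq> s c ` U"
    using assms(2) U unfolding bounded_in_def by blast
  have "\<forall>c. norm c \<ge> max r q \<longrightarrow> A \<union> B \<subseteq> s c ` U"
    using r(2) q(2) by simp
  with r(1) show "\<exists>r>0. \<forall>c. norm c \<ge> r \<longrightarrow> A \<union> B \<subseteq> s c ` U"
    by (intro exI[of _ "max r q"]) auto
qed

lemma openin_strong_topology:
  "openin (strong_topology s \<tau>) W \<longleftrightarrow> W \<subseteq> dual s \<tau> \<and>
     (\<forall>f\<in>W. \<exists>B \<epsilon>. bounded_in s \<tau> B \<and> \<epsilon> > 0 \<and>
        {g \<in> dual s \<tau>. \<forall>x\<in>B. norm (g x - f x) < \<epsilon>} \<subseteq> W)"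
proof -
  let ?nb = "\<lambda>f B \<epsilon>. {g \<in> dual s \<tau>. \<forall>x\<in>B. norm (g x - f x) < \<epsilon>}"
  let ?O = "\<lambda>W. W \<subseteq> dual s \<tau> \<and> (\<forall>f\<in>W. \<exists>B \<epsilon>. bounded_in s \<tau> B \<and> \<epsilon> > 0 \<and> ?nb f B \<epsilon> \<subseteq> W)"
  have "istopology ?O"
    unfolding istopology_def
  proof (intro conjI allI impI)
    fix S T assume S: "?O S" and T: "?O T"
    show "S \<inter> T \<subseteq> dual s \<tau>"
      using S by blast
    show "\<forall>f\<in>S \<inter> T. \<exists>B \<epsilon>. bounded_in s \<tau> B \<and> \<epsilon> > 0 \<and> ?nb f B \<epsilon> \<subseteq> S \<inter> T"
    proof
      fix f assume f: "f \<in> S \<inter> T"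
      obtain B e where 1: "bounded_in s \<tau> B" "e > 0" "?nb f B e \<subseteq> S"
        using S f by blast
      obtain C d where 2: "bounded_in s \<tau> C" "d > 0" "?nb f C d \<subseteq> T"
        using T f by blast
      have "?nb f (B \<union> C) (min e d) \<subseteq> ?nb f B e \<inter> ?nb f C d"
        by auto
      with 1(3) 2(3) have "?nb f (B \<union> C) (min e d) \<subseteq> S \<inter> T"
        by blast
      with 1 2 show "\<exists>B \<epsilon>. bounded_in s \<tau> B \<and> \<epsilon> > 0 \<and> ?nb f B \<epsilon> \<subseteq> S \<inter> T"
        by (intro exI[of _ "B \<union> C"] exI[of _ "min e d"] conjI bounded_in_Un) (assumption | simp)+
    qed
  next
    fix \<K> assume K: "\<forall>K\<in>\<K>. ?O K"
    show "\<Union>\<K> \<subseteq> dual s \<tau>"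
      using K by blast
    show "\<forall>f\<in>\<Union>\<K>. \<exists>B \<epsilon>. bounded_in s \<tau> B \<and> \<epsilon> > 0 \<and> ?nb f B \<epsilon> \<subseteq> \<Union>\<K>"
    proof
      fix f assume "f \<in> \<Union>\<K>"
      then obtain K where k: "K \<in> \<K>" "f \<in> K" by blast
      then obtain B e where "bounded_in s \<tau> B" "e > 0" "?nb f B e \<subseteq> K"
        using K by blast
      with k(1) show "\<exists>B \<epsilon>. bounded_in s \<tau> B \<and> \<epsilon> > 0 \<and> ?nb f B \<epsilon> \<subseteq> \<Union>\<K>"
        by (intro exI[of _ B] exI[of _ e]) blast
    qed
  qed
  then show ?thesis
    unfolding strong_topology_def by (simp only: topology_inverse')
qed

lemma topspace_strong_topology [simp]: "topspace (strong_topology s \<tau>) = dual s \<tau>"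
proof (rule antisym)
  show "topspace (strong_topology s \<tau>) \<subseteq> dual s \<tau>"
    using openin_strong_topology openin_topspace by blast
  have "\<exists>B \<epsilon>. bounded_in s \<tau> B \<and> \<epsilon> > 0 \<and>
      {g \<in> dual s \<tau>. \<forall>x\<in>B. norm (g x - f x) < \<epsilon>} \<subseteq> dual s \<tau>" for f
    by (intro exI[of _ "{}"] exI[of _ "1::real"]) (auto simp: bounded_in_empty)
  then have "openin (strong_topology s \<tau>) (dual s \<tau>)"
    unfolding openin_strong_topology by blast
  then show "dual s \<tau> \<subseteq> topspace (strong_topology s \<tau>)"
    by (rule openin_subset)
qed

definition adjoint_map :: "'v topology \<Rightarrow> ('v \<Rightarrow> 'w) \<Rightarrow> ('w \<Rightarrow> 'k::real_or_complex) \<Rightarrow> 'v \<Rightarrow> 'k" where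
  "adjoint_map \<tau> T g = (\<lambda>x. if x \<in> topspace \<tau> then g (T x) else 0)"

definition equicontinuous_set ::
  "('k::real_or_complex \<Rightarrow> 'v::ab_group_add \<Rightarrow> 'v) \<Rightarrow> 'v topology \<Rightarrow> ('v \<Rightarrow> 'k) set \<Rightarrow> bool" where
  "equicontinuous_set s \<tau> H \<longleftrightarrow>
     H \<subseteq> dual s \<tau> \<and>
     (\<forall>\<epsilon>>0. \<exists>U. openin \<tau> U \<and> 0 \<in> U \<and> (\<forall>f\<in>H. \<forall>x\<in>U. norm (f x) < \<epsilon>))"

definition quasibarrelled ::
  "('k::real_or_complex \<Rightarrow> 'v::ab_group_add \<Rightarrow> 'v) \<Rightarrow> 'v topology \<Rightarrow> bool" where
  "quasibarrelled s \<tau> \<longleftrightarrow>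
     (\<forall>H. bounded_in fscale (strong_topology s \<tau>) H \<longrightarrow> equicontinuous_set s \<tau> H)"


section \<open>Banach spaces and \<open>\<ell>\<^sub>p\<close>\<close>

text \<open>The distance is set to 0 off the carrier because \<^locale>\<open>Metric_space\<close> demands
  nonnegativity and symmetry on the whole type.\<close>

definition norm_dist :: "'v::ab_group_add set \<Rightarrow> ('v \<Rightarrow> real) \<Rightarrow> 'v \<Rightarrow> 'v \<Rightarrow> real" where
  "norm_dist V N x y = (if x \<in> V \<and> y \<in> V then N (x - y) else 0)"

definition norm_topology :: "'v::ab_group_add set \<Rightarrow> ('v \<Rightarrow> real) \<Rightarrow> 'v topology" where
  "norm_topology V N = Metric_space.mtopology V (norm_dist V N)"

locale banach_space = vector_space_on V s
  for V :: "'v::ab_group_add set" and s :: "'k::real_or_complex \<Rightarrow> 'v \<Rightarrow> 'v"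
    and N :: "'v \<Rightarrow> real" +
  assumes norm_ge_0: "x \<in> V \<Longrightarrow> N x \<ge> 0"
    and norm_eq_0: "x \<in> V \<Longrightarrow> N x = 0 \<longleftrightarrow> x = 0"
    and norm_scale: "x \<in> V \<Longrightarrow> N (s c x) = norm c * N x"
    and norm_triangle: "x \<in> V \<Longrightarrow> y \<in> V \<Longrightarrow> N (x + y) \<le> N x + N y"
    and complete: "Metric_space.mcomplete V (norm_dist V N)"

definition ell :: "real \<Rightarrow> (nat \<Rightarrow> 'k::real_or_complex) set" where
  "ell p = {x. summable (\<lambda>n. norm (x n) powr p)}"

definition ell_norm :: "real \<Rightarrow> (nat \<Rightarrow> 'k::real_or_complex) \<Rightarrow> real" where
  "ell_norm p x = (\<Sum>n. norm (x n) powr p) powr (1 / p)"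

text \<open>HOL cannot quantify over types inside a formula, so ``for every Banach space'' is rendered as
  ``for every Banach space carried by a subset of the type below'', in which \<open>'u\<close> is an arbitrary
  additive group (a type variable). Every Banach space, on a type \<open>'z\<close> say, occurs for a suitable
  \<open>'u\<close>: take \<open>'u = 'z\<close> and identify \<open>z\<close> with \<open>(z, 0)\<close>. The second factor guarantees that a copy of
  \<open>\<ell>\<^sub>p\<close> is present whatever \<open>'u\<close> is.\<close>

type_synonym ('u, 'k) banach_universe = "'u \<times> (nat \<Rightarrow> 'k)"


section \<open>Weakly \<open>p\<close>-summable sequences and derived notions\<close>

definition weakly_p_summable ::
  "real \<Rightarrow> ('k::real_or_complex \<Rightarrow> 'v::ab_group_add \<Rightarrow> 'v) \<Rightarrow> 'v topology \<Rightarrow> (nat \<Rightarrow> 'v) \<Rightarrow> bool" where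
  "weakly_p_summable p s \<tau> x \<longleftrightarrow>
     range x \<subseteq> topspace \<tau> \<and> (\<forall>\<phi>\<in>dual s \<tau>. (\<lambda>n. \<phi> (x n)) \<in> ell p)"

definition weakly_p_Cauchy ::
  "real \<Rightarrow> ('k::real_or_complex \<Rightarrow> 'v::ab_group_add \<Rightarrow> 'v) \<Rightarrow> 'v topology \<Rightarrow> (nat \<Rightarrow> 'v) \<Rightarrow> bool" where
  "weakly_p_Cauchy p s \<tau> x \<longleftrightarrow>
     range x \<subseteq> topspace \<tau> \<and>
     (\<forall>k j. strict_mono k \<and> strict_mono j \<longrightarrow> weakly_p_summable p s \<tau> (\<lambda>n. x (k n) - x (j n)))"

text \<open>The suprema are taken in the extended reals, so that an unbounded set has supremum \<open>\<infinity>\<close>.\<close>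

definition p_Vstar_set ::
  "real \<Rightarrow> ('k::real_or_complex \<Rightarrow> 'v::ab_group_add \<Rightarrow> 'v) \<Rightarrow> 'v topology \<Rightarrow> 'v set \<Rightarrow> bool" where
  "p_Vstar_set p s \<tau> A \<longleftrightarrow>
     A \<noteq> {} \<and> A \<subseteq> topspace \<tau> \<and>
     (\<forall>\<phi>. weakly_p_summable p fscale (strong_topology s \<tau>) \<phi> \<longrightarrow>
        (\<lambda>n. SUP a\<in>A. ereal (norm (\<phi> n a))) \<longlonglongrightarrow> 0)"

definition p_V_set ::
  "real \<Rightarrow> ('k::real_or_complex \<Rightarrow> 'v::ab_group_add \<Rightarrow> 'v) \<Rightarrow> 'v topology \<Rightarrow> ('v \<Rightarrow> 'k) set \<Rightarrow> bool" where
  "p_V_set p s \<tau> B \<longleftrightarrow>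
     B \<noteq> {} \<and> B \<subseteq> dual s \<tau> \<and>
     (\<forall>x. weakly_p_summable p s \<tau> x \<longrightarrow> (\<lambda>n. SUP \<phi>\<in>B. ereal (norm (\<phi> (x n)))) \<longlonglongrightarrow> 0)"

definition linf_Vp_barrelled ::
  "real \<Rightarrow> ('k::real_or_complex \<Rightarrow> 'v::ab_group_add \<Rightarrow> 'v) \<Rightarrow> 'v topology \<Rightarrow> bool" where
  "linf_Vp_barrelled p s \<tau> \<longleftrightarrow>
     (\<forall>\<phi> :: nat \<Rightarrow> 'v \<Rightarrow> 'k.
        p_V_set p s \<tau> (range \<phi>) \<longrightarrow> equicontinuous_set s \<tau> (range \<phi>))"

definition weakly_seq_p_precompact ::
  "real \<Rightarrow> ('k::real_or_complex \<Rightarrow> 'v::ab_group_add \<Rightarrow> 'v) \<Rightarrow> 'v topology \<Rightarrow> 'v set \<Rightarrow> bool" where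
  "weakly_seq_p_precompact p s \<tau> A \<longleftrightarrow>
     A \<subseteq> topspace \<tau> \<and>
     (\<forall>x :: nat \<Rightarrow> 'v. range x \<subseteq> A \<longrightarrow>
        (\<exists>r. strict_mono r \<and> weakly_p_Cauchy p s \<tau> (x \<circ> r)))"

definition weakly_seq_p_precompact_operator ::
  "real \<Rightarrow> ('k::real_or_complex \<Rightarrow> 'v::ab_group_add \<Rightarrow> 'v) \<Rightarrow> 'v topology \<Rightarrow>
   ('k \<Rightarrow> 'w::ab_group_add \<Rightarrow> 'w) \<Rightarrow> 'w topology \<Rightarrow> ('v \<Rightarrow> 'w) \<Rightarrow> bool" where
  "weakly_seq_p_precompact_operator p s \<tau> s' \<tau>' S \<longleftrightarrow>
     operator s \<tau> s' \<tau>' S \<and>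
     (\<exists>U. openin \<tau> U \<and> 0 \<in> U \<and> weakly_seq_p_precompact p s' \<tau>' (S ` U))"

end

theory Submission
  imports Defs "HOL-Library.Diagonal_Subsequence"
begin

text \<open>
  The three properties of \<open>A\<close> are compared through two observations about weakly \<open>p\<close>-summable sequences
  in the strong dual of the space.

  The first is that these sequences give operators into \<open>\<ell>\<^sub>p\<close>. If \<open>(\<xi> n)\<close> is weakly \<open>p\<close>-summable, then
  \<open>x \<mapsto> (\<xi> n x)\<close> maps into \<open>\<ell>\<^sub>p\<close>, and it is continuous (\<open>operator_of_weakly_p_summable\<close>): the combinations
  of the \<open>\<xi> n\<close> with coefficients in the unit ball of the dual of \<open>\<ell>\<^sub>p\<close> are weakly bounded, hence strongly
  bounded by a uniform boundedness argument (\<open>weakly_bounded_imp_strongly_bounded\<close>), hence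
  equicontinuous because the space is quasibarrelled. As relatively compact subsets of \<open>\<ell>\<^sub>p\<close> have uniformly
  small late coordinates, relative compactness of the images of \<open>A\<close> in \<open>\<ell>\<^sub>p\<close> makes \<open>A\<close> a p-(V*) set.

  The second is a compactness duality (\<open>relatively_compact_image_of_p_Vstar_set\<close>). Let \<open>A\<close> be a p-(V*)
  set and let the adjoint of \<open>T\<close> map a ball of the dual of a Banach space to a weakly sequentially
  \<open>p\<close>-precompact set. Every sequence in this set has a subsequence whose consecutive differences are weakly
  \<open>p\<close>-summable and so tend to zero uniformly on \<open>A\<close>; therefore the set is totally bounded for uniform
  convergence on \<open>A\<close>. Approximating with finitely many functionals and norming differences by the
  Hahn-Banach theorem (\<open>norming_functional\<close>) shows that \<open>T\<close> maps \<open>A\<close> to a totally bounded set.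

  It remains to see that every operator into \<open>\<ell>\<^sub>p\<close> is covered by the second observation, that is, that the
  unit ball of the dual of \<open>\<ell>\<^sub>p\<close> is weakly sequentially \<open>p\<close>-precompact for \<open>p > 1\<close>
  (\<open>identity_ell_dual_weakly_seq_p_precompact\<close>). A bounded sequence of functionals has a pointwise
  convergent subsequence; after subtracting the limit, a gliding hump yields a subsequence that
  lives essentially on disjoint blocks of coordinates, so that its values at any \<open>z\<close> in \<open>\<ell>\<^sub>p\<close> are
  dominated by the norms of the blocks of \<open>z\<close>, a sequence in \<open>\<ell>\<^sub>p\<close>, up to a geometric sequence. By reflexivity of \<open>\<ell>\<^sub>p\<close> (\<open>ell_reflexive\<close>) the points \<open>z\<close> exhaust the
  bidual.
\<close>

section \<open>Local compactness of the scalar field\<close>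

text \<open>Both fields are treated at once: over the reals, \<open>i = 0\<close> serves as the second coordinate
  direction. Bounded coordinates make every ball the continuous image of part of a square, hence
  relatively compact.\<close>

lemma scalar_coordinates:
  "\<exists>i::'k::real_or_complex. \<forall>z. \<exists>a b. z = of_real a + i * of_real b \<and> \<bar>a\<bar> \<le> norm z \<and> \<bar>b\<bar> \<le> norm z"
proof (cases "\<forall>z::'k. \<exists>a. z = a *\<^sub>R 1")
  case True
  then show ?thesis
    by (intro exI[of _ 0]) (force simp: of_real_def)
next
  case False
  then obtain i :: 'k where i: "\<forall>z. \<exists>a b. z = a *\<^sub>R 1 + b *\<^sub>R i \<and> norm z = sqrt (a\<^sup>2 + b\<^sup>2)"
    using real_or_complex[where 'a='k] by blast
  have "\<exists>a b. z = of_real a + i * of_real b \<and> \<bar>a\<bar> \<le> norm z \<and> \<bar>b\<bar> \<le> norm z" for z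
  proof -
    obtain a b where ab: "z = a *\<^sub>R 1 + b *\<^sub>R i" "norm z = sqrt (a\<^sup>2 + b\<^sup>2)"
      using i by blast
    have "\<bar>a\<bar> \<le> sqrt (a\<^sup>2 + b\<^sup>2)" "\<bar>b\<bar> \<le> sqrt (a\<^sup>2 + b\<^sup>2)"
      by (simp_all add: real_le_rsqrt)
    with ab show ?thesis
      by (intro exI[of _ a] exI[of _ b]) (simp add: of_real_def)
  qed
  then show ?thesis by blast
qed

lemma compact_cball_scalar: "compact (cball (0::'k::real_or_complex) M)"
proof -
  obtain i :: 'k where i: "\<And>z. \<exists>a b. z = of_real a + i * of_real b \<and> \<bar>a\<bar> \<le> norm z \<and> \<bar>b\<bar> \<le> norm z"
    using scalar_coordinates by blast
  let ?h = "\<lambda>u::real \<times> real. of_real (fst u) + i * of_real (snd u)"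
  have "compact (?h ` ({-M..M} \<times> {-M..M}))"
    by (intro compact_continuous_image compact_Times continuous_intros) auto
  moreover have "cball 0 M \<subseteq> ?h ` ({-M..M} \<times> {-M..M})"
  proof
    fix z :: 'k assume "z \<in> cball 0 M"
    moreover obtain a b where "z = of_real a + i * of_real b" "\<bar>a\<bar> \<le> norm z" "\<bar>b\<bar> \<le> norm z"
      using i by blast
    ultimately show "z \<in> ?h ` ({-M..M} \<times> {-M..M})"
      by (intro image_eqI[of _ _ "(a, b)"]) auto
  qed
  ultimately show ?thesis
    using compact_Int_closed[OF _ closed_cball] by (metis inf.absorb_iff2)
qed

instance real_or_complex \<subseteq> heine_borel
proof
  fix f :: "nat \<Rightarrow> 'a" assume "bounded (range f)"
  then obtain M where "\<forall>n. f n \<in> cball 0 M"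
    by (auto simp: bounded_iff)
  then show "\<exists>l r. strict_mono (r::nat\<Rightarrow>nat) \<and> ((f \<circ> r) \<longlongrightarrow> l) sequentially"
    using compact_cball_scalar[of M] unfolding compact_def by meson
qed

instance real_or_complex \<subseteq> banach ..

section \<open>The Hahn-Banach theorem\<close>

context vector_space_on
begin

lemma scale_zero: "x \<in> V \<Longrightarrow> s 0 x = 0"
  using scale_add_left[of x 0 0] by simp

lemma scale_minus_one: "x \<in> V \<Longrightarrow> s (-1) x = - x"
  using scale_add_left[of x "-1" 1] scale_zero[of x] scale_one[of x]
  by (simp add: eq_neg_iff_add_eq_0)

lemma uminus_mem: "x \<in> V \<Longrightarrow> - x \<in> V"
  using scale_mem[of x "-1"] by (simp add: scale_minus_one)

lemma diff_mem: "x \<in> V \<Longrightarrow> y \<in> V \<Longrightarrow> x - y \<in> V"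
  using add_mem[of x "-y"] uminus_mem[of y] by simp

lemma scale_zero_right: "s c 0 = 0"
  using scale_add_right[of 0 0 c] zero_mem by simp

lemma scale_cancel: "c \<noteq> 0 \<Longrightarrow> x \<in> V \<Longrightarrow> s c (s (inverse c) x) = x"
  by (simp add: scale_scale scale_one)

text \<open>Positive homogeneity is demanded as an inequality only; applied to the inverse factor as well, it
  gives equality (\<open>sublinear_scale\<close>), and the inequality is all that has to be checked for infima.\<close>

definition sublinear :: "('v \<Rightarrow> real) \<Rightarrow> bool" where
  "sublinear q \<longleftrightarrow> q 0 = 0 \<and> (\<forall>x\<in>V. \<forall>y\<in>V. q (x + y) \<le> q x + q y) \<and>
     (\<forall>x\<in>V. \<forall>r>0. q (s (of_real r) x) \<le> r * q x)"

lemma sublinear_add: "sublinear q \<Longrightarrow> x \<in> V \<Longrightarrow> y \<in> V \<Longrightarrow> q (x + y) \<le> q x + q y"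
  by (simp add: sublinear_def)

lemma sublinear_scale:
  assumes "sublinear q" "x \<in> V" "r \<ge> 0"
  shows "q (s (of_real r) x) = r * q x"
proof (cases "r = 0")
  case True
  then show ?thesis using assms by (simp add: scale_zero sublinear_def)
next
  case False
  have "q (s (of_real (inverse r)) (s (of_real r) x)) \<le> inverse r * q (s (of_real r) x)"
    using assms False unfolding sublinear_def by (simp add: scale_mem del: of_real_inverse)
  also have "s (of_real (inverse r)) (s (of_real r) x) = x"
    using assms False by (simp add: scale_scale scale_one)
  finally have "r * q x \<le> q (s (of_real r) x)"
    using assms False by (simp add: field_simps)
  moreover have "q (s (of_real r) x) \<le> r * q x"
    using assms False unfolding sublinear_def by simp
  ultimately show ?thesis by simp
qed

lemma sublinear_neg: "sublinear q \<Longrightarrow> x \<in> V \<Longrightarrow> - q (- x) \<le> q x"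
  using sublinear_add[of q x "- x"] uminus_mem[of x] unfolding sublinear_def by auto

text \<open>For sublinear \<open>q\<close> this is the largest sublinear functional below \<open>q\<close> whose value at \<open>- y\<close> is at most
  \<open>- q y\<close>: it is below \<open>q\<close> (take \<open>t = 0\<close>), has this value at \<open>- y\<close> (take \<open>t = 1\<close>), and any such functional
  \<open>q'\<close> satisfies \<open>q' x \<le> q' (x + t y) + t q' (- y) \<le> q (x + t y) - t q y\<close>.\<close>

definition slope_inf :: "('v \<Rightarrow> real) \<Rightarrow> 'v \<Rightarrow> 'v \<Rightarrow> real" where
  "slope_inf q y x = (if x \<in> V then INF t\<in>{0..}. q (x + s (of_real t) y) - t * q y else 0)"

lemma slope_inf_le:
  assumes "sublinear q" "x \<in> V" "y \<in> V" "t \<ge> 0"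
  shows "slope_inf q y x \<le> q (x + s (of_real t) y) - t * q y"
proof -
  have "bdd_below ((\<lambda>t. q (x + s (of_real t) y) - t * q y) ` {0..})"
  proof (rule bdd_belowI2[of _ "- q (- x)"])
    fix t :: real assume t: "t \<in> {0..}"
    have "q ((x + s (of_real t) y) + - x) \<le> q (x + s (of_real t) y) + q (- x)"
      using assms by (intro sublinear_add add_mem scale_mem uminus_mem)
    moreover have "q ((x + s (of_real t) y) + - x) = t * q y"
      using sublinear_scale[of q y t] assms t by simp
    ultimately show "- q (- x) \<le> q (x + s (of_real t) y) - t * q y" by simp
  qed
  then show ?thesis
    using assms unfolding slope_inf_def by (auto intro: cINF_lower)
qed

lemma slope_inf_greatest:
  assumes "x \<in> V" "\<And>t. t \<ge> 0 \<Longrightarrow> m \<le> q (x + s (of_real t) y) - t * q y"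
  shows "m \<le> slope_inf q y x"
  using assms unfolding slope_inf_def by (auto intro: cINF_greatest)

lemma slope_inf_le_self: "sublinear q \<Longrightarrow> x \<in> V \<Longrightarrow> y \<in> V \<Longrightarrow> slope_inf q y x \<le> q x"
  using slope_inf_le[of q x y 0] by (simp add: scale_zero)

lemma sublinear_slope_inf:
  assumes q: "sublinear q" and y: "y \<in> V"
  shows "sublinear (slope_inf q y)"
  unfolding sublinear_def
proof (intro conjI ballI allI impI)
  have "0 \<le> slope_inf q y 0"
    using sublinear_scale[OF q y] by (intro slope_inf_greatest zero_mem) simp
  moreover have "slope_inf q y 0 \<le> 0"
    using slope_inf_le_self[OF q zero_mem y] q by (simp add: sublinear_def)
  ultimately show "slope_inf q y 0 = 0" by simp
next
  fix x z assume x: "x \<in> V" and z: "z \<in> V"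
  have *: "slope_inf q y (x + z) \<le> (q (x + s (of_real t) y) - t * q y) + (q (z + s (of_real u) y) - u * q y)"
    if "t \<ge> 0" "u \<ge> 0" for t u
  proof -
    have "slope_inf q y (x + z) \<le> q ((x + z) + s (of_real (t + u)) y) - (t + u) * q y"
      using that by (intro slope_inf_le q add_mem x z y) simp
    also have "(x + z) + s (of_real (t + u)) y = (x + s (of_real t) y) + (z + s (of_real u) y)"
      using y by (simp add: scale_add_left)
    also have "q \<dots> \<le> q (x + s (of_real t) y) + q (z + s (of_real u) y)"
      using q x y z unfolding sublinear_def by (simp add: add_mem scale_mem)
    finally show ?thesis by (simp add: algebra_simps)
  qed
  have "slope_inf q y (x + z) - (q (x + s (of_real t) y) - t * q y) \<le> slope_inf q y z"
    if "t \<ge> 0" for t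
  proof (intro slope_inf_greatest z)
    fix u :: real assume "u \<ge> 0"
    from *[OF that this]
    show "slope_inf q y (x + z) - (q (x + s (of_real t) y) - t * q y) \<le> q (z + s (of_real u) y) - u * q y"
      by simp
  qed
  then have "slope_inf q y (x + z) - slope_inf q y z \<le> slope_inf q y x"
    by (intro slope_inf_greatest x) (simp add: algebra_simps)
  then show "slope_inf q y (x + z) \<le> slope_inf q y x + slope_inf q y z" by simp
next
  fix x and r :: real assume x: "x \<in> V" and r: "r > 0"
  have "slope_inf q y (s (of_real r) x) / r \<le> slope_inf q y x"
  proof (intro slope_inf_greatest x)
    fix t :: real assume t: "t \<ge> 0"
    have "slope_inf q y (s (of_real r) x) \<le> q (s (of_real r) x + s (of_real (r * t)) y) - (r * t) * q y"
      using t r by (intro slope_inf_le q scale_mem x y) simp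
    also have "s (of_real r) x + s (of_real (r * t)) y = s (of_real r) (x + s (of_real t) y)"
      using x y by (simp add: scale_add_right scale_mem scale_scale)
    also have "q \<dots> = r * q (x + s (of_real t) y)"
      using r by (intro sublinear_scale q add_mem x scale_mem y) simp
    finally show "slope_inf q y (s (of_real r) x) / r \<le> q (x + s (of_real t) y) - t * q y"
      using r by (simp add: field_simps)
  qed
  then show "slope_inf q y (s (of_real r) x) \<le> r * slope_inf q y x"
    using r by (simp add: field_simps)
qed

text \<open>Zorn's lemma for the reversed pointwise order: the pointwise infimum of a chain of sublinear
  functionals is sublinear, because two members of a chain may be replaced by the smaller one in the
  triangle inequality, and it is finite because each member \<open>q\<close> satisfies
  \<open>q x \<ge> - q (- x) \<ge> - p (- x)\<close>. Functionals are cut off outside the carrier to make the order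
  antisymmetric.\<close>

lemma minimal_sublinear:
  assumes p: "sublinear p"
  obtains f where "sublinear f" "\<And>x. x \<in> V \<Longrightarrow> f x \<le> p x" "\<And>x. x \<notin> V \<Longrightarrow> f x = 0"
    "\<And>q x. sublinear q \<Longrightarrow> (\<And>x. x \<in> V \<Longrightarrow> q x \<le> f x) \<Longrightarrow> x \<in> V \<Longrightarrow> q x = f x"
proof -
  define A where "A = {q. sublinear q \<and> (\<forall>x\<in>V. q x \<le> p x) \<and> (\<forall>x. x \<notin> V \<longrightarrow> q x = 0)}"
  define P where "P a b \<longleftrightarrow> (\<forall>x. b x \<le> a x)" for a b :: "'v \<Rightarrow> real"
  have cut: "sublinear (\<lambda>x. if x \<in> V then q x else 0)" if "sublinear q" for q
    using that by (simp add: sublinear_def add_mem scale_mem zero_mem)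
  have "partial_order_on A (relation_of P A)"
    unfolding partial_order_on_def preorder_on_def refl_on_def trans_def antisym_def relation_of_def P_def
    by (auto intro: order_trans) (blast intro: antisym)
  moreover have "\<exists>u\<in>A. \<forall>a\<in>C. P a u" if C: "C \<in> Chains (relation_of P A)" for C
  proof (cases "C = {}")
    case True
    have "(\<lambda>x. if x \<in> V then p x else 0) \<in> A"
      using cut[OF p] by (simp add: A_def)
    with True show ?thesis by blast
  next
    case False
    have CA: "C \<subseteq> A" and lin: "\<And>a b. a \<in> C \<Longrightarrow> b \<in> C \<Longrightarrow> P a b \<or> P b a"
      using C unfolding Chains_def relation_of_def by auto
    define u where "u x = (if x \<in> V then INF q\<in>C. q x else 0)" for x
    have lower: "u x \<le> q x" if "q \<in> C" "x \<in> V" for q x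
    proof -
      have "bdd_below ((\<lambda>q. q x) ` C)"
      proof (rule bdd_belowI2[of _ "- p (- x)"])
        fix q assume "q \<in> C"
        then have "sublinear q" "q (- x) \<le> p (- x)"
          using CA uminus_mem[OF \<open>x \<in> V\<close>] unfolding A_def by auto
        then show "- p (- x) \<le> q x"
          using sublinear_neg[of q x] \<open>x \<in> V\<close> by linarith
      qed
      then show ?thesis using that unfolding u_def by (auto intro: cINF_lower)
    qed
    have greatest: "m \<le> u x" if "x \<in> V" "\<And>q. q \<in> C \<Longrightarrow> m \<le> q x" for m x
      using that False unfolding u_def by (auto intro: cINF_greatest)
    obtain q0 where q0: "q0 \<in> C" using False by blast
    have "sublinear u"
      unfolding sublinear_def
    proof (intro conjI ballI allI impI)
      have "q 0 = 0" if "q \<in> C" for q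
        using that CA unfolding A_def sublinear_def by auto
      then show "u 0 = 0"
        using lower[OF q0 zero_mem] greatest[OF zero_mem, of 0] q0 by force
    next
      fix x y assume x: "x \<in> V" and y: "y \<in> V"
      have *: "u (x + y) \<le> q x + r y" if q: "q \<in> C" "r \<in> C" for q r
      proof -
        obtain w where w: "w \<in> C" "w x \<le> q x" "w y \<le> r y"
          using lin[OF q] q unfolding P_def by blast
        have "u (x + y) \<le> w (x + y)" using w x y by (intro lower add_mem)
        also have "\<dots> \<le> w x + w y"
          using w CA x y unfolding A_def sublinear_def by auto
        finally show ?thesis using w by linarith
      qed
      have "u (x + y) - q x \<le> u y" if "q \<in> C" for q
        using *[OF that] by (intro greatest y) (simp add: algebra_simps)
      then have "u (x + y) - u y \<le> u x"
        by (intro greatest x) (simp add: algebra_simps)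
      then show "u (x + y) \<le> u x + u y" by simp
    next
      fix x and r :: real assume x: "x \<in> V" and r: "r > 0"
      have "u (s (of_real r) x) / r \<le> u x"
      proof (intro greatest x)
        fix q assume q: "q \<in> C"
        have "u (s (of_real r) x) \<le> q (s (of_real r) x)" by (intro lower q scale_mem x)
        also have "\<dots> \<le> r * q x" using q CA x r unfolding A_def sublinear_def by auto
        finally show "u (s (of_real r) x) / r \<le> q x" using r by (simp add: field_simps)
      qed
      then show "u (s (of_real r) x) \<le> r * u x" using r by (simp add: field_simps)
    qed
    moreover have "u x \<le> p x" if "x \<in> V" for x
      using lower[OF q0 that] q0 CA that unfolding A_def by force
    ultimately have "u \<in> A" by (simp add: A_def u_def)
    moreover have "P a u" if "a \<in> C" for a
      using lower[OF that] that CA unfolding P_def A_def u_def by force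
    ultimately show ?thesis by blast
  qed
  ultimately obtain f where f: "f \<in> A" "\<And>a. a \<in> A \<Longrightarrow> P f a \<Longrightarrow> a = f"
    using predicate_Zorn[of A P] by blast
  show thesis
  proof
    show "sublinear f" "\<And>x. x \<in> V \<Longrightarrow> f x \<le> p x" "\<And>x. x \<notin> V \<Longrightarrow> f x = 0"
      using f by (auto simp: A_def)
    fix q x assume q: "sublinear q" "\<And>x. x \<in> V \<Longrightarrow> q x \<le> f x" and x: "x \<in> V"
    have "(\<lambda>x. if x \<in> V then q x else 0) = f"
    proof (rule f(2))
      show "(\<lambda>x. if x \<in> V then q x else 0) \<in> A"
        using cut[OF q(1)] q(2) f(1) unfolding A_def by (force intro: order_trans)
      show "P f (\<lambda>x. if x \<in> V then q x else 0)"
        using q(2) f(1) unfolding P_def A_def by auto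
    qed
    then show "q x = f x" using x by (auto simp: fun_eq_iff split: if_splits)
  qed
qed

text \<open>The real Hahn-Banach theorem without extension from subspaces: a minimal sublinear functional \<open>f\<close>
  coincides with \<open>slope_inf f z\<close> for every \<open>z\<close>, and \<open>slope_inf f z x \<le> f (x + z) - f z\<close> then makes it
  additive. Minimizing below \<open>slope_inf p y\<close> instead of \<open>p\<close> forces the value \<open>p y\<close> at \<open>y\<close>.\<close>

lemma real_linear_functional_ge:
  assumes p: "sublinear p" and y: "y \<in> V"
  obtains g where "\<And>x z. x \<in> V \<Longrightarrow> z \<in> V \<Longrightarrow> g (x + z) = g x + g z"
    "\<And>r x. x \<in> V \<Longrightarrow> g (s (of_real r) x) = r * g x"
    "\<And>x. x \<in> V \<Longrightarrow> g x \<le> p x" "g y = p y"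
proof -
  obtain f where f: "sublinear f" "\<And>x. x \<in> V \<Longrightarrow> f x \<le> slope_inf p y x" "\<And>x. x \<notin> V \<Longrightarrow> f x = 0"
    and min: "\<And>q x. sublinear q \<Longrightarrow> (\<And>x. x \<in> V \<Longrightarrow> q x \<le> f x) \<Longrightarrow> x \<in> V \<Longrightarrow> q x = f x"
    using minimal_sublinear[OF sublinear_slope_inf[OF p y]] by blast
  have add: "f (x + z) = f x + f z" if x: "x \<in> V" and z: "z \<in> V" for x z
  proof -
    have "f x = slope_inf f z x"
      using min[OF sublinear_slope_inf[OF f(1) z]] slope_inf_le_self[OF f(1) _ z] x by auto
    also have "\<dots> \<le> f (x + s (of_real 1) z) - 1 * f z"
      by (intro slope_inf_le f x z) simp
    finally have "f x + f z \<le> f (x + z)" using z by (simp add: scale_one)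
    moreover have "f (x + z) \<le> f x + f z" using f(1) x z by (simp add: sublinear_def)
    ultimately show ?thesis by simp
  qed
  have neg: "f (- x) = - f x" if "x \<in> V" for x
    using add[OF that uminus_mem[OF that]] f(1) by (simp add: sublinear_def)
  have le: "f x \<le> p x" if "x \<in> V" for x
    using f(2)[OF that] slope_inf_le_self[OF p that y] by linarith
  show thesis
  proof
    show "f (s (of_real r) x) = r * f x" if x: "x \<in> V" for r x
    proof (cases "r \<ge> 0")
      case True
      then show ?thesis using sublinear_scale[OF f(1) x] by simp
    next
      case False
      have "s (of_real r) x = - s (of_real (- r)) x"
        using x scale_scale[of x "-1" "of_real (- r)"] scale_minus_one[OF scale_mem[OF x]] by simp
      then show ?thesis
        using sublinear_scale[OF f(1) x, of "- r"] False neg[OF scale_mem[OF x]] by simp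
    qed
    have "f (- y) \<le> slope_inf p y (- y)" by (intro f uminus_mem y)
    also have "\<dots> \<le> p (- y + s (of_real 1) y) - 1 * p y" by (intro slope_inf_le p uminus_mem y) simp
    also have "\<dots> = - p y" using p y by (simp add: scale_one sublinear_def)
    finally show "f y = p y" using neg[OF y] le[OF y] by simp
  qed (use add le in auto)
qed

end

lemma (in banach_space) sublinear_norm: "sublinear N"
  unfolding sublinear_def using norm_eq_0[of 0] zero_mem norm_triangle norm_scale by simp

text \<open>Over the complex numbers the functional is \<open>g x - i g (i x)\<close> for a real-linear \<open>g\<close> as above. Rotating
  \<open>f x\<close> to a nonnegative real number reduces the bound on its modulus to the bound on \<open>g\<close>.\<close>

lemma (in banach_space) norming_functional:
  assumes y: "y \<in> V"
  obtains f :: "'v \<Rightarrow> 'k" where "\<And>x z. x \<in> V \<Longrightarrow> z \<in> V \<Longrightarrow> f (x + z) = f x + f z"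
    "\<And>c x. x \<in> V \<Longrightarrow> f (s c x) = c * f x"
    "\<And>x. x \<in> V \<Longrightarrow> norm (f x) \<le> N x" "N y \<le> norm (f y)"
proof -
  obtain g where g: "\<And>x z. x \<in> V \<Longrightarrow> z \<in> V \<Longrightarrow> g (x + z) = g x + g z"
    "\<And>r x. x \<in> V \<Longrightarrow> g (s (of_real r) x) = r * g x"
    "\<And>x. x \<in> V \<Longrightarrow> g x \<le> N x" "g y = N y"
    using real_linear_functional_ge[OF sublinear_norm y] by blast
  show thesis
  proof (cases "\<forall>z::'k. \<exists>a. z = a *\<^sub>R 1")
    case True
    show thesis
    proof
      show "of_real (g (s c x)) = c * (of_real (g x) :: 'k)" if "x \<in> V" for c x
        using True g(2)[OF that] by (metis of_real_def of_real_mult)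
      show "norm (of_real (g x) :: 'k) \<le> N x" if "x \<in> V" for x
      proof -
        have "g (s (of_real (-1)) x) \<le> N (s (of_real (-1)) x)" by (intro g scale_mem that)
        then have "- g x \<le> N x" using g(2)[OF that, of "-1"] norm_scale[OF that, of "-1"] by simp
        with g(3)[OF that] show ?thesis by simp
      qed
    qed (use g in auto)
  next
    case False
    then obtain i :: 'k where i: "i * i = -1"
      and "\<forall>z. \<exists>a b. z = a *\<^sub>R 1 + b *\<^sub>R i \<and> norm z = sqrt (a\<^sup>2 + b\<^sup>2)"
      using real_or_complex[where 'a='k] by blast
    then have rep: "\<exists>a b. z = of_real a + i * of_real b \<and> norm z = sqrt (a\<^sup>2 + b\<^sup>2)" for z :: 'k
      by (simp add: of_real_def)
    have uniq: "a = a'" if "of_real a + i * of_real b = of_real a' + i * of_real b'" for a b a' b'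
    proof (rule ccontr)
      assume "a \<noteq> a'"
      \<comment> \<open>otherwise \<open>i\<close> would be a real number with square \<open>- 1\<close>\<close>
      have eq: "i * of_real (b - b') = of_real (a' - a)" using that by (simp add: algebra_simps)
      with \<open>a \<noteq> a'\<close> have "b - b' \<noteq> 0" by auto
      with eq have "i = of_real ((a' - a) / (b - b'))"
        by (metis nonzero_eq_divide_eq of_real_divide of_real_eq_0_iff)
      then have "(of_real (((a' - a) / (b - b')) * ((a' - a) / (b - b'))) :: 'k) = of_real (-1)"
        using i by (metis of_real_mult of_real_minus of_real_1)
      then have "((a' - a) / (b - b')) * ((a' - a) / (b - b')) = - 1"
        by (simp only: of_real_eq_iff)
      then show False by (smt (verit) zero_le_square)
    qed
    have norm_ge: "\<bar>a\<bar> \<le> norm (of_real a + i * of_real b)" for a b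
    proof -
      obtain a' b' where *: "of_real a + i * of_real b = of_real a' + i * of_real b'"
        "norm (of_real a + i * of_real b) = sqrt (a'\<^sup>2 + b'\<^sup>2)"
        using rep by blast
      then show ?thesis using uniq[OF *(1)] by (simp add: real_le_rsqrt)
    qed
    define f :: "'v \<Rightarrow> 'k" where "f x = of_real (g x) + i * of_real (- g (s i x))" for x
    have f_add: "f (x + z) = f x + f z" if "x \<in> V" "z \<in> V" for x z
      using that by (simp add: f_def scale_add_right g scale_mem algebra_simps)
    have f_real: "f (s (of_real r) x) = of_real r * f x" if "x \<in> V" for r x
    proof -
      have "s i (s (of_real r) x) = s (of_real r) (s i x)"
        using that by (simp add: scale_scale mult.commute)
      then show ?thesis using that by (simp add: f_def g scale_mem algebra_simps)
    qed
    have f_i: "f (s i x) = i * f x" if "x \<in> V" for x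
    proof -
      have "s i (s i x) = s (of_real (-1)) x" using that i by (simp add: scale_scale)
      then have "g (s i (s i x)) = - g x" using g(2)[OF that, of "-1"] by simp
      moreover have "i * f x = i * of_real (g x) - (i * i) * of_real (g (s i x))"
        by (simp add: f_def algebra_simps)
      ultimately show ?thesis using i by (simp add: f_def)
    qed
    have f_scale: "f (s c x) = c * f x" if x: "x \<in> V" for c x
    proof -
      obtain a b where c: "c = of_real a + i * of_real b" using rep by blast
      have "s c x = s (of_real a) x + s i (s (of_real b) x)"
        using x by (simp add: c scale_add_left scale_scale)
      then have "f (s c x) = f (s (of_real a) x) + f (s i (s (of_real b) x))"
        using x by (simp add: f_add scale_mem)
      then show ?thesis
        using x by (simp add: f_i f_real scale_mem c algebra_simps)
    qed
    show thesis
    proof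
      show "norm (f x) \<le> N x" if x: "x \<in> V" for x
      proof (cases "f x = 0")
        case True
        then show ?thesis using norm_ge_0[OF x] by simp
      next
        case False
        define c where "c = of_real (norm (f x)) / f x"
        have "f (s c x) = of_real (norm (f x))" using False x by (simp add: f_scale c_def)
        then have "of_real (g (s c x)) + i * of_real (- g (s i (s c x))) = of_real (norm (f x)) + i * of_real 0"
          by (simp add: f_def)
        from uniq[OF this] have "norm (f x) = g (s c x)" by simp
        also have "\<dots> \<le> N (s c x)" by (intro g scale_mem x)
        also have "\<dots> = N x" using x False by (simp add: norm_scale c_def norm_divide)
        finally show ?thesis .
      qed
      show "N y \<le> norm (f y)"
        using norm_ge[of "g y" "- g (s i y)"] g(4) norm_ge_0[OF y] by (simp only: f_def)
    qed (use f_add f_scale in auto)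
  qed
qed

section \<open>Banach spaces on a carrier\<close>

context banach_space
begin

lemma norm_zero [simp]: "N 0 = 0"
  using norm_eq_0[of 0] zero_mem by simp

lemma norm_minus: "x \<in> V \<Longrightarrow> N (- x) = N x"
  using norm_scale[of x "-1"] by (simp add: scale_minus_one)

lemma norm_diff_commute: "x \<in> V \<Longrightarrow> y \<in> V \<Longrightarrow> N (x - y) = N (y - x)"
  using norm_minus[of "x - y"] by (simp add: diff_mem)

lemma norm_diff_triangle:
  "x \<in> V \<Longrightarrow> y \<in> V \<Longrightarrow> z \<in> V \<Longrightarrow> N (x - z) \<le> N (x - y) + N (y - z)"
  using norm_triangle[of "x - y" "y - z"] by (simp add: diff_mem)

text \<open>With the metric structure of a Banach space the general theory of metric spaces applies to
  \<open>norm_topology\<close>, which by definition is the topology of this metric.\<close>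

sublocale metric: Metric_space V "norm_dist V N"
proof
  show "0 \<le> norm_dist V N x y" for x y
    by (simp add: norm_dist_def norm_ge_0 diff_mem)
  show "norm_dist V N x y = norm_dist V N y x" for x y
    by (simp add: norm_dist_def norm_diff_commute)
  show "(norm_dist V N x y = 0) = (x = y)" if "x \<in> V" "y \<in> V" for x y
    using that by (simp add: norm_dist_def norm_eq_0 diff_mem)
  show "norm_dist V N x z \<le> norm_dist V N x y + norm_dist V N y z" if "x \<in> V" "y \<in> V" "z \<in> V" for x y z
    using that by (simp add: norm_dist_def norm_diff_triangle)
qed

lemma topspace_norm_topology [simp]: "topspace (norm_topology V N) = V"
  by (simp add: norm_topology_def)

lemma openin_norm_topology:
  "openin (norm_topology V N) U \<longleftrightarrow> U \<subseteq> V \<and> (\<forall>x\<in>U. \<exists>r>0. \<forall>y\<in>V. N (y - x) < r \<longrightarrow> y \<in> U)"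
proof -
  have "metric.mball x r \<subseteq> U \<longleftrightarrow> (\<forall>y\<in>V. N (y - x) < r \<longrightarrow> y \<in> U)" if "x \<in> V" for x r
    using that by (auto simp: metric.mball_def norm_dist_def norm_diff_commute[of x])
  then show ?thesis
    unfolding norm_topology_def metric.openin_mtopology by (meson subsetD)
qed

lemma openin_norm_ball: "openin (norm_topology V N) {x \<in> V. N x < r}"
  unfolding openin_norm_topology
proof (intro conjI ballI)
  fix x assume x: "x \<in> {x \<in> V. N x < r}"
  have "N y < r" if "y \<in> V" "N (y - x) < r - N x" for y
    using norm_triangle[of "y - x" x] that x by (simp add: diff_mem)
  then show "\<exists>\<epsilon>>0. \<forall>y\<in>V. N (y - x) < \<epsilon> \<longrightarrow> y \<in> {x \<in> V. N x < r}"
    using x by (intro exI[of _ "r - N x"]) auto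
qed auto

lemma bounded_in_norm_topology_iff:
  "bounded_in s (norm_topology V N) B \<longleftrightarrow> B \<subseteq> V \<and> (\<exists>M. \<forall>x\<in>B. N x \<le> M)"
proof (intro iffI conjI)
  assume B: "bounded_in s (norm_topology V N) B"
  then show "B \<subseteq> V" by (simp add: bounded_in_def)
  obtain r where r: "r > 0" "\<And>c. norm c \<ge> r \<Longrightarrow> B \<subseteq> s c ` {x \<in> V. N x < 1}"
    using B openin_norm_ball[of 1] zero_mem unfolding bounded_in_def by force
  have "N x \<le> r" if "x \<in> B" for x
  proof -
    have "x \<in> s (of_real r) ` {x \<in> V. N x < 1}"
      using r(2)[of "of_real r"] r(1) that by (simp add: subset_iff)
    then obtain y where y: "y \<in> V" "N y < 1" "x = s (of_real r) y"
      by blast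
    then show ?thesis using r(1) by (simp add: norm_scale)
  qed
  then show "\<exists>M. \<forall>x\<in>B. N x \<le> M" by blast
next
  assume "B \<subseteq> V \<and> (\<exists>M. \<forall>x\<in>B. N x \<le> M)"
  then obtain M where B: "B \<subseteq> V" "\<And>x. x \<in> B \<Longrightarrow> N x \<le> M" by blast
  show "bounded_in s (norm_topology V N) B"
    unfolding bounded_in_def
  proof (intro conjI allI impI)
    show "B \<subseteq> topspace (norm_topology V N)" using B by simp
    fix U assume "openin (norm_topology V N) U \<and> 0 \<in> U"
    then obtain r where r: "r > 0" "\<And>y. y \<in> V \<Longrightarrow> N y < r \<Longrightarrow> y \<in> U"
      unfolding openin_norm_topology by (metis diff_zero)
    have "B \<subseteq> s c ` U" if c: "norm c \<ge> (\<bar>M\<bar> + 1) / r" for c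
    proof
      fix x assume x: "x \<in> B"
      have pos: "norm c > 0" using c r(1) by (smt (verit) divide_pos_pos)
      have "(\<bar>M\<bar> + 1) \<le> norm c * r" using c r(1) by (simp add: field_simps)
      then have "N x < norm c * r" using B(2)[OF x] by linarith
      moreover have "N (s (inverse c) x) = N x / norm c"
        using x B(1) norm_scale[of x "inverse c"] by (auto simp: norm_inverse divide_inverse)
      ultimately have "N (s (inverse c) x) < r"
        using pos by (simp add: pos_divide_less_eq mult.commute)
      moreover have "x = s c (s (inverse c) x)" using pos x B(1) by (auto simp: scale_cancel)
      ultimately show "x \<in> s c ` U" using r(2) x B(1) by (blast intro: scale_mem)
    qed
    then show "\<exists>r>0. \<forall>c. r \<le> norm c \<longrightarrow> B \<subseteq> s c ` U"
      using r(1) by (intro exI[of _ "(\<bar>M\<bar> + 1) / r"]) (simp add: add_nonneg_pos)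
  qed
qed

text \<open>In a complete metric space relative compactness is total boundedness, which is the form in which
  compactness is produced and used below.\<close>

lemma relatively_compact_in_norm_topology_iff:
  "relatively_compact_in (norm_topology V N) S \<longleftrightarrow>
    S \<subseteq> V \<and> (\<forall>\<epsilon>>0. \<exists>K. finite K \<and> K \<subseteq> S \<and> (\<forall>x\<in>S. \<exists>y\<in>K. N (x - y) < \<epsilon>))"
proof -
  have "relatively_compact_in (norm_topology V N) S \<longleftrightarrow> S \<subseteq> V \<and> metric.mtotally_bounded S"
    using metric.mtotally_bounded_eq_compact_closure_of[OF complete, of S]
    by (auto simp: relatively_compact_in_def norm_topology_def)
  also have "\<dots> \<longleftrightarrow> S \<subseteq> V \<and> (\<forall>\<epsilon>>0. \<exists>K. finite K \<and> K \<subseteq> S \<and> (\<forall>x\<in>S. \<exists>y\<in>K. N (x - y) < \<epsilon>))"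
  proof (intro conj_cong refl)
    assume S: "S \<subseteq> V"
    have "S \<subseteq> (\<Union>x\<in>K. metric.mball x \<epsilon>) \<longleftrightarrow> (\<forall>x\<in>S. \<exists>y\<in>K. N (x - y) < \<epsilon>)" if "K \<subseteq> S" for K \<epsilon>
    proof -
      have "x \<in> metric.mball y \<epsilon> \<longleftrightarrow> N (x - y) < \<epsilon>" if "x \<in> S" "y \<in> K" for x y
      proof -
        have "x \<in> V" "y \<in> V" using that \<open>K \<subseteq> S\<close> S by auto
        then show ?thesis
          using norm_diff_commute[of x y] by (simp add: metric.in_mball norm_dist_def)
      qed
      then show ?thesis by blast
    qed
    then show "metric.mtotally_bounded S \<longleftrightarrow>
        (\<forall>\<epsilon>>0. \<exists>K. finite K \<and> K \<subseteq> S \<and> (\<forall>x\<in>S. \<exists>y\<in>K. N (x - y) < \<epsilon>))"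
      unfolding metric.mtotally_bounded_def by meson
  qed
  finally show ?thesis .
qed

end

text \<open>The scalar field is itself a Banach space, so that statements about operators into Banach spaces also
  cover functionals.\<close>

lemma banach_space_scalars: "banach_space UNIV (*) (norm :: 'k::real_or_complex \<Rightarrow> real)"
proof
  have "norm_dist UNIV norm = (dist :: 'k \<Rightarrow> _)"
    by (intro ext) (simp add: norm_dist_def dist_norm)
  then show "Metric_space.mcomplete UNIV (norm_dist UNIV (norm :: 'k \<Rightarrow> real))"
    by (simp add: complete_UNIV)
qed (auto simp: algebra_simps norm_mult norm_triangle_ineq)

lemma norm_topology_scalars: "norm_topology UNIV norm = (euclidean :: 'k::real_or_complex topology)"
proof -
  have "norm_dist UNIV norm = (dist :: 'k \<Rightarrow> _)"
    by (intro ext) (simp add: norm_dist_def dist_norm)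
  then show ?thesis by (simp add: norm_topology_def)
qed

section \<open>Operators, duals and adjoints\<close>

lemma operator_cong:
  assumes "operator s \<tau> s' \<tau>' T" "\<And>x. x \<in> topspace \<tau> \<Longrightarrow> T x = T' x"
    and "vector_space_on (topspace \<tau>) s"
  shows "operator s \<tau> s' \<tau>' T'"
proof -
  interpret vector_space_on "topspace \<tau>" s by fact
  have "continuous_map \<tau> \<tau>' T'"
    using assms(1,2) by (auto simp: operator_def intro: continuous_map_eq)
  moreover have "T' (x + y) = T' x + T' y" if "x \<in> topspace \<tau>" "y \<in> topspace \<tau>" for x y
    using assms(1) that assms(2)[of x] assms(2)[of y] assms(2)[OF add_mem[OF that]]
    by (simp add: operator_def)
  moreover have "T' (s c x) = s' c (T' x)" if "x \<in> topspace \<tau>" for c x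
    using assms(1) that assms(2)[of x] assms(2)[OF scale_mem[OF that, of c]]
    by (simp add: operator_def)
  ultimately show ?thesis by (simp add: operator_def)
qed

lemma operator_compose:
  assumes "operator s \<tau> s' \<tau>' T" "operator s' \<tau>' s'' \<tau>'' S"
  shows "operator s \<tau> s'' \<tau>'' (S \<circ> T)"
proof -
  have T: "continuous_map \<tau> \<tau>' T" and S: "continuous_map \<tau>' \<tau>'' S"
    using assms by (auto simp: operator_def)
  have mem: "T x \<in> topspace \<tau>'" if "x \<in> topspace \<tau>" for x
    using continuous_map_funspace[OF T] that by blast
  show ?thesis
    unfolding operator_def
  proof (intro conjI ballI allI)
    show "continuous_map \<tau> \<tau>'' (S \<circ> T)" by (rule continuous_map_compose[OF T S])
    show "(S \<circ> T) (x + y) = (S \<circ> T) x + (S \<circ> T) y" if "x \<in> topspace \<tau>" "y \<in> topspace \<tau>" for x y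
      using assms that mem by (simp add: operator_def)
    show "(S \<circ> T) (s c x) = s'' c ((S \<circ> T) x)" if "x \<in> topspace \<tau>" for c x
      using assms that mem by (simp add: operator_def)
  qed
qed

lemma operator_mem: "operator s \<tau> s' \<tau>' T \<Longrightarrow> x \<in> topspace \<tau> \<Longrightarrow> T x \<in> topspace \<tau>'"
  unfolding operator_def using continuous_map_funspace by blast

lemma operator_add:
  "operator s \<tau> s' \<tau>' T \<Longrightarrow> x \<in> topspace \<tau> \<Longrightarrow> y \<in> topspace \<tau> \<Longrightarrow> T (x + y) = T x + T y"
  by (simp add: operator_def)

lemma operator_scale:
  "operator s \<tau> s' \<tau>' T \<Longrightarrow> x \<in> topspace \<tau> \<Longrightarrow> T (s c x) = s' c (T x)"
  by (simp add: operator_def)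

lemma operator_zero:
  assumes "operator s \<tau> s' \<tau>' T" "0 \<in> topspace \<tau>"
  shows "T 0 = 0"
  using operator_add[OF assms(1) assms(2) assms(2)] by simp

lemma operator_diff:
  assumes "operator s \<tau> s' \<tau>' T" "x \<in> topspace \<tau>" "y \<in> topspace \<tau>" "x - y \<in> topspace \<tau>"
  shows "T (x - y) = T x - T y"
  using operator_add[OF assms(1,4,3)] by simp

lemma openin_operator_vimage:
  "operator s \<tau> s' \<tau>' T \<Longrightarrow> openin \<tau>' U \<Longrightarrow> openin \<tau> {x \<in> topspace \<tau>. T x \<in> U}"
  unfolding operator_def by (blast intro: openin_continuous_map_preimage)

lemma bounded_in_operator_image:
  assumes T: "operator s \<tau> s' \<tau>' T" and B: "bounded_in s \<tau> B" and "0 \<in> topspace \<tau>"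
  shows "bounded_in s' \<tau>' (T ` B)"
  unfolding bounded_in_def
proof (intro conjI allI impI)
  have BV: "B \<subseteq> topspace \<tau>" using B by (simp add: bounded_in_def)
  then show "T ` B \<subseteq> topspace \<tau>'" using operator_mem[OF T] by blast
  fix U assume U: "openin \<tau>' U \<and> 0 \<in> U"
  let ?W = "{x \<in> topspace \<tau>. T x \<in> U}"
  have "openin \<tau> ?W" "0 \<in> ?W"
    using openin_operator_vimage[OF T] U operator_zero[OF T] assms(3) by auto
  then obtain r where r: "r > 0" "\<And>c. r \<le> norm c \<Longrightarrow> B \<subseteq> s c ` ?W"
    using B unfolding bounded_in_def by blast
  have "T ` B \<subseteq> s' c ` U" if "r \<le> norm c" for c
  proof -
    have "T ` B \<subseteq> T ` s c ` ?W" using r(2)[OF that] by blast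
    also have "\<dots> \<subseteq> s' c ` U" using operator_scale[OF T] by auto
    finally show ?thesis .
  qed
  with r(1) show "\<exists>r>0. \<forall>c. r \<le> norm c \<longrightarrow> T ` B \<subseteq> s' c ` U" by blast
qed

lemma dual_iff:
  "f \<in> dual s \<tau> \<longleftrightarrow> operator s \<tau> (*) (norm_topology UNIV norm) f \<and> (\<forall>x. x \<notin> topspace \<tau> \<longrightarrow> f x = 0)"
  by (simp add: dual_def norm_topology_scalars)

lemma dual_operator: "f \<in> dual s \<tau> \<Longrightarrow> operator s \<tau> (*) euclidean f"
  by (simp add: dual_def)

lemma dual_add: "f \<in> dual s \<tau> \<Longrightarrow> x \<in> topspace \<tau> \<Longrightarrow> y \<in> topspace \<tau> \<Longrightarrow> f (x + y) = f x + f y"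
  by (simp add: dual_def operator_def)

lemma dual_scale: "f \<in> dual s \<tau> \<Longrightarrow> x \<in> topspace \<tau> \<Longrightarrow> f (s c x) = c * f x"
  by (simp add: dual_def operator_def)

lemma dual_bounded_on:
  fixes f :: "'v::ab_group_add \<Rightarrow> 'k::real_or_complex"
  assumes f: "f \<in> dual s \<tau>" and B: "bounded_in s \<tau> B" and "0 \<in> topspace \<tau>"
  obtains M where "M \<ge> 0" "\<And>x. x \<in> B \<Longrightarrow> norm (f x) \<le> M"
proof -
  interpret K: banach_space UNIV "(*)" "norm :: 'k \<Rightarrow> real" by (rule banach_space_scalars)
  have "bounded_in (*) (norm_topology UNIV norm) (f ` B)"
    using f bounded_in_operator_image[OF _ B assms(3)] unfolding dual_iff by blast
  then obtain M where "\<And>x. x \<in> B \<Longrightarrow> norm (f x) \<le> M"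
    unfolding K.bounded_in_norm_topology_iff by auto
  then have "\<And>x. x \<in> B \<Longrightarrow> norm (f x) \<le> \<bar>M\<bar>" by (meson abs_ge_self order_trans)
  then show thesis using that[of "\<bar>M\<bar>"] by simp
qed

lemma zero_in_dual: "0 \<in> dual s \<tau>"
  by (simp add: dual_def operator_def zero_fun_def)

lemma add_in_dual: "f \<in> dual s \<tau> \<Longrightarrow> g \<in> dual s \<tau> \<Longrightarrow> f + g \<in> dual s \<tau>"
  by (auto simp: dual_def operator_def plus_fun_def algebra_simps intro!: continuous_map_add)

lemma fscale_in_dual: "f \<in> dual s \<tau> \<Longrightarrow> fscale c f \<in> dual s \<tau>"
  by (auto simp: dual_def operator_def fscale_def algebra_simps
      intro!: continuous_map_compose[of \<tau> euclidean f euclidean "(*) c", unfolded comp_def] continuous_intros)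

lemma vector_space_on_dual: "vector_space_on (dual s \<tau>) fscale"
  by standard (auto simp: zero_in_dual add_in_dual fscale_in_dual, auto simp: fscale_def plus_fun_def algebra_simps)

lemma sum_in_dual: "(\<And>i. i \<in> I \<Longrightarrow> f i \<in> dual s \<tau>) \<Longrightarrow> (\<Sum>i\<in>I. f i) \<in> dual s \<tau>"
  by (induction I rule: infinite_finite_induct) (auto simp: zero_in_dual intro: add_in_dual)

lemma diff_in_dual: "f \<in> dual s \<tau> \<Longrightarrow> g \<in> dual s \<tau> \<Longrightarrow> f - g \<in> dual s \<tau>"
  using vector_space_on.diff_mem[OF vector_space_on_dual] .

lemma sum_fun_apply: "(\<Sum>i\<in>I. f i) x = (\<Sum>i\<in>I. f i x :: 'a::comm_monoid_add)"
  by (induction I rule: infinite_finite_induct) auto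

lemma fscale_apply: "fscale c f x = c * f x"
  by (simp add: fscale_def)

text \<open>The defining base of neighbourhoods of zero, as an elimination rule: the only way in which open
  sets of the strong topology are exploited.\<close>

lemma strong_nhd_zero:
  assumes "openin (strong_topology s \<tau>) U" "0 \<in> U"
  obtains B \<epsilon> where "bounded_in s \<tau> B" "\<epsilon> > 0" "{g \<in> dual s \<tau>. \<forall>x\<in>B. norm (g x) < \<epsilon>} \<subseteq> U"
  using assms unfolding openin_strong_topology by fastforce

text \<open>Members of the bidual are the linear functionals bounded on the polar of some bounded set. In this
  form no topology remains when bidual elements are constructed or used. Continuity at zero
  gives the polar with radius \<open>\<epsilon>\<close>, which scaling turns into radius 1; the converse translates the
  estimate from zero to an arbitrary functional.\<close>

lemma bidual_iff:
  fixes s :: "'k::real_or_complex \<Rightarrow> 'v::ab_group_add \<Rightarrow> 'v"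
  shows "\<phi> \<in> dual fscale (strong_topology s \<tau>) \<longleftrightarrow>
    (\<forall>f\<in>dual s \<tau>. \<forall>g\<in>dual s \<tau>. \<phi> (f + g) = \<phi> f + \<phi> g) \<and>
    (\<forall>c. \<forall>f\<in>dual s \<tau>. \<phi> (fscale c f) = c * \<phi> f) \<and> (\<forall>f. f \<notin> dual s \<tau> \<longrightarrow> \<phi> f = 0) \<and>
    (\<exists>B D. bounded_in s \<tau> B \<and> D \<ge> 0 \<and> (\<forall>f\<in>dual s \<tau>. (\<forall>x\<in>B. norm (f x) \<le> 1) \<longrightarrow> norm (\<phi> f) \<le> D))"
    (is "_ \<longleftrightarrow> ?add \<and> ?scale \<and> ?off \<and> ?bd")
proof (intro iffI conjI)
  assume phi: "\<phi> \<in> dual fscale (strong_topology s \<tau>)"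
  then show ?add ?scale ?off by (auto simp: dual_def operator_def)
  let ?U = "{f \<in> dual s \<tau>. \<phi> f \<in> ball 0 1}"
  have "openin (strong_topology s \<tau>) ?U"
    using openin_operator_vimage[OF dual_operator[OF phi], of "ball 0 1"] by simp
  moreover have "0 \<in> ?U"
    using operator_zero[OF dual_operator[OF phi]] by (simp add: zero_in_dual)
  ultimately obtain B \<epsilon> where B: "bounded_in s \<tau> B" "\<epsilon> > 0"
    and U: "{g \<in> dual s \<tau>. \<forall>x\<in>B. norm (g x) < \<epsilon>} \<subseteq> ?U"
    by (rule strong_nhd_zero)
  have "norm (\<phi> f) \<le> 2 / \<epsilon>" if f: "f \<in> dual s \<tau>" "\<forall>x\<in>B. norm (f x) \<le> 1" for f
  proof -
    have "norm (fscale (of_real (\<epsilon> / 2)) f x) < \<epsilon>" if "x \<in> B" for x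
    proof -
      have "norm (fscale (of_real (\<epsilon> / 2)) f x) = \<epsilon> / 2 * norm (f x)"
        using B(2) by (simp add: fscale_def norm_mult)
      also have "\<dots> \<le> \<epsilon> / 2 * 1" using f that B(2) by (intro mult_left_mono) auto
      finally show ?thesis using B(2) by simp
    qed
    then have "fscale (of_real (\<epsilon> / 2)) f \<in> ?U"
      using U fscale_in_dual[OF f(1)] by blast
    then have "norm (\<phi> (fscale (of_real (\<epsilon> / 2)) f)) < 1" by simp
    also have "\<phi> (fscale (of_real (\<epsilon> / 2)) f) = of_real (\<epsilon> / 2) * \<phi> f"
      using \<open>?scale\<close> f(1) by blast
    finally show ?thesis using B(2) by (simp add: norm_mult field_simps)
  qed
  with B show ?bd by (intro exI[of _ B] exI[of _ "2 / \<epsilon>"]) auto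
next
  assume asm: "?add \<and> ?scale \<and> ?off \<and> ?bd"
  then obtain B D where B: "bounded_in s \<tau> B" "D \<ge> 0"
    and D: "\<And>f. f \<in> dual s \<tau> \<Longrightarrow> \<forall>x\<in>B. norm (f x) \<le> 1 \<Longrightarrow> norm (\<phi> f) \<le> D" by blast
  have "continuous_map (strong_topology s \<tau>) euclidean \<phi>"
    unfolding continuous_map
  proof (intro conjI allI impI)
    fix W :: "'k set" assume W: "openin euclidean W"
    show "openin (strong_topology s \<tau>) {f \<in> topspace (strong_topology s \<tau>). \<phi> f \<in> W}"
      unfolding openin_strong_topology topspace_strong_topology
    proof (intro conjI ballI)
      fix f assume f: "f \<in> {f \<in> dual s \<tau>. \<phi> f \<in> W}"
      then obtain e where e: "e > 0" "ball (\<phi> f) e \<subseteq> W"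
        using W by (auto simp: open_contains_ball)
      define \<epsilon> where "\<epsilon> = e / (D + 1)"
      have eps: "\<epsilon> > 0" using e B by (simp add: \<epsilon>_def)
      have "\<phi> g \<in> W" if g: "g \<in> dual s \<tau>" "\<forall>x\<in>B. norm (g x - f x) < \<epsilon>" for g
      proof -
        define h where "h = fscale (of_real (1 / \<epsilon>)) (g - f)"
        have h: "h \<in> dual s \<tau>" using f g by (auto simp: h_def intro!: fscale_in_dual diff_in_dual)
        have "norm (h x) \<le> 1" if "x \<in> B" for x
          using g(2) that eps by (auto simp: h_def fscale_def norm_mult norm_divide field_simps less_imp_le)
        then have le: "norm (\<phi> h) \<le> D" using D h by blast
        have gf: "g = f + fscale (of_real \<epsilon>) h"
          using eps by (auto simp: h_def fscale_def fun_eq_iff)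
        have "\<phi> g = \<phi> f + \<phi> (fscale (of_real \<epsilon>) h)"
          using asm f h by (subst gf) (simp add: fscale_in_dual)
        also have "\<phi> (fscale (of_real \<epsilon>) h) = of_real \<epsilon> * \<phi> h" using asm h by blast
        finally have "dist (\<phi> f) (\<phi> g) = \<epsilon> * norm (\<phi> h)"
          using eps by (simp add: dist_norm norm_minus_commute norm_mult)
        also have "\<dots> \<le> \<epsilon> * D" using le eps by simp
        also have "\<dots> < e" using e B(2) by (simp add: \<epsilon>_def field_simps)
        finally show ?thesis using e(2) by (auto simp: subset_iff)
      qed
      with B(1) eps f show "\<exists>B \<epsilon>. bounded_in s \<tau> B \<and> 0 < \<epsilon> \<and>
          {g \<in> dual s \<tau>. \<forall>x\<in>B. norm (g x - f x) < \<epsilon>} \<subseteq> {f \<in> dual s \<tau>. \<phi> f \<in> W}"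
        by (intro exI[of _ B] exI[of _ \<epsilon>]) auto
    qed auto
  qed auto
  with asm show "\<phi> \<in> dual fscale (strong_topology s \<tau>)"
    by (simp add: dual_def operator_def)
qed

lemma adjoint_in_dual:
  assumes T: "operator s \<tau> s' \<tau>' T" and f: "f \<in> dual s' \<tau>'" and "vector_space_on (topspace \<tau>) s"
  shows "adjoint_map \<tau> T f \<in> dual s \<tau>"
proof -
  have "operator s \<tau> (*) euclidean (adjoint_map \<tau> T f)"
    using operator_cong[OF operator_compose[OF T dual_operator[OF f]] _ assms(3), of "adjoint_map \<tau> T f"]
    by (simp add: adjoint_map_def)
  then show ?thesis by (simp add: dual_def adjoint_map_def)
qed

text \<open>Continuity of the adjoint for the strong topologies, because operators map bounded sets to bounded
  sets.\<close>

lemma operator_adjoint: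
  assumes T: "operator s \<tau> s' \<tau>' T" and V: "vector_space_on (topspace \<tau>) s"
  shows "operator fscale (strong_topology s' \<tau>') fscale (strong_topology s \<tau>) (adjoint_map \<tau> T)"
proof -
  interpret vector_space_on "topspace \<tau>" s by fact
  have "continuous_map (strong_topology s' \<tau>') (strong_topology s \<tau>) (adjoint_map \<tau> T)"
    unfolding continuous_map
  proof (intro conjI allI impI)
    show "adjoint_map \<tau> T ` topspace (strong_topology s' \<tau>') \<subseteq> topspace (strong_topology s \<tau>)"
      using adjoint_in_dual[OF T _ V] by auto
    fix W assume W: "openin (strong_topology s \<tau>) W"
    show "openin (strong_topology s' \<tau>') {f \<in> topspace (strong_topology s' \<tau>'). adjoint_map \<tau> T f \<in> W}"
      unfolding openin_strong_topology topspace_strong_topology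
    proof (intro conjI ballI)
      fix f assume f: "f \<in> {f \<in> dual s' \<tau>'. adjoint_map \<tau> T f \<in> W}"
      then obtain B \<epsilon> where B: "bounded_in s \<tau> B" "\<epsilon> > 0"
        and sub: "{g \<in> dual s \<tau>. \<forall>x\<in>B. norm (g x - adjoint_map \<tau> T f x) < \<epsilon>} \<subseteq> W"
        using W unfolding openin_strong_topology by blast
      have "B \<subseteq> topspace \<tau>" using B by (simp add: bounded_in_def)
      then have "\<forall>x\<in>B. norm (adjoint_map \<tau> T g x - adjoint_map \<tau> T f x) < \<epsilon>"
        if "\<forall>y\<in>T ` B. norm (g y - f y) < \<epsilon>" for g
        using that by (auto simp: adjoint_map_def)
      then have "adjoint_map \<tau> T g \<in> W" if "g \<in> dual s' \<tau>'" "\<forall>y\<in>T ` B. norm (g y - f y) < \<epsilon>" for g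
        using that sub adjoint_in_dual[OF T that(1) V] by blast
      with B zero_mem bounded_in_operator_image[OF T B(1)]
      show "\<exists>B \<epsilon>. bounded_in s' \<tau>' B \<and> 0 < \<epsilon> \<and> {g \<in> dual s' \<tau>'. \<forall>x\<in>B. norm (g x - f x) < \<epsilon>}
          \<subseteq> {f \<in> dual s' \<tau>'. adjoint_map \<tau> T f \<in> W}"
        by (intro exI[of _ "T ` B"] exI[of _ \<epsilon>]) auto
    qed auto
  qed
  then show ?thesis
    by (auto simp: operator_def adjoint_map_def fscale_def fun_eq_iff)
qed

section \<open>Weakly p-summable sequences under operators\<close>

text \<open>Composing a functional with an operator is applying the adjoint, so weak \<open>p\<close>-summability passes to
  images; hence so do weakly \<open>p\<close>-Cauchy sequences and weak sequential \<open>p\<close>-precompactness, which makes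
  the weakly sequentially \<open>p\<close>-precompact operators a two-sided ideal.\<close>

lemma weakly_p_summable_operator_image:
  assumes S: "operator s \<tau> s' \<tau>' S" and V: "vector_space_on (topspace \<tau>) s"
    and x: "weakly_p_summable p s \<tau> x"
  shows "weakly_p_summable p s' \<tau>' (\<lambda>n. S (x n))"
proof -
  have mem: "x n \<in> topspace \<tau>" for n using x by (auto simp: weakly_p_summable_def)
  have "(\<lambda>n. \<phi> (S (x n))) \<in> ell p" if "\<phi> \<in> dual s' \<tau>'" for \<phi>
  proof -
    have "(\<lambda>n. adjoint_map \<tau> S \<phi> (x n)) \<in> ell p"
      using x adjoint_in_dual[OF S that V] unfolding weakly_p_summable_def by blast
    then show ?thesis using mem by (simp add: adjoint_map_def)
  qed
  then show ?thesis using mem operator_mem[OF S] by (auto simp: weakly_p_summable_def)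
qed

lemma weakly_p_Cauchy_operator_image:
  assumes S: "operator s \<tau> s' \<tau>' S" and V: "vector_space_on (topspace \<tau>) s"
    and x: "weakly_p_Cauchy p s \<tau> x"
  shows "weakly_p_Cauchy p s' \<tau>' (\<lambda>n. S (x n))"
proof -
  interpret vector_space_on "topspace \<tau>" s by fact
  have mem: "x n \<in> topspace \<tau>" for n using x by (auto simp: weakly_p_Cauchy_def)
  have "weakly_p_summable p s' \<tau>' (\<lambda>n. S (x (k n)) - S (x (j n)))"
    if "strict_mono k" "strict_mono j" for k j
  proof -
    have "weakly_p_summable p s' \<tau>' (\<lambda>n. S (x (k n) - x (j n)))"
      using x that by (intro weakly_p_summable_operator_image[OF S V]) (simp add: weakly_p_Cauchy_def)
    then show ?thesis using mem by (simp add: operator_diff[OF S] diff_mem)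
  qed
  then show ?thesis using mem operator_mem[OF S] by (auto simp: weakly_p_Cauchy_def)
qed

lemma weakly_seq_p_precompact_operator_image:
  assumes S: "operator s \<tau> s' \<tau>' S" and V: "vector_space_on (topspace \<tau>) s"
    and C: "weakly_seq_p_precompact p s \<tau> C"
  shows "weakly_seq_p_precompact p s' \<tau>' (S ` C)"
  unfolding weakly_seq_p_precompact_def
proof (intro conjI allI impI)
  show "S ` C \<subseteq> topspace \<tau>'"
    using C operator_mem[OF S] by (auto simp: weakly_seq_p_precompact_def)
  fix y :: "nat \<Rightarrow> _" assume "range y \<subseteq> S ` C"
  then have "\<forall>n. \<exists>x. x \<in> C \<and> y n = S x" by blast
  then obtain x where x: "\<And>n. x n \<in> C" "\<And>n. y n = S (x n)" by metis
  then obtain r where "strict_mono r" "weakly_p_Cauchy p s \<tau> (x \<circ> r)"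
    using C unfolding weakly_seq_p_precompact_def by blast
  then show "\<exists>r. strict_mono r \<and> weakly_p_Cauchy p s' \<tau>' (y \<circ> r)"
    using weakly_p_Cauchy_operator_image[OF S V, of p "x \<circ> r"] x(2) by (auto simp: comp_def)
qed

lemma weakly_seq_p_precompact_mono:
  assumes "weakly_seq_p_precompact p s \<tau> C" "D \<subseteq> C"
  shows "weakly_seq_p_precompact p s \<tau> D"
  unfolding weakly_seq_p_precompact_def
proof (intro conjI allI impI)
  show "D \<subseteq> topspace \<tau>" using assms by (auto simp: weakly_seq_p_precompact_def)
  fix x :: "nat \<Rightarrow> _" assume "range x \<subseteq> D"
  then have "range x \<subseteq> C" using assms(2) by (rule subset_trans)
  with assms(1) show "\<exists>r. strict_mono r \<and> weakly_p_Cauchy p s \<tau> (x \<circ> r)"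
    unfolding weakly_seq_p_precompact_def by blast
qed

lemma weakly_seq_p_precompact_operator_postcompose:
  assumes R: "weakly_seq_p_precompact_operator p s \<tau> s' \<tau>' R"
    and S: "operator s' \<tau>' s'' \<tau>'' S" and V: "vector_space_on (topspace \<tau>') s'"
  shows "weakly_seq_p_precompact_operator p s \<tau> s'' \<tau>'' (S \<circ> R)"
proof -
  obtain U where U: "openin \<tau> U" "0 \<in> U" "weakly_seq_p_precompact p s' \<tau>' (R ` U)"
    and R': "operator s \<tau> s' \<tau>' R"
    using R by (auto simp: weakly_seq_p_precompact_operator_def)
  have "weakly_seq_p_precompact p s'' \<tau>'' ((S \<circ> R) ` U)"
    using weakly_seq_p_precompact_operator_image[OF S V U(3)] by (simp add: image_comp)
  with U operator_compose[OF R' S] show ?thesis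
    unfolding weakly_seq_p_precompact_operator_def by blast
qed

lemma weakly_seq_p_precompact_operator_precompose:
  assumes R: "operator s \<tau> s' \<tau>' R" and S: "weakly_seq_p_precompact_operator p s' \<tau>' s'' \<tau>'' S"
    and "0 \<in> topspace \<tau>"
  shows "weakly_seq_p_precompact_operator p s \<tau> s'' \<tau>'' (S \<circ> R)"
proof -
  obtain U where U: "openin \<tau>' U" "0 \<in> U" "weakly_seq_p_precompact p s'' \<tau>'' (S ` U)"
    and S': "operator s' \<tau>' s'' \<tau>'' S"
    using S by (auto simp: weakly_seq_p_precompact_operator_def)
  let ?W = "{x \<in> topspace \<tau>. R x \<in> U}"
  have "(S \<circ> R) ` ?W \<subseteq> S ` U" by auto
  then have "weakly_seq_p_precompact p s'' \<tau>'' ((S \<circ> R) ` ?W)"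
    using U(3) by (rule weakly_seq_p_precompact_mono[rotated])
  moreover have "openin \<tau> ?W" "0 \<in> ?W"
    using openin_operator_vimage[OF R U(1)] operator_zero[OF R] U(2) assms(3) by auto
  ultimately show ?thesis
    using operator_compose[OF R S'] unfolding weakly_seq_p_precompact_operator_def by blast
qed

lemma relatively_compact_in_continuous_image:
  assumes "continuous_map X Y f" "Hausdorff_space Y" "relatively_compact_in X S"
  shows "relatively_compact_in Y (f ` S)"
proof -
  have S: "S \<subseteq> topspace X" and c: "compactin X (X closure_of S)"
    using assms(3) by (auto simp: relatively_compact_in_def)
  have K: "compactin Y (f ` (X closure_of S))"
    using image_compactin[OF c assms(1)] .
  have "f ` S \<subseteq> f ` (X closure_of S)"
    using closure_of_subset[OF S] by blast
  then have "Y closure_of (f ` S) \<subseteq> f ` (X closure_of S)"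
    using compactin_imp_closedin[OF assms(2) K] by (rule closure_of_minimal)
  then have "compactin Y (Y closure_of (f ` S))"
    by (rule closed_compactin[OF K _ closedin_closure_of])
  moreover have "f ` S \<subseteq> topspace Y"
    using image_mono[OF S, of f] continuous_map_image_subset_topspace[OF assms(1)] by (rule subset_trans)
  ultimately show ?thesis
    by (simp add: relatively_compact_in_def)
qed

section \<open>The spaces \<open>\<ell>\<^sub>p\<close>\<close>

text \<open>Convexity of the \<open>p\<close>-th power on the closed half-line. When one argument vanishes, it reduces to
  \<open>u powr p \<le> u\<close> for \<open>u\<close> in the unit interval.\<close>

lemma powr_convex_combination:
  fixes a b t p :: real
  assumes "a \<ge> 0" "b \<ge> 0" "0 \<le> t" "t \<le> 1" "1 \<le> p"
  shows "((1 - t) * a + t * b) powr p \<le> (1 - t) * a powr p + t * b powr p"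
proof -
  have scale: "(u * c) powr p \<le> u * c powr p" if "0 \<le> u" "u \<le> 1" "c \<ge> 0" for u c :: real
  proof -
    have "u powr p \<le> u" using powr_mono'[of 1 p u] that assms by simp
    then show ?thesis using that by (auto simp: powr_mult intro!: mult_right_mono)
  qed
  consider "a = 0" | "b = 0" | "a > 0" "b > 0" using assms by linarith
  then show ?thesis
  proof cases
    case 1
    then show ?thesis using scale[of t b] assms by simp
  next
    case 2
    then show ?thesis using scale[of "1 - t" a] assms by simp
  next
    case 3
    then show ?thesis
      using convex_onD[OF powr_convex[OF assms(5)], of t a b] assms by simp
  qed
qed

text \<open>Minkowski's inequality for finite sums. The bounds \<open>\<alpha>\<close> and \<open>\<beta>\<close> are strictly positive numbers above the two
  norms, so that dividing by them is harmless: \<open>(a + b) / (\<alpha> + \<beta>)\<close> is a convex combination of \<open>a / \<alpha>\<close>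
  and \<open>b / \<beta>\<close>, with weights proportional to \<open>\<alpha>\<close> and \<open>\<beta>\<close>, and the \<open>p\<close>-th power is convex.\<close>

lemma minkowski_sum:
  fixes a b :: "'i \<Rightarrow> real"
  assumes "1 \<le> p" "\<And>i. i \<in> I \<Longrightarrow> a i \<ge> 0" "\<And>i. i \<in> I \<Longrightarrow> b i \<ge> 0" "\<alpha> > 0" "\<beta> > 0"
    and a: "(\<Sum>i\<in>I. a i powr p) \<le> \<alpha> powr p" and b: "(\<Sum>i\<in>I. b i powr p) \<le> \<beta> powr p"
  shows "(\<Sum>i\<in>I. (a i + b i) powr p) \<le> (\<alpha> + \<beta>) powr p"
proof -
  define t where "t = \<beta> / (\<alpha> + \<beta>)"
  have t: "0 \<le> t" "t \<le> 1" "1 - t = \<alpha> / (\<alpha> + \<beta>)"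
    using assms by (auto simp: t_def field_simps)
  have "(a i + b i) powr p \<le> (\<alpha> + \<beta>) powr p * ((1 - t) * (a i powr p / \<alpha> powr p) + t * (b i powr p / \<beta> powr p))"
    if i: "i \<in> I" for i
  proof -
    have "a i + b i = (\<alpha> + \<beta>) * ((1 - t) * (a i / \<alpha>) + t * (b i / \<beta>))"
    proof -
      have "(\<alpha> + \<beta>) * (1 - t) = \<alpha>" "(\<alpha> + \<beta>) * t = \<beta>"
        unfolding t(3) using assms by (simp_all add: t_def)
      then have "(\<alpha> + \<beta>) * ((1 - t) * (a i / \<alpha>) + t * (b i / \<beta>)) = \<alpha> * (a i / \<alpha>) + \<beta> * (b i / \<beta>)"
        by (simp only: distrib_left mult.assoc[symmetric])
      then show ?thesis using assms by simp
    qed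
    then have "(a i + b i) powr p = (\<alpha> + \<beta>) powr p * ((1 - t) * (a i / \<alpha>) + t * (b i / \<beta>)) powr p"
      using assms i t by (simp add: powr_mult)
    also have "\<dots> \<le> (\<alpha> + \<beta>) powr p * ((1 - t) * (a i / \<alpha>) powr p + t * (b i / \<beta>) powr p)"
      using assms i t by (intro mult_left_mono powr_convex_combination) auto
    finally show ?thesis using assms i by (simp add: powr_divide)
  qed
  then have "(\<Sum>i\<in>I. (a i + b i) powr p) \<le>
      (\<Sum>i\<in>I. (\<alpha> + \<beta>) powr p * ((1 - t) * (a i powr p / \<alpha> powr p) + t * (b i powr p / \<beta> powr p)))"
    by (rule sum_mono)
  also have "\<dots> = (\<alpha> + \<beta>) powr p *
      ((1 - t) * ((\<Sum>i\<in>I. a i powr p) / \<alpha> powr p) + t * ((\<Sum>i\<in>I. b i powr p) / \<beta> powr p))"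
    by (simp only: sum_divide_distrib sum_distrib_left sum.distrib distrib_left)
  also have "\<dots> \<le> (\<alpha> + \<beta>) powr p * ((1 - t) * 1 + t * 1)"
    using assms t by (intro mult_left_mono add_mono) auto
  finally show ?thesis by simp
qed

lemma ell_norm_nonneg: "ell_norm p x \<ge> 0"
  by (simp add: ell_norm_def)

lemma ell_norm_powr:
  assumes "0 < p" "x \<in> ell p"
  shows "ell_norm p x powr p = (\<Sum>n. norm (x n) powr p)"
proof -
  have "(\<Sum>n. norm (x n) powr p) \<ge> 0"
    using assms by (intro suminf_nonneg) (auto simp: ell_def)
  then show ?thesis using assms by (simp add: ell_norm_def powr_powr)
qed

lemma sum_le_ell_norm:
  assumes "0 < p" "x \<in> ell p" "finite I"
  shows "(\<Sum>n\<in>I. norm (x n) powr p) \<le> ell_norm p x powr p"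
  using assms by (auto simp: ell_norm_powr ell_def intro!: sum_le_suminf)

text \<open>Membership in \<open>ell p\<close> and bounds of the norm are always obtained from a uniform bound on the finite
  sections.\<close>

lemma ell_norm_leI:
  assumes "0 < p" "c \<ge> 0" and le: "\<And>N. (\<Sum>n<N. norm (x n) powr p) \<le> c powr p"
  shows ell_memI: "x \<in> ell p" and "ell_norm p x \<le> c"
proof -
  have s: "summable (\<lambda>n. norm (x n) powr p)"
  proof (rule bounded_imp_summable)
    show "(\<Sum>k\<le>n. norm (x k) powr p) \<le> c powr p" for n
      using le[of "Suc n"] by (simp only: lessThan_Suc_atMost)
  qed simp
  then show mem: "x \<in> ell p" by (simp add: ell_def)
  have "ell_norm p x powr p \<le> c powr p"
    using suminf_le_const[OF s le] assms(1) mem by (simp add: ell_norm_powr)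
  then show "ell_norm p x \<le> c"
    using assms(1,2) ell_norm_nonneg[of p x] by (meson leI not_le powr_less_mono2)
qed

lemma norm_le_ell_norm:
  assumes "0 < p" "x \<in> ell p"
  shows "norm (x n) \<le> ell_norm p x"
proof -
  have "norm (x n) powr p \<le> ell_norm p x powr p"
    using sum_le_ell_norm[OF assms, of "{n}"] by simp
  then show ?thesis
    using assms(1) ell_norm_nonneg[of p x] by (meson leI not_le powr_less_mono2 norm_ge_zero)
qed

lemma ell_norm_triangle:
  assumes p: "1 \<le> p" and x: "x \<in> ell p" and y: "y \<in> ell p"
  shows ell_add: "x + y \<in> ell p" and "ell_norm p (x + y) \<le> ell_norm p x + ell_norm p y"
proof -
  have *: "(\<Sum>n<N. norm ((x + y) n) powr p) \<le> (ell_norm p x + ell_norm p y + e) powr p" if "e > 0" for e N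
  proof -
    have "(\<Sum>n<N. norm ((x + y) n) powr p) \<le> (\<Sum>n<N. (norm (x n) + norm (y n)) powr p)"
      using p by (intro sum_mono powr_mono2) (auto intro: norm_triangle_ineq)
    also have "\<dots> \<le> ((ell_norm p x + e / 2) + (ell_norm p y + e / 2)) powr p"
    proof (rule minkowski_sum)
      show "(\<Sum>n<N. norm (x n) powr p) \<le> (ell_norm p x + e / 2) powr p"
        using sum_le_ell_norm[of p x "{..<N}"] p x that ell_norm_nonneg[of p x]
        by (smt (verit) field_sum_of_halves finite_lessThan powr_mono2)
      show "(\<Sum>n<N. norm (y n) powr p) \<le> (ell_norm p y + e / 2) powr p"
        using sum_le_ell_norm[of p y "{..<N}"] p y that ell_norm_nonneg[of p y]
        by (smt (verit) field_sum_of_halves finite_lessThan powr_mono2)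
    qed (use p that ell_norm_nonneg[of p x] ell_norm_nonneg[of p y] in auto)
    finally show ?thesis by (simp add: algebra_simps)
  qed
  have nn: "ell_norm p x + ell_norm p y + e \<ge> 0" if "e > 0" for e
    using that ell_norm_nonneg[of p x] ell_norm_nonneg[of p y] by simp
  show "x + y \<in> ell p"
    using * p nn[of 1] by (intro ell_memI[of p "ell_norm p x + ell_norm p y + 1"]) auto
  show "ell_norm p (x + y) \<le> ell_norm p x + ell_norm p y"
  proof (rule field_le_epsilon)
    fix e :: real assume "e > 0"
    then show "ell_norm p (x + y) \<le> ell_norm p x + ell_norm p y + e"
      using * p nn by (intro ell_norm_leI) auto
  qed
qed

lemma ell_scale:
  assumes "x \<in> ell p"
  shows "fscale c x \<in> ell p"
  using assms by (auto simp: ell_def fscale_def norm_mult powr_mult intro: summable_mult)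

lemma ell_norm_scale:
  assumes "0 < p" "x \<in> ell p"
  shows "ell_norm p (fscale c x) = norm c * ell_norm p x"
proof -
  have "(\<Sum>n. norm (fscale c x n) powr p) = norm c powr p * (\<Sum>n. norm (x n) powr p)"
    using assms by (simp add: fscale_def norm_mult powr_mult ell_def suminf_mult)
  moreover have "(\<Sum>n. norm (x n) powr p) \<ge> 0"
    using assms by (intro suminf_nonneg) (auto simp: ell_def)
  ultimately show ?thesis
    using assms by (simp add: ell_norm_def powr_mult powr_powr)
qed

lemma vector_space_on_ell:
  assumes "1 \<le> p"
  shows "vector_space_on (ell p :: (nat \<Rightarrow> 'k::real_or_complex) set) fscale"
proof
  show "0 \<in> (ell p :: (nat \<Rightarrow> 'k) set)" by (simp add: ell_def)
  show "x + y \<in> ell p" if "x \<in> ell p" "y \<in> ell p" for x y :: "nat \<Rightarrow> 'k"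
    using assms that by (rule ell_add)
  show "fscale c x \<in> ell p" if "x \<in> ell p" for x :: "nat \<Rightarrow> 'k" and c
    using that by (rule ell_scale)
qed (auto simp: fscale_def plus_fun_def algebra_simps)

lemma ell_diff: "1 \<le> p \<Longrightarrow> x \<in> ell p \<Longrightarrow> y \<in> ell p \<Longrightarrow> x - y \<in> ell p"
  using vector_space_on.diff_mem[OF vector_space_on_ell] by blast

text \<open>The coordinatewise limit is the limit in norm, since a bound on finite sections of
  \<open>\<sigma> m - \<sigma> n\<close> survives letting \<open>n\<close> tend to infinity. That the distance is a metric is a premise here,
  as completeness enters the construction of the Banach space itself.\<close>

lemma complete_ell:
  assumes p: "1 \<le> p"
    and M: "Metric_space (ell p :: (nat \<Rightarrow> 'k::real_or_complex) set) (norm_dist (ell p) (ell_norm p))"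
  shows "Metric_space.mcomplete (ell p :: (nat \<Rightarrow> 'k) set) (norm_dist (ell p) (ell_norm p))"
proof -
  interpret Metric_space "ell p :: (nat \<Rightarrow> 'k) set" "norm_dist (ell p) (ell_norm p)" by fact
  show ?thesis
    unfolding mcomplete_def
  proof (intro allI impI)
    fix \<sigma> :: "nat \<Rightarrow> nat \<Rightarrow> 'k" assume "MCauchy \<sigma>"
    then have mem: "\<sigma> n \<in> ell p" and Cauchy: "\<And>e. e > 0 \<Longrightarrow> \<exists>N. \<forall>m\<ge>N. \<forall>n\<ge>N. ell_norm p (\<sigma> m - \<sigma> n) < e" for n
      unfolding MCauchy_def norm_dist_def by (auto simp: image_subset_iff)
    have "Cauchy (\<lambda>n. \<sigma> n i)" for i
    proof (rule metric_CauchyI)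
      fix e :: real assume "e > 0"
      then obtain N where N: "\<forall>m\<ge>N. \<forall>n\<ge>N. ell_norm p (\<sigma> m - \<sigma> n) < e" using Cauchy by blast
      have "dist (\<sigma> m i) (\<sigma> n i) < e" if "m \<ge> N" "n \<ge> N" for m n
        using norm_le_ell_norm[OF _ ell_diff[OF p mem[of m] mem[of n]], of i] p N that
        by (force simp: dist_norm)
      then show "\<exists>M. \<forall>m\<ge>M. \<forall>n\<ge>M. dist (\<sigma> m i) (\<sigma> n i) < e" by blast
    qed
    then have "\<forall>i. \<exists>l. (\<lambda>n. \<sigma> n i) \<longlonglongrightarrow> l"
      by (simp add: Cauchy_convergent_iff convergent_def)
    then obtain x where x: "\<And>i. (\<lambda>n. \<sigma> n i) \<longlonglongrightarrow> x i" by metis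
    have close: "\<exists>N. \<forall>m\<ge>N. \<sigma> m - x \<in> ell p \<and> ell_norm p (\<sigma> m - x) \<le> e" if "e > 0" for e
    proof -
      obtain N where N: "\<forall>m\<ge>N. \<forall>n\<ge>N. ell_norm p (\<sigma> m - \<sigma> n) < e" using Cauchy \<open>e > 0\<close> by blast
      have "\<sigma> m - x \<in> ell p \<and> ell_norm p (\<sigma> m - x) \<le> e" if m: "m \<ge> N" for m
      proof -
        have "(\<Sum>i<K. norm ((\<sigma> m - x) i) powr p) \<le> e powr p" for K
        proof (rule tendsto_upperbound)
          show "(\<lambda>n. \<Sum>i<K. norm ((\<sigma> m - \<sigma> n) i) powr p) \<longlonglongrightarrow> (\<Sum>i<K. norm ((\<sigma> m - x) i) powr p)"
            using p x by (auto intro!: tendsto_intros tendsto_powr')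
          have "(\<Sum>i<K. norm ((\<sigma> m - \<sigma> n) i) powr p) \<le> e powr p" if "n \<ge> N" for n
          proof -
            have "(\<Sum>i<K. norm ((\<sigma> m - \<sigma> n) i) powr p) \<le> ell_norm p (\<sigma> m - \<sigma> n) powr p"
              using p by (intro sum_le_ell_norm ell_diff mem) auto
            also have "\<dots> \<le> e powr p"
              using p N m that by (intro powr_mono2 ell_norm_nonneg) (auto intro: less_imp_le)
            finally show ?thesis .
          qed
          then show "\<forall>\<^sub>F n in sequentially. (\<Sum>i<K. norm ((\<sigma> m - \<sigma> n) i) powr p) \<le> e powr p"
            unfolding eventually_sequentially by blast
        qed simp
        then show ?thesis
          using p \<open>e > 0\<close> ell_norm_leI[of p e "\<sigma> m - x"] by auto
      qed
      then show ?thesis by blast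
    qed
    obtain N where "\<sigma> N - x \<in> ell p" using close[of 1] by auto
    then have xm: "x \<in> ell p"
      using ell_diff[OF p mem[of N], of "\<sigma> N - x"] by simp
    moreover have "\<exists>N. \<forall>n\<ge>N. \<sigma> n \<in> ell p \<and> norm_dist (ell p) (ell_norm p) (\<sigma> n) x < e" if "e > 0" for e
    proof -
      obtain N where "\<forall>m\<ge>N. ell_norm p (\<sigma> m - x) \<le> e / 2"
        using close[of "e / 2"] half_gt_zero[OF \<open>e > 0\<close>] by blast
      then have "\<forall>m\<ge>N. ell_norm p (\<sigma> m - x) < e" using that by force
      then show ?thesis using mem xm by (auto simp: norm_dist_def)
    qed
    ultimately show "\<exists>x. limitin mtopology \<sigma> x sequentially"
      unfolding limit_metric_sequentially by blast
  qed
qed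

lemma banach_space_ell:
  assumes p: "1 \<le> p"
  shows "banach_space (ell p :: (nat \<Rightarrow> 'k::real_or_complex) set) fscale (ell_norm p)"
proof -
  interpret vector_space_on "ell p :: (nat \<Rightarrow> 'k) set" fscale
    using p by (rule vector_space_on_ell)
  have zero: "ell_norm p x = 0 \<longleftrightarrow> x = 0" if "x \<in> ell p" for x :: "nat \<Rightarrow> 'k"
    using norm_le_ell_norm[OF _ that] p by (auto simp: fun_eq_iff ell_norm_def)
  have sym: "ell_norm p (x - y) = ell_norm p (y - x)" for x y :: "nat \<Rightarrow> 'k"
    by (simp add: ell_norm_def norm_minus_commute)
  have "Metric_space (ell p :: (nat \<Rightarrow> 'k) set) (norm_dist (ell p) (ell_norm p))"
  proof
    show "norm_dist (ell p) (ell_norm p) x z \<le> norm_dist (ell p) (ell_norm p) x y + norm_dist (ell p) (ell_norm p) y z"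
      if "x \<in> ell p" "y \<in> ell p" "z \<in> ell p" for x y z :: "nat \<Rightarrow> 'k"
      using ell_norm_triangle(2)[OF p, of "x - y" "y - z"] that p by (simp add: norm_dist_def ell_diff)
  qed (use p in \<open>auto simp: norm_dist_def ell_norm_nonneg sym zero ell_diff\<close>)
  from complete_ell[OF p this] show ?thesis
    using p zero by unfold_locales (auto simp: ell_norm_nonneg ell_norm_scale ell_norm_triangle)
qed

section \<open>Duality between finite sequences\<close>

text \<open>The duality map of \<open>\<ell>\<^sub>p\<close> in one coordinate: a scalar of modulus \<open>norm v powr (p - 1)\<close> whose product with
  \<open>v\<close> is \<open>norm v powr p\<close>. Division by zero gives the value 0 at 0, as it should. Sequences
  \<open>dual_coeff p (v n)\<close> with \<open>v\<close> in the unit ball of \<open>\<ell>\<^sub>p\<close> run through the unit ball of the dual space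
  without any mention of the conjugate exponent.\<close>

definition dual_coeff :: "real \<Rightarrow> 'k::real_or_complex \<Rightarrow> 'k" where
  "dual_coeff p v = of_real (norm v powr p) / v"

lemma dual_coeff_mult: "p > 0 \<Longrightarrow> dual_coeff p v * v = of_real (norm v powr p)"
  by (cases "v = 0") (simp_all add: dual_coeff_def)

lemma norm_dual_coeff: "norm (dual_coeff p v) = norm v powr (p - 1)"
  by (cases "v = 0") (simp_all add: dual_coeff_def norm_divide powr_diff)

text \<open>A crude substitute for Young's inequality, true because the larger of the two moduli dominates both
  factors.\<close>

lemma norm_dual_coeff_mult_le:
  assumes "p \<ge> 1"
  shows "norm (dual_coeff p v * u) \<le> norm v powr p + norm u powr p"
proof -
  define m where "m = max (norm v) (norm u)"
  have "norm v powr (p - 1) * norm u \<le> m powr (p - 1) * m"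
    using assms by (intro mult_mono powr_mono2) (auto simp: m_def)
  also have "m powr (p - 1) * m = m powr p"
  proof -
    have "m \<ge> 0" by (simp add: m_def le_max_iff_disj)
    then show ?thesis using powr_add[of m "p - 1" 1] by simp
  qed
  also have "m powr p \<le> norm v powr p + norm u powr p"
    by (simp add: m_def max_def)
  finally show ?thesis by (simp add: norm_mult norm_dual_coeff)
qed

text \<open>The converse of Hoelder's inequality: the normalized vector \<open>v = u / R\<close>, where \<open>R\<close> is the \<open>p\<close>-norm of
  \<open>u\<close>, gives the pairing the value \<open>R\<close>.\<close>

lemma sum_powr_le_of_dual_coeff:
  fixes u :: "'i \<Rightarrow> 'k::real_or_complex"
  assumes "p > 0" "D \<ge> 0"
    and le: "\<And>v. (\<Sum>i\<in>I. norm (v i) powr p) \<le> 1 \<Longrightarrow> norm (\<Sum>i\<in>I. dual_coeff p (v i) * u i) \<le> D"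
  shows "(\<Sum>i\<in>I. norm (u i) powr p) \<le> D powr p"
proof (cases "(\<Sum>i\<in>I. norm (u i) powr p) = 0")
  case True
  then show ?thesis by simp
next
  case False
  define S where "S = (\<Sum>i\<in>I. norm (u i) powr p)"
  define R where "R = S powr (1 / p)"
  have S: "S > 0" using False by (simp add: S_def sum_nonneg order.strict_iff_order)
  have R: "R > 0" "R powr p = S" using S assms(1) by (simp_all add: R_def powr_powr)
  define v where "v i = u i / of_real R" for i
  have v: "norm (v i) powr p = norm (u i) powr p / S" for i
    using R by (simp add: v_def norm_divide powr_divide)
  have sum1: "(\<Sum>i\<in>I. norm (v i) powr p) = 1"
    using S by (simp add: v flip: sum_divide_distrib S_def)
  have "dual_coeff p (v i) * u i = of_real (norm (v i) powr p * R)" for i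
  proof -
    have "u i = v i * of_real R" using R by (simp add: v_def)
    then have "dual_coeff p (v i) * u i = dual_coeff p (v i) * v i * of_real R" by simp
    then show ?thesis using assms(1) by (simp only: dual_coeff_mult of_real_mult)
  qed
  then have "(\<Sum>i\<in>I. dual_coeff p (v i) * u i) = of_real ((\<Sum>i\<in>I. norm (v i) powr p) * R)"
    by (simp add: sum_distrib_right)
  then have "R \<le> D" using le[of v] sum1 R by simp
  then have "R powr p \<le> D powr p" using R assms by (intro powr_mono2) auto
  then show ?thesis using R by (simp add: S_def)
qed

section \<open>Weakly bounded sets in the strong dual\<close>

text \<open>The core of the elementary proof of the uniform boundedness principle. Row \<open>k\<close> of \<open>a\<close> is bounded by \<open>P k\<close>
  and nearly attains this bound on the diagonal. The sign of the \<open>k\<close>-th term is chosen such that adding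
  this term leaves at least \<open>norm (a k k) / 3 ^ k\<close> in row \<open>k\<close>, which is possible because of
  \<open>max (norm (u + w)) (norm (u - w)) \<ge> norm w\<close>. The later terms of row \<open>k\<close> add up to at most
  \<open>P k / (2 * 3 ^ k)\<close>, which is less than the \<open>2 / 3\<close> of \<open>P k / 3 ^ k\<close> that was secured.\<close>

lemma signs_sum_lower_bound:
  fixes a :: "nat \<Rightarrow> nat \<Rightarrow> 'k::banach"
  assumes le: "\<And>k j. norm (a k j) \<le> P k" and diag: "\<And>k. norm (a k k) \<ge> 2 / 3 * P k"
  obtains \<epsilon> :: "nat \<Rightarrow> real" where "\<And>j. \<bar>\<epsilon> j\<bar> = 1"
    "\<And>k. norm (\<Sum>j. (\<epsilon> j / 3 ^ j) *\<^sub>R a k j) \<ge> P k / (6 * 3 ^ k)"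
proof -
  define sgn' :: "(nat \<Rightarrow> 'k) \<Rightarrow> nat \<Rightarrow> real" where
    "sgn' \<psi> k = (if norm (\<psi> k + (1 / 3 ^ k) *\<^sub>R a k k) \<ge> norm ((1 / 3 ^ k) *\<^sub>R a k k) then 1 else - 1)" for \<psi> k
  define \<psi> :: "nat \<Rightarrow> nat \<Rightarrow> 'k" where
    "\<psi> = rec_nat (\<lambda>_. 0) (\<lambda>k \<psi> l. \<psi> l + (sgn' \<psi> k / 3 ^ k) *\<^sub>R a l k)"
  define \<epsilon> where "\<epsilon> k = sgn' (\<psi> k) k" for k
  have psi_sum: "\<psi> k l = (\<Sum>j<k. (\<epsilon> j / 3 ^ j) *\<^sub>R a l j)" for k l
    by (induction k) (simp_all add: \<psi>_def \<epsilon>_def)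
  have abs_eps: "\<bar>\<epsilon> j\<bar> = 1" for j by (simp add: \<epsilon>_def sgn'_def)
  have bound: "norm ((\<epsilon> j / 3 ^ j) *\<^sub>R a k j) \<le> P k * (1 / 3) ^ j" for k j
    using le[of k j] abs_eps[of j] by (simp add: field_simps power_one_over)
  have geo: "summable (\<lambda>j. P k * (1 / 3 :: real) ^ j)" for k
    by (intro summable_mult summable_geometric) simp
  have summ: "summable (\<lambda>j. (\<epsilon> j / 3 ^ j) *\<^sub>R a k j)" for k
    using geo[of k] bound[of _ k] by (rule summable_comparison_test'[where N=0]) 
  have big: "norm (\<psi> (Suc k) k) \<ge> norm (a k k) / 3 ^ k" for k
  proof -
    let ?w = "(1 / 3 ^ k) *\<^sub>R a k k"
    have "2 * norm ?w \<le> norm (\<psi> k k + ?w) + norm (\<psi> k k - ?w)"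
    proof -
      have eq: "(\<psi> k k + ?w) - (\<psi> k k - ?w) = 2 *\<^sub>R ?w" by (simp only: scaleR_2) simp
      have "norm (2 *\<^sub>R ?w) \<le> norm (\<psi> k k + ?w) + norm (\<psi> k k - ?w)"
        unfolding eq[symmetric] by (rule norm_triangle_ineq4)
      then show ?thesis by simp
    qed
    then have "norm (\<psi> k k + \<epsilon> k *\<^sub>R ?w) \<ge> norm ?w"
      by (auto simp: \<epsilon>_def sgn'_def)
    then show ?thesis by (simp add: psi_sum)
  qed
  have tail: "norm (\<Sum>j. (\<epsilon> (j + Suc k) / 3 ^ (j + Suc k)) *\<^sub>R a k (j + Suc k)) \<le> P k / (2 * 3 ^ k)" for k
  proof -
    have "norm (\<Sum>j. (\<epsilon> (j + Suc k) / 3 ^ (j + Suc k)) *\<^sub>R a k (j + Suc k))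
        \<le> (\<Sum>j. P k * (1 / 3) ^ (j + Suc k))"
      by (rule norm_suminf_le[OF bound summable_ignore_initial_segment[OF geo]])
    also have "\<dots> = (\<Sum>j. (P k * (1 / 3) ^ Suc k) * (1 / 3) ^ j)"
      by (simp add: power_add mult_ac)
    also have "\<dots> = (P k * (1 / 3) ^ Suc k) * (1 / (1 - 1 / 3))"
      by (subst suminf_mult) (auto simp: suminf_geometric)
    also have "\<dots> = P k / (2 * 3 ^ k)" by (simp add: power_one_over)
    finally show ?thesis .
  qed
  have "norm (\<Sum>j. (\<epsilon> j / 3 ^ j) *\<^sub>R a k j) \<ge> P k / (6 * 3 ^ k)" for k
  proof -
    have "(\<Sum>j. (\<epsilon> j / 3 ^ j) *\<^sub>R a k j) =
        (\<Sum>j. (\<epsilon> (j + Suc k) / 3 ^ (j + Suc k)) *\<^sub>R a k (j + Suc k)) + \<psi> (Suc k) k"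
      unfolding psi_sum by (rule suminf_split_initial_segment[OF summ])
    then have split: "(\<Sum>j. (\<epsilon> j / 3 ^ j) *\<^sub>R a k j) =
        \<psi> (Suc k) k + (\<Sum>j. (\<epsilon> (j + Suc k) / 3 ^ (j + Suc k)) *\<^sub>R a k (j + Suc k))"
      by (simp only: add.commute)
    have "norm (\<Sum>j. (\<epsilon> j / 3 ^ j) *\<^sub>R a k j) \<ge> norm (\<psi> (Suc k) k) -
        norm (\<Sum>j. (\<epsilon> (j + Suc k) / 3 ^ (j + Suc k)) *\<^sub>R a k (j + Suc k))"
      unfolding split by (rule norm_diff_ineq)
    moreover have "norm (a k k) / 3 ^ k \<ge> (2 / 3 * P k) / 3 ^ k"
      using diag by (intro divide_right_mono) auto
    moreover have "(2 / 3 * P k) / 3 ^ k - P k / (2 * 3 ^ k) = P k / (6 * 3 ^ k)"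
      by (simp add: field_simps)
    ultimately show ?thesis using big[of k] tail[of k] by linarith
  qed
  with abs_eps show thesis by (rule that)
qed

context vector_space_on
begin

text \<open>Absolutely convergent combinations of evaluations at points of one bounded set are continuous for the
  strong topology. These functionals detect strongly
  unbounded sets.\<close>

lemma series_in_bidual:
  fixes c :: "nat \<Rightarrow> real"
  assumes V: "V = topspace \<tau>" and B: "bounded_in s \<tau> B" and x: "\<And>j. x j \<in> B"
    and c: "summable (\<lambda>j. \<bar>c j\<bar>)"
  shows "(\<lambda>f. if f \<in> dual s \<tau> then \<Sum>j. c j *\<^sub>R f (x j) else 0) \<in> dual fscale (strong_topology s \<tau>)"
proof -
  have xV: "x j \<in> topspace \<tau>" for j using B x by (auto simp: bounded_in_def)
  have summ: "summable (\<lambda>j. c j *\<^sub>R f (x j))" if "f \<in> dual s \<tau>" for f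
  proof -
    obtain M where M: "\<And>y. y \<in> B \<Longrightarrow> norm (f y) \<le> M"
      using dual_bounded_on[OF \<open>f \<in> dual s \<tau>\<close> B] zero_mem V by blast
    have "norm (c j *\<^sub>R f (x j)) \<le> \<bar>c j\<bar> * M" for j
      using M[OF x] by (simp add: mult_left_mono)
    with summable_mult2[OF c] show ?thesis by (rule summable_comparison_test'[where N=0])
  qed
  have le: "norm (\<Sum>j. c j *\<^sub>R f (x j)) \<le> (\<Sum>j. \<bar>c j\<bar>)"
    if "f \<in> dual s \<tau>" "\<forall>y\<in>B. norm (f y) \<le> 1" for f
  proof (rule norm_suminf_le[OF _ c])
    show "norm (c j *\<^sub>R f (x j)) \<le> \<bar>c j\<bar>" for j
      using that x by (simp add: mult_left_le)
  qed
  have "(\<Sum>j. \<bar>c j\<bar>) \<ge> 0" using c by (intro suminf_nonneg) auto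
  moreover have "(\<Sum>j. c j *\<^sub>R (f + g) (x j)) = (\<Sum>j. c j *\<^sub>R f (x j)) + (\<Sum>j. c j *\<^sub>R g (x j))"
    if "f \<in> dual s \<tau>" "g \<in> dual s \<tau>" for f g
    using suminf_add[OF summ[OF that(1)] summ[OF that(2)]] by (simp add: scaleR_add_right)
  moreover have "(\<Sum>j. c j *\<^sub>R fscale d f (x j)) = d * (\<Sum>j. c j *\<^sub>R f (x j))"
    if "f \<in> dual s \<tau>" for f d
    using suminf_mult[OF summ[OF that], of d] by (simp add: fscale_def)
  ultimately show ?thesis
    unfolding bidual_iff using B le
    by (auto simp: add_in_dual fscale_in_dual intro!: exI[of _ B] exI[of _ "\<Sum>j. \<bar>c j\<bar>"])
qed

end

lemma bounded_in_strong_topologyI: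
  assumes H: "H \<subseteq> dual s \<tau>"
    and bd: "\<And>B. bounded_in s \<tau> B \<Longrightarrow> \<exists>M. \<forall>h\<in>H. \<forall>x\<in>B. norm (h x) \<le> M"
  shows "bounded_in fscale (strong_topology s \<tau>) H"
  unfolding bounded_in_def
proof (intro conjI allI impI)
  show "H \<subseteq> topspace (strong_topology s \<tau>)" using H by simp
  fix U assume "openin (strong_topology s \<tau>) U \<and> 0 \<in> U"
  then have U: "openin (strong_topology s \<tau>) U" "0 \<in> U" by simp_all
  obtain B \<epsilon> where B: "bounded_in s \<tau> B" and eps: "\<epsilon> > 0"
    and sub: "{g \<in> dual s \<tau>. \<forall>x\<in>B. norm (g x) < \<epsilon>} \<subseteq> U"
    by (rule strong_nhd_zero[OF U])
  obtain M where M: "\<forall>h\<in>H. \<forall>x\<in>B. norm (h x) \<le> M" using bd[OF B] by blast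
  have "H \<subseteq> fscale c ` U" if c: "norm c \<ge> (\<bar>M\<bar> + 1) / \<epsilon>" for c
  proof
    fix h assume h: "h \<in> H"
    have pos: "norm c > 0" using c eps by (smt (verit) divide_pos_pos)
    have c': "\<bar>M\<bar> + 1 \<le> norm c * \<epsilon>" using c eps by (simp add: pos_divide_le_eq)
    have "norm (fscale (inverse c) h x) < \<epsilon>" if "x \<in> B" for x
    proof -
      have "norm (h x) \<le> M" using M h that by blast
      then have "norm (h x) < norm c * \<epsilon>" using c' by linarith
      then show ?thesis
        using pos by (simp add: fscale_def norm_mult norm_divide divide_simps mult.commute)
    qed
    then have "fscale (inverse c) h \<in> U"
      using sub fscale_in_dual[of h s \<tau> "inverse c"] h H by blast
    moreover have "h = fscale c (fscale (inverse c) h)"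
      using pos by (auto simp: fscale_def)
    ultimately show "h \<in> fscale c ` U" by blast
  qed
  then show "\<exists>r>0. \<forall>c. r \<le> norm c \<longrightarrow> H \<subseteq> fscale c ` U"
    using eps by (intro exI[of _ "(\<bar>M\<bar> + 1) / \<epsilon>"]) (simp add: add_nonneg_pos)
qed

text \<open>If \<open>H\<close> were unbounded on the bounded set \<open>B\<close>, there would be functionals \<open>h k\<close> in \<open>H\<close> whose suprema on
  \<open>B\<close> exceed \<open>4 ^ k\<close>. Then some signed series \<open>\<Sum>j. \<plusminus> f (x j) / 3 ^ j\<close> with points of \<open>B\<close> would be a bidual
  functional whose value at \<open>h k\<close> is at least of order \<open>(4 / 3) ^ k\<close>, in contradiction to weak
  boundedness.\<close>

lemma weakly_bounded_imp_strongly_bounded: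
  assumes V: "vector_space_on (topspace \<tau>) s" and H: "H \<subseteq> dual s \<tau>"
    and weak: "\<And>\<phi>. \<phi> \<in> dual fscale (strong_topology s \<tau>) \<Longrightarrow> \<exists>M. \<forall>h\<in>H. norm (\<phi> h) \<le> M"
  shows "bounded_in fscale (strong_topology s \<tau>) H"
proof (rule bounded_in_strong_topologyI[OF H], rule ccontr)
  interpret vector_space_on "topspace \<tau>" s by fact
  fix B assume B: "bounded_in s \<tau> B" and nb: "\<not> (\<exists>M. \<forall>h\<in>H. \<forall>x\<in>B. norm (h x) \<le> M)"
  have "\<exists>h\<in>H. \<exists>x\<in>B. \<exists>P. (\<forall>y\<in>B. norm (h y) \<le> P) \<and> norm (h x) \<ge> 2 / 3 * P \<and> P \<ge> 4 ^ k" for k :: nat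
  proof -
    obtain h z where h: "h \<in> H" "z \<in> B" "norm (h z) > 4 ^ k"
      using nb by (meson not_le)
    obtain M where M: "\<And>x. x \<in> B \<Longrightarrow> norm (h x) \<le> M"
      using dual_bounded_on[OF subsetD[OF H h(1)] B zero_mem] by metis
    define P where "P = (SUP x\<in>B. norm (h x))"
    have bdd: "bdd_above ((\<lambda>x. norm (h x)) ` B)" using M by (rule bdd_aboveI2)
    then have le: "norm (h y) \<le> P" if "y \<in> B" for y
      unfolding P_def using that by (rule cSUP_upper[rotated])
    have pos: "P > 4 ^ k" using le[OF h(2)] h(3) by linarith
    have "0 < P" using pos by (smt (verit) zero_less_power)
    then have "2 / 3 * P < P" by simp
    then obtain x where "x \<in> B" "2 / 3 * P < norm (h x)"
      using less_cSUP_iff[OF _ bdd] h(2) unfolding P_def by blast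
    then show ?thesis using h le pos by (intro bexI[of _ h] bexI[of _ x] exI[of _ P]) auto
  qed
  then obtain h x P where h: "\<And>k. h k \<in> H" and x: "\<And>k. x k \<in> B"
    and P: "\<And>k y. y \<in> B \<Longrightarrow> norm (h k y) \<le> P k" "\<And>k. norm (h k (x k)) \<ge> 2 / 3 * P k"
      "\<And>k. P k \<ge> 4 ^ k"
    by metis
  obtain \<epsilon> :: "nat \<Rightarrow> real" where eps: "\<And>j. \<bar>\<epsilon> j\<bar> = 1"
    and low: "\<And>k. norm (\<Sum>j. (\<epsilon> j / 3 ^ j) *\<^sub>R h k (x j)) \<ge> P k / (6 * 3 ^ k)"
    using signs_sum_lower_bound[of "\<lambda>k j. h k (x j)" P] P x by metis
  have "\<bar>\<epsilon> j / 3 ^ j\<bar> = (1 / 3) ^ j" for j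
    using eps[of j] by (simp add: abs_divide power_one_over)
  then have "summable (\<lambda>j. \<bar>\<epsilon> j / 3 ^ j\<bar>)"
    by (simp add: summable_geometric)
  from weak[OF series_in_bidual[OF refl B x this]] obtain M
    where M: "\<forall>h\<in>H. norm (if h \<in> dual s \<tau> then \<Sum>j. (\<epsilon> j / 3 ^ j) *\<^sub>R h (x j) else 0) \<le> M" ..
  have "(4 / 3) ^ k \<le> 6 * M" for k :: nat
  proof -
    have "4 ^ k / (6 * 3 ^ k) \<le> P k / (6 * 3 ^ k)" using P(3) by (intro divide_right_mono) auto
    also have "\<dots> \<le> M" using low[of k] bspec[OF M h[of k]] h[of k] H by (auto split: if_splits)
    finally show ?thesis by (simp add: power_divide field_simps)
  qed
  moreover obtain k :: nat where "6 * M < (4 / 3) ^ k"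
    using real_arch_pow[of "4/3" "6 * M"] by auto
  ultimately show False by (meson not_le)
qed

section \<open>Weakly p-summable sequences of functionals as operators into \<open>\<ell>\<^sub>p\<close>\<close>

context locally_convex_space
begin

lemma bounded_in_singleton:
  assumes x: "x \<in> topspace \<tau>"
  shows "bounded_in s \<tau> {x}"
  unfolding bounded_in_def
proof (intro conjI allI impI)
  show "{x} \<subseteq> topspace \<tau>" using x by simp
  fix U assume U: "openin \<tau> U \<and> 0 \<in> U"
  have "continuous_map euclidean \<tau> ((\<lambda>(c, x). s c x) \<circ> (\<lambda>c. (c, x)))"
    using continuous_scale by (rule continuous_map_compose[rotated]) (use x in \<open>auto simp: continuous_map_paired\<close>)
  then have "openin euclidean {c \<in> topspace euclidean. ((\<lambda>(c, x). s c x) \<circ> (\<lambda>c. (c, x))) c \<in> U}"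
    using U by (blast intro: openin_continuous_map_preimage)
  then have "open {c. s c x \<in> U}" by simp
  moreover have "0 \<in> {c. s c x \<in> U}" using U x by (simp add: scale_zero)
  ultimately obtain \<delta> where d: "\<delta> > 0" "ball 0 \<delta> \<subseteq> {c. s c x \<in> U}"
    by (meson open_contains_ball)
  have "{x} \<subseteq> s c ` U" if c: "norm c \<ge> 2 / \<delta>" for c
  proof -
    have pos: "norm c > 0" using c d by (smt (verit) divide_pos_pos)
    have "norm (inverse c) < \<delta>"
    proof -
      have "2 \<le> norm c * \<delta>" using c d by (simp add: pos_divide_le_eq)
      then have "1 < norm c * \<delta>" by simp
      then show ?thesis using pos by (simp add: norm_divide inverse_eq_divide pos_divide_less_eq mult.commute)
    qed
    then have "s (inverse c) x \<in> U" using d(2) by auto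
    then show ?thesis using scale_cancel[of c x] pos x by (metis image_eqI norm_eq_zero less_irrefl singletonD subsetI)
  qed
  then show "\<exists>r>0. \<forall>c. r \<le> norm c \<longrightarrow> {x} \<subseteq> s c ` U"
    using d(1) by (intro exI[of _ "2 / \<delta>"]) auto
qed

lemma evaluation_in_bidual:
  assumes "x \<in> topspace \<tau>"
  shows "(\<lambda>f. if f \<in> dual s \<tau> then f x else 0) \<in> dual fscale (strong_topology s \<tau>)"
  unfolding bidual_iff
  using bounded_in_singleton[OF assms]
  by (auto simp: add_in_dual fscale_in_dual fscale_apply
      intro!: exI[of _ "{x}"] exI[of _ "1::real"])

lemma openin_translate:
  assumes "openin \<tau> U" "a \<in> topspace \<tau>"
  shows "openin \<tau> {x \<in> topspace \<tau>. x - a \<in> U}"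
proof -
  have "continuous_map \<tau> \<tau> ((\<lambda>(x, y). x + y) \<circ> (\<lambda>x. (x, - a)))"
    using continuous_add
    by (rule continuous_map_compose[rotated]) (use uminus_mem assms in \<open>auto simp: continuous_map_paired\<close>)
  then have "openin \<tau> {x \<in> topspace \<tau>. ((\<lambda>(x, y). x + y) \<circ> (\<lambda>x. (x, - a))) x \<in> U}"
    using assms(1) by (rule openin_continuous_map_preimage)
  then show ?thesis by simp
qed

text \<open>Continuity of a linear map need only be checked at zero, as translations of the domain are
  continuous.\<close>

lemma operator_norm_topologyI:
  assumes W: "banach_space W s' N"
    and mem: "\<And>x. x \<in> topspace \<tau> \<Longrightarrow> T x \<in> W"
    and add: "\<And>x y. x \<in> topspace \<tau> \<Longrightarrow> y \<in> topspace \<tau> \<Longrightarrow> T (x + y) = T x + T y"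
    and scale: "\<And>c x. x \<in> topspace \<tau> \<Longrightarrow> T (s c x) = s' c (T x)"
    and small: "\<And>\<epsilon>. \<epsilon> > 0 \<Longrightarrow> \<exists>U. openin \<tau> U \<and> 0 \<in> U \<and> (\<forall>x\<in>U. N (T x) \<le> \<epsilon>)"
  shows "operator s \<tau> s' (norm_topology W N) T"
proof -
  interpret W: banach_space W s' N by fact
  have "continuous_map \<tau> (norm_topology W N) T"
    unfolding continuous_map W.topspace_norm_topology
  proof (intro conjI allI impI)
    show "T ` topspace \<tau> \<subseteq> W" using mem by blast
    fix G assume G: "openin (norm_topology W N) G"
    show "openin \<tau> {x \<in> topspace \<tau>. T x \<in> G}"
    proof (subst openin_subopen, intro ballI)
      fix a assume a: "a \<in> {x \<in> topspace \<tau>. T x \<in> G}"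
      then obtain r where r: "r > 0" "\<And>y. y \<in> W \<Longrightarrow> N (y - T a) < r \<Longrightarrow> y \<in> G"
        using G unfolding W.openin_norm_topology by blast
      obtain U where U: "openin \<tau> U" "0 \<in> U" "\<forall>x\<in>U. N (T x) \<le> r / 2"
        using small[of "r / 2"] r(1) by auto
      let ?O = "{x \<in> topspace \<tau>. x - a \<in> U}"
      have "T x \<in> G" if x: "x \<in> ?O" for x
      proof -
        have "x - a \<in> topspace \<tau>" using x a diff_mem by blast
        then have "T x - T a = T (x - a)" using add[of "x - a" a] a by simp
        then have "N (T x - T a) < r" using U(3) x r(1) by fastforce
        then show ?thesis using r(2) mem x by blast
      qed
      then have "?O \<subseteq> {x \<in> topspace \<tau>. T x \<in> G}" by blast
      moreover have "openin \<tau> ?O" using openin_translate[OF U(1)] a by blast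
      moreover have "a \<in> ?O" using a U(2) by simp
      ultimately show "\<exists>T'. openin \<tau> T' \<and> a \<in> T' \<and> T' \<subseteq> {x \<in> topspace \<tau>. T x \<in> G}" by blast
    qed
  qed
  with add scale show ?thesis by (simp add: operator_def)
qed

text \<open>Evaluations at points belong to the bidual, so each \<open>(\<xi> n x)\<close> lies in \<open>\<ell>\<^sub>p\<close>. For continuity consider
  the set \<open>H\<close> of all finite combinations of the \<open>\<xi> n\<close> with coefficients \<open>dual_coeff p (v n)\<close>, \<open>v\<close> in the
  unit ball. A bidual functional \<open>\<phi>\<close> is bounded on \<open>H\<close> because \<open>(\<phi> (\<xi> n))\<close> lies in \<open>\<ell>\<^sub>p\<close>. So \<open>H\<close> is
  strongly bounded and, the space being quasibarrelled, equicontinuous; a bound for \<open>H\<close> at \<open>x\<close> is a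
  bound for the \<open>p\<close>-norm of \<open>(\<xi> n x)\<close>.\<close>

lemma operator_of_weakly_p_summable:
  assumes p: "1 \<le> p" and qb: "quasibarrelled s \<tau>"
    and \<xi>: "weakly_p_summable p fscale (strong_topology s \<tau>) \<xi>"
  shows "operator s \<tau> fscale (norm_topology (ell p) (ell_norm p)) (\<lambda>x n. \<xi> n x)"
proof -
  have chi: "\<xi> n \<in> dual s \<tau>" for n using \<xi> by (auto simp: weakly_p_summable_def)
  define H where "H = {\<Sum>n<N. fscale (dual_coeff p (v n)) (\<xi> n) | N v. (\<Sum>n<(N::nat). norm (v n :: 'k) powr p) \<le> 1}"
  have H_dual: "H \<subseteq> dual s \<tau>"
    unfolding H_def by (auto intro!: sum_in_dual fscale_in_dual chi)
  have "bounded_in fscale (strong_topology s \<tau>) H"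
  proof (rule weakly_bounded_imp_strongly_bounded[OF vector_space_on_axioms H_dual])
    fix \<phi> assume phi: "\<phi> \<in> dual fscale (strong_topology s \<tau>)"
    then have ell: "(\<lambda>n. \<phi> (\<xi> n)) \<in> ell p" using \<xi> by (auto simp: weakly_p_summable_def)
    have lin: "\<phi> (f + g) = \<phi> f + \<phi> g" "\<phi> (fscale c f) = c * \<phi> f"
      if "f \<in> dual s \<tau>" "g \<in> dual s \<tau>" for f g c
      using phi that unfolding bidual_iff by blast+
    have phi0: "\<phi> 0 = 0" using lin(1)[OF zero_in_dual zero_in_dual] by simp
    have phi_sum: "\<phi> (\<Sum>n<N. fscale (c n) (\<xi> n)) = (\<Sum>n<N. c n * \<phi> (\<xi> n))" for N :: nat and c
    proof (induction N)
      case (Suc N)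
      have "\<phi> (\<Sum>n<Suc N. fscale (c n) (\<xi> n)) = \<phi> ((\<Sum>n<N. fscale (c n) (\<xi> n)) + fscale (c N) (\<xi> N))"
        by simp
      also have "\<dots> = \<phi> (\<Sum>n<N. fscale (c n) (\<xi> n)) + c N * \<phi> (\<xi> N)"
        using lin[of _ "fscale (c N) (\<xi> N)"] lin(2)[OF chi chi] chi
        by (simp add: sum_in_dual fscale_in_dual)
      finally show ?case unfolding Suc by (simp only: sum.lessThan_Suc)
    qed (simp add: phi0 flip: zero_fun_def)
    have "norm (\<phi> h) \<le> 1 + ell_norm p (\<lambda>n. \<phi> (\<xi> n)) powr p" if "h \<in> H" for h
    proof -
      obtain N :: nat and v where h: "h = (\<Sum>n<N. fscale (dual_coeff p (v n)) (\<xi> n))"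
        and v: "(\<Sum>n<N. norm (v n) powr p) \<le> 1"
        using \<open>h \<in> H\<close> unfolding H_def by blast
      have "norm (\<phi> h) \<le> (\<Sum>n<N. norm (dual_coeff p (v n) * \<phi> (\<xi> n)))"
        unfolding h phi_sum by (rule norm_sum)
      also have "\<dots> \<le> (\<Sum>n<N. norm (v n) powr p + norm (\<phi> (\<xi> n)) powr p)"
        using p by (intro sum_mono norm_dual_coeff_mult_le)
      also have "\<dots> = (\<Sum>n<N. norm (v n) powr p) + (\<Sum>n<N. norm (\<phi> (\<xi> n)) powr p)"
        by (rule sum.distrib)
      also have "\<dots> \<le> 1 + ell_norm p (\<lambda>n. \<phi> (\<xi> n)) powr p"
        using sum_le_ell_norm[OF _ ell, of "{..<N}"] p v by simp
      finally show ?thesis .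
    qed
    then show "\<exists>M. \<forall>h\<in>H. norm (\<phi> h) \<le> M" by blast
  qed
  then have equi: "equicontinuous_set s \<tau> H" using qb by (simp add: quasibarrelled_def)
  show ?thesis
  proof (rule operator_norm_topologyI[OF banach_space_ell[OF p]])
    show "(\<lambda>n. \<xi> n x) \<in> ell p" if "x \<in> topspace \<tau>" for x
      using \<xi> evaluation_in_bidual[OF that] chi unfolding weakly_p_summable_def by fastforce
    show "(\<lambda>n. \<xi> n (x + y)) = (\<lambda>n. \<xi> n x) + (\<lambda>n. \<xi> n y)"
      if "x \<in> topspace \<tau>" "y \<in> topspace \<tau>" for x y
      using that dual_add[OF chi] by auto
    show "(\<lambda>n. \<xi> n (s c x)) = fscale c (\<lambda>n. \<xi> n x)" if "x \<in> topspace \<tau>" for c x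
      using that dual_scale[OF chi] by (auto simp: fscale_def)
    fix \<epsilon> :: real assume eps: "\<epsilon> > 0"
    then have "\<exists>U. openin \<tau> U \<and> 0 \<in> U \<and> (\<forall>h\<in>H. \<forall>x\<in>U. norm (h x) < \<epsilon>)"
      using equi unfolding equicontinuous_set_def by simp
    then obtain U where U: "openin \<tau> U" "0 \<in> U" and small: "\<forall>h\<in>H. \<forall>x\<in>U. norm (h x) < \<epsilon>"
      by (elim exE conjE)
    have "ell_norm p (\<lambda>n. \<xi> n x) \<le> \<epsilon>" if x: "x \<in> U" for x
    proof (rule ell_norm_leI)
      fix N :: nat
      show "(\<Sum>n<N. norm (\<xi> n x) powr p) \<le> \<epsilon> powr p"
      proof (rule sum_powr_le_of_dual_coeff)
        fix v :: "nat \<Rightarrow> 'k" assume "(\<Sum>n<N. norm (v n) powr p) \<le> 1"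
        then have "(\<Sum>n<N. fscale (dual_coeff p (v n)) (\<xi> n)) \<in> H" unfolding H_def by blast
        from bspec[OF bspec[OF small this] x] show "norm (\<Sum>n<N. dual_coeff p (v n) * \<xi> n x) \<le> \<epsilon>"
          by (simp add: sum_fun_apply fscale_def)
      qed (use p eps in auto)
    qed (use p eps in auto)
    with U show "\<exists>U. openin \<tau> U \<and> 0 \<in> U \<and> (\<forall>x\<in>U. ell_norm p (\<lambda>n. \<xi> n x) \<le> \<epsilon>)" by blast
  qed
qed

end

section \<open>Relatively compact images\<close>

text \<open>Removes the extended reals: the suprema tend to zero exactly if the functions tend to zero uniformly
  on \<open>A\<close>.\<close>

lemma SUP_norm_tendsto_0_iff:
  assumes "A \<noteq> {}"
  shows "(\<lambda>n. SUP a\<in>A. ereal (norm (\<phi> n a))) \<longlonglongrightarrow> 0 \<longleftrightarrow>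
    (\<forall>\<epsilon>>0. \<forall>\<^sub>F n in sequentially. \<forall>a\<in>A. norm (\<phi> n a) < \<epsilon>)" (is "?l \<longleftrightarrow> ?r")
proof
  assume l: ?l
  show ?r
  proof (intro allI impI)
    fix \<epsilon> :: real assume "\<epsilon> > 0"
    then have "\<forall>\<^sub>F n in sequentially. (SUP a\<in>A. ereal (norm (\<phi> n a))) < ereal \<epsilon>"
      using l by (intro order_tendstoD(2)) auto
    then show "\<forall>\<^sub>F n in sequentially. \<forall>a\<in>A. norm (\<phi> n a) < \<epsilon>"
    proof eventually_elim
      case (elim n)
      have "ereal (norm (\<phi> n a)) < ereal \<epsilon>" if "a \<in> A" for a
        using SUP_upper[OF that, of "\<lambda>a. ereal (norm (\<phi> n a))"] elim by (rule le_less_trans)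
      then show ?case by simp
    qed
  qed
next
  assume r: ?r
  show ?l
  proof (rule order_tendstoI)
    fix b :: ereal assume "b < 0"
    obtain a where a: "a \<in> A" using assms by blast
    have "b < (SUP a\<in>A. ereal (norm (\<phi> n a)))" for n
    proof -
      have "0 \<le> ereal (norm (\<phi> n a))" by simp
      also have "\<dots> \<le> (SUP a\<in>A. ereal (norm (\<phi> n a)))" using a by (rule SUP_upper)
      finally show ?thesis using \<open>b < 0\<close> by (rule less_le_trans[rotated])
    qed
    then show "\<forall>\<^sub>F n in sequentially. b < (SUP a\<in>A. ereal (norm (\<phi> n a)))" by simp
  next
    fix b :: ereal assume "0 < b"
    then obtain e where e: "0 < ereal e" "ereal e < b" using ereal_dense2 by blast
    have "\<forall>\<^sub>F n in sequentially. \<forall>a\<in>A. norm (\<phi> n a) < e" using r e by simp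
    then show "\<forall>\<^sub>F n in sequentially. (SUP a\<in>A. ereal (norm (\<phi> n a))) < b"
    proof eventually_elim
      case (elim n)
      then have "(SUP a\<in>A. ereal (norm (\<phi> n a))) \<le> ereal e" by (intro SUP_least) (auto intro: less_imp_le)
      then show ?case using e(2) by (rule le_less_trans)
    qed
  qed
qed

lemma ell_coordinates_small:
  assumes "0 < p" "x \<in> ell p" "e > 0"
  shows "\<forall>\<^sub>F n in sequentially. norm (x n) < e"
proof -
  have "(\<lambda>n. norm (x n) powr p) \<longlonglongrightarrow> 0"
    using assms(2) by (auto simp: ell_def intro: summable_LIMSEQ_zero)
  then have "\<forall>\<^sub>F n in sequentially. norm (x n) powr p < e powr p"
    using assms(3) by (intro order_tendstoD(2)) auto
  then show ?thesis
  proof eventually_elim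
    case (elim n)
    show ?case
      using elim assms powr_mono2[of p e "norm (x n)"] by (smt (verit))
  qed
qed

text \<open>A finite \<open>e / 2\<close>-net has uniformly small late coordinates, and a coordinate never exceeds the norm.\<close>

lemma relatively_compact_in_ell_coordinates_small:
  fixes S :: "(nat \<Rightarrow> 'k::real_or_complex) set"
  assumes p: "1 \<le> p" and S: "relatively_compact_in (norm_topology (ell p) (ell_norm p)) S" and e: "e > 0"
  shows "\<forall>\<^sub>F n in sequentially. \<forall>x\<in>S. norm (x n) < e"
proof -
  interpret banach_space "ell p :: (nat \<Rightarrow> 'k) set" fscale "ell_norm p"
    using p by (rule banach_space_ell)
  obtain K where K: "finite K" "K \<subseteq> S" "\<forall>x\<in>S. \<exists>y\<in>K. ell_norm p (x - y) < e / 2" and SV: "S \<subseteq> ell p"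
    using S half_gt_zero[OF e] unfolding relatively_compact_in_norm_topology_iff by meson
  have "\<forall>\<^sub>F n in sequentially. \<forall>y\<in>K. norm (y n) < e / 2"
    using K(2) SV p e by (intro eventually_ball_finite[OF K(1)] ballI ell_coordinates_small[of p]) auto
  then show ?thesis
  proof eventually_elim
    case (elim n)
    show ?case
    proof
      fix x assume x: "x \<in> S"
      obtain y where y: "y \<in> K" "ell_norm p (x - y) < e / 2" using K(3) x by blast
      have "norm ((x - y) n) \<le> ell_norm p (x - y)"
        using p K(2) SV x y by (intro norm_le_ell_norm diff_mem) auto
      then have "norm (x n - y n) < e / 2" using y by simp
      moreover have "norm (y n) < e / 2" using elim y by blast
      ultimately show "norm (x n) < e" using norm_triangle_sub[of "x n" "y n"] by simp
    qed
  qed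
qed

text \<open>The operator attached to a weakly \<open>p\<close>-summable sequence \<open>\<xi>\<close> has \<open>\<xi> n\<close> as its \<open>n\<close>-th coordinate, so
  relative compactness of the image of \<open>A\<close> says that \<open>\<xi>\<close> tends to zero uniformly on \<open>A\<close>.\<close>

lemma (in locally_convex_space) p_Vstar_set_of_relatively_compact_images:
  assumes p: "1 \<le> p" and qb: "quasibarrelled s \<tau>" and A: "A \<noteq> {}" "A \<subseteq> topspace \<tau>"
    and rc: "\<And>T. operator s \<tau> fscale (norm_topology (ell p) (ell_norm p)) T \<Longrightarrow>
         relatively_compact_in (norm_topology (ell p) (ell_norm p)) (T ` A)"
  shows "p_Vstar_set p s \<tau> A"
  unfolding p_Vstar_set_def
proof (intro conjI allI impI A)
  fix \<xi> assume "weakly_p_summable p fscale (strong_topology s \<tau>) \<xi>"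
  then have "operator s \<tau> fscale (norm_topology (ell p) (ell_norm p)) (\<lambda>x n. \<xi> n x)"
    by (rule operator_of_weakly_p_summable[OF p qb])
  from relatively_compact_in_ell_coordinates_small[OF p rc[OF this]]
  show "(\<lambda>n. SUP a\<in>A. ereal (norm (\<xi> n a))) \<longlonglongrightarrow> 0"
    unfolding SUP_norm_tendsto_0_iff[OF A(1)] by simp
qed

section \<open>Bounded functionals on a Banach space\<close>

text \<open>Only homogeneity of \<open>f\<close> is assumed, so that maps such as \<open>\<lambda>x. f (cut I x)\<close> are covered as
  they stand.\<close>

lemma (in banach_space) norm_le_of_unit_ball:
  assumes scale: "\<And>c x. x \<in> V \<Longrightarrow> f (s c x) = c * f x"
    and le: "\<And>x. x \<in> V \<Longrightarrow> N x \<le> 1 \<Longrightarrow> norm (f x) \<le> M" and x: "x \<in> V"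
  shows "norm (f x) \<le> M * N x"
proof (cases "x = 0")
  case True
  then show ?thesis using scale[OF zero_mem, of 0] by (simp add: scale_zero_right)
next
  case False
  then have pos: "N x > 0" using norm_ge_0[OF x] norm_eq_0[OF x] by linarith
  have "N (s (of_real (inverse (N x))) x) = 1"
    using pos x norm_scale[OF x, of "of_real (inverse (N x))"] by (simp only: norm_of_real) simp
  then have "norm (f (s (of_real (inverse (N x))) x)) \<le> M" using le x by (simp add: scale_mem del: of_real_inverse)
  then have "norm (f x) / N x \<le> M"
    using scale[OF x] pos by (simp add: norm_mult norm_inverse divide_inverse mult.commute)
  then show ?thesis using pos by (simp add: pos_divide_le_eq)
qed

lemma (in banach_space) dual_iff_bounded:
  "f \<in> dual s (norm_topology V N) \<longleftrightarrow>
    (\<forall>x\<in>V. \<forall>y\<in>V. f (x + y) = f x + f y) \<and> (\<forall>c. \<forall>x\<in>V. f (s c x) = c * f x) \<and>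
    (\<forall>x. x \<notin> V \<longrightarrow> f x = 0) \<and> (\<exists>C. \<forall>x\<in>V. norm (f x) \<le> C * N x)"
    (is "_ \<longleftrightarrow> ?add \<and> ?scale \<and> ?off \<and> ?bd")
proof (intro iffI conjI)
  assume f: "f \<in> dual s (norm_topology V N)"
  then show ?add ?scale ?off by (auto simp: dual_def operator_def)
  have "bounded_in s (norm_topology V N) {x \<in> V. N x \<le> 1}"
    unfolding bounded_in_norm_topology_iff by auto
  then obtain M where M: "\<And>x. x \<in> {x \<in> V. N x \<le> 1} \<Longrightarrow> norm (f x) \<le> M"
    using dual_bounded_on[OF f] zero_mem by (metis topspace_norm_topology)
  have "norm (f x) \<le> M * N x" if x: "x \<in> V" for x
    using norm_le_of_unit_ball[of f M x] \<open>?scale\<close> M x by blast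
  then show ?bd by blast
next
  assume asm: "?add \<and> ?scale \<and> ?off \<and> ?bd"
  then obtain C where C: "\<And>x. x \<in> V \<Longrightarrow> norm (f x) \<le> C * N x" by blast
  have "continuous_map (norm_topology V N) euclidean f"
    unfolding continuous_map
  proof (intro conjI allI impI)
    fix G :: "'k set" assume G: "openin euclidean G"
    show "openin (norm_topology V N) {x \<in> topspace (norm_topology V N). f x \<in> G}"
      unfolding openin_norm_topology topspace_norm_topology
    proof (intro conjI ballI)
      fix x assume x: "x \<in> {x \<in> V. f x \<in> G}"
      then obtain e where e: "e > 0" "ball (f x) e \<subseteq> G" using G by (auto simp: open_contains_ball)
      have "f y \<in> G" if y: "y \<in> V" "N (y - x) < e / (\<bar>C\<bar> + 1)" for y
      proof -
        have "f y - f x = f (y - x)" using asm x y diff_mem[of y x] by (metis (no_types, lifting) add_diff_cancel diff_add_cancel mem_Collect_eq)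
        then have "norm (f y - f x) \<le> C * N (y - x)" using C x y by (simp add: diff_mem)
        also have "\<dots> \<le> (\<bar>C\<bar> + 1) * N (y - x)"
          using x y by (intro mult_right_mono norm_ge_0 diff_mem) auto
        also have "\<dots> < e" using y(2) by (simp add: pos_less_divide_eq mult.commute add_nonneg_pos)
        finally show ?thesis using e(2) by (auto simp: subset_iff dist_norm norm_minus_commute)
      qed
      then show "\<exists>r>0. \<forall>y\<in>V. N (y - x) < r \<longrightarrow> y \<in> {x \<in> V. f x \<in> G}"
        using e(1) by (intro exI[of _ "e / (\<bar>C\<bar> + 1)"]) (auto simp: add_nonneg_pos)
    qed auto
  qed auto
  with asm show "f \<in> dual s (norm_topology V N)" by (simp add: dual_def operator_def)
qed

section \<open>Images of p-(V*) sets\<close>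

text \<open>A set without finite nets for the (negated) relation \<open>R\<close> contains a sequence each member of which is
  \<open>R\<close>-related to all earlier ones.\<close>

lemma separated_sequence:
  assumes "\<forall>F. finite F \<longrightarrow> F \<subseteq> K \<longrightarrow> (\<exists>x\<in>K. \<forall>y\<in>F. R x y)"
  shows "\<exists>x :: nat \<Rightarrow> 'a. range x \<subseteq> K \<and> (\<forall>n. \<forall>m<n. R (x n) (x m))"
proof -
  have "\<exists>x. \<forall>n::nat. x n \<in> K \<and> (\<forall>m<n. R (x n) (x m))"
  proof (rule dependent_wellorder_choice)
    fix n and x :: "nat \<Rightarrow> 'a" assume "\<And>m. m < n \<Longrightarrow> x m \<in> K \<and> (\<forall>l<m. R (x m) (x l))"
    then have "x ` {..<n} \<subseteq> K" by auto
    then show "\<exists>r. r \<in> K \<and> (\<forall>m<n. R r (x m))"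
      using assms[rule_format, of "x ` {..<n}"] by auto
  qed auto
  then show ?thesis by blast
qed

text \<open>Each function maps \<open>A\<close> into a compact disc, which small discs cover; the pieces are intersections of
  preimages of these.\<close>

lemma finite_cover_small_oscillation:
  fixes F :: "('a \<Rightarrow> 'k::real_or_complex) set"
  assumes "finite F" "\<forall>g\<in>F. \<exists>M. \<forall>a\<in>A. norm (g a) \<le> M" "e > 0"
  shows "\<exists>\<P>. finite \<P> \<and> A \<subseteq> \<Union>\<P> \<and> (\<forall>P\<in>\<P>. \<forall>a\<in>P. \<forall>b\<in>P. \<forall>g\<in>F. norm (g a - g b) < e)"
  using assms(1,2)
proof (induction F)
    case empty
    show ?case by (intro exI[of _ "{A}"]) auto
  next
    case (insert g F)
    then obtain \<P> where P: "finite \<P>" "A \<subseteq> \<Union>\<P>"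
      "\<forall>P\<in>\<P>. \<forall>a\<in>P. \<forall>b\<in>P. \<forall>g\<in>F. norm (g a - g b) < e" by auto
    obtain M where M: "\<forall>a\<in>A. norm (g a) \<le> M" using insert.prems by blast
    obtain k :: "'k set" where k: "finite k" "cball 0 M \<subseteq> (\<Union>z\<in>k. ball z (e / 2))"
      using seq_compact_imp_totally_bounded[OF compact_imp_seq_compact[OF compact_cball_scalar[of M]],
          rule_format, OF half_gt_zero[OF assms(3)]]
      by metis
    define \<Q> where "\<Q> = (\<lambda>(P, z). {a \<in> P. g a \<in> ball z (e / 2)}) ` (\<P> \<times> k)"
    have "finite \<Q>" using P k by (simp add: \<Q>_def)
    moreover have "A \<subseteq> \<Union>\<Q>"
    proof
      fix a assume a: "a \<in> A"
      obtain P where "P \<in> \<P>" "a \<in> P" using P a by blast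
      moreover have "g a \<in> cball 0 M" using M a by simp
      then obtain z where "z \<in> k" "g a \<in> ball z (e / 2)" using k by blast
      ultimately show "a \<in> \<Union>\<Q>" unfolding \<Q>_def by blast
    qed
    moreover have "norm (h a - h b) < e" if "Q \<in> \<Q>" "a \<in> Q" "b \<in> Q" "h \<in> insert g F" for Q a b h
    proof -
      obtain P z where Pz: "P \<in> \<P>" "a \<in> P" "b \<in> P" "dist z (g a) < e / 2" "dist z (g b) < e / 2"
        using \<open>Q \<in> \<Q>\<close> \<open>a \<in> Q\<close> \<open>b \<in> Q\<close> unfolding \<Q>_def by auto
      show ?thesis
      proof (cases "h = g")
        case True
        have "dist (g a) (g b) < e" using Pz(4,5) by (rule dist_triangle_half_r)
        then show ?thesis by (simp add: True dist_norm)
      next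
        case False
        then show ?thesis using P(3) Pz that(4) by blast
      qed
    qed
    ultimately show ?case by (intro exI[of _ \<Q>]) simp
qed

text \<open>A weakly sequentially \<open>p\<close>-precompact set of functionals is totally bounded for uniform convergence on a
  p-(V*) set. Otherwise it contains an \<open>e\<close>-separated sequence, which has a weakly \<open>p\<close>-Cauchy
  subsequence; its consecutive differences form a weakly \<open>p\<close>-summable sequence, which tends to zero
  uniformly on \<open>A\<close>. This contradicts separation.\<close>

lemma p_Vstar_set_totally_bounded_functionals:
  assumes A: "p_Vstar_set p s \<tau> A" and K: "weakly_seq_p_precompact p fscale (strong_topology s \<tau>) K"
    and e: "e > 0"
  shows "\<exists>F. finite F \<and> F \<subseteq> K \<and> (\<forall>f\<in>K. \<exists>g\<in>F. \<forall>a\<in>A. norm (f a - g a) < e)"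
proof (rule ccontr)
    assume neg: "\<not> ?thesis"
    have far: "\<forall>F. finite F \<longrightarrow> F \<subseteq> K \<longrightarrow> (\<exists>f\<in>K. \<forall>g\<in>F. \<exists>a\<in>A. norm (f a - g a) \<ge> e)"
      using neg by (meson not_le)
    obtain x :: "nat \<Rightarrow> _" where x: "range x \<subseteq> K" and sep: "\<forall>n. \<forall>m<n. \<exists>a\<in>A. norm (x n a - x m a) \<ge> e"
      using separated_sequence[OF far] by (elim exE conjE)
    obtain r where r: "strict_mono r" "weakly_p_Cauchy p fscale (strong_topology s \<tau>) (x \<circ> r)"
      using K x unfolding weakly_seq_p_precompact_def by blast
    have "weakly_p_summable p fscale (strong_topology s \<tau>) (\<lambda>n. (x \<circ> r) (Suc n) - (x \<circ> r) (id n))"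
      using r(2) strict_mono_Suc_iff[of Suc] strict_mono_id unfolding weakly_p_Cauchy_def by blast
    then have "(\<lambda>n. SUP a\<in>A. ereal (norm (((x \<circ> r) (Suc n) - (x \<circ> r) (id n)) a))) \<longlonglongrightarrow> 0"
      using A unfolding p_Vstar_set_def by blast
    moreover have "A \<noteq> {}" using A by (simp add: p_Vstar_set_def)
    ultimately have "\<forall>\<epsilon>>0. \<forall>\<^sub>F n in sequentially. \<forall>a\<in>A. norm (((x \<circ> r) (Suc n) - (x \<circ> r) (id n)) a) < \<epsilon>"
      by (intro iffD1[OF SUP_norm_tendsto_0_iff])
    then have "\<forall>\<^sub>F n in sequentially. \<forall>a\<in>A. norm (((x \<circ> r) (Suc n) - (x \<circ> r) (id n)) a) < e"
      using e by simp
    then obtain n where "\<forall>a\<in>A. norm (((x \<circ> r) (Suc n) - (x \<circ> r) (id n)) a) < e"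
      by (auto simp: eventually_sequentially)
    moreover have "r n < r (Suc n)" using r(1) by (simp add: strict_mono_Suc_iff)
    ultimately show False using sep[rule_format, of "r n" "r (Suc n)"] by force
qed

text \<open>A neighbourhood \<open>U\<close> whose image under the adjoint is weakly sequentially \<open>p\<close>-precompact contains a
  multiple \<open>c\<close> of the dual unit ball. By the previous lemma finitely many functionals \<open>g\<close> in that image
  approximate all others uniformly on \<open>A\<close>, and \<open>A\<close> is covered by finitely many pieces on which these
  \<open>g\<close> hardly vary. Two points \<open>a\<close>, \<open>b\<close> of one piece are then nearly equal for every functional
  \<open>h \<circ> T\<close> with \<open>h\<close> in \<open>U\<close>. Taking for \<open>h\<close> the multiple by \<open>c\<close> of a functional norming \<open>T a - T b\<close>
  bounds the norm of this difference.\<close>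

lemma relatively_compact_image_of_p_Vstar_set:
  assumes A: "p_Vstar_set p s \<tau> A" and bd: "bounded_in s \<tau> A" and zero: "0 \<in> topspace \<tau>"
    and Y: "banach_space Y sY N" and T: "operator s \<tau> sY (norm_topology Y N) T"
    and adj: "weakly_seq_p_precompact_operator p fscale (strong_topology sY (norm_topology Y N))
        fscale (strong_topology s \<tau>) (adjoint_map \<tau> T)"
  shows "relatively_compact_in (norm_topology Y N) (T ` A)"
proof -
  interpret Y: banach_space Y sY N by fact
  have AV: "A \<subseteq> topspace \<tau>" using A by (simp add: p_Vstar_set_def)
  have TY: "T a \<in> Y" if "a \<in> A" for a using operator_mem[OF T] AV that by auto
  obtain U where U: "openin (strong_topology sY (norm_topology Y N)) U" "0 \<in> U"
    and pre: "weakly_seq_p_precompact p fscale (strong_topology s \<tau>) (adjoint_map \<tau> T ` U)"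
    using adj unfolding weakly_seq_p_precompact_operator_def by blast
  obtain B \<epsilon> where B: "bounded_in sY (norm_topology Y N) B" and eps: "\<epsilon> > 0"
    and BU: "{g \<in> dual sY (norm_topology Y N). \<forall>x\<in>B. norm (g x) < \<epsilon>} \<subseteq> U"
    by (rule strong_nhd_zero[OF U])
  obtain M where BY: "B \<subseteq> Y" and M: "\<forall>x\<in>B. N x \<le> M"
    using B unfolding Y.bounded_in_norm_topology_iff by blast
  define c where "c = \<epsilon> / (\<bar>M\<bar> + 1)"
  have c: "c > 0" using eps by (simp add: c_def add_nonneg_pos)
  have smallU: "g \<in> U" if g: "g \<in> dual sY (norm_topology Y N)" "\<And>y. y \<in> Y \<Longrightarrow> norm (g y) \<le> c * N y" for g
  proof -
    have "norm (g x) < \<epsilon>" if "x \<in> B" for x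
    proof -
      have "norm (g x) \<le> c * N x" using g(2) that BY by blast
      also have "\<dots> \<le> c * \<bar>M\<bar>" using M that c by (intro mult_left_mono) auto
      also have "\<dots> < c * (\<bar>M\<bar> + 1)" using c by simp
      also have "\<dots> = \<epsilon>" by (simp add: c_def)
      finally show ?thesis .
    qed
    then show ?thesis using BU g(1) by blast
  qed
  show ?thesis
    unfolding Y.relatively_compact_in_norm_topology_iff
  proof (intro conjI allI impI)
    show "T ` A \<subseteq> Y" using TY by blast
    fix e :: real assume e: "e > 0"
    \<comment> \<open>three errors of size \<open>\<delta>\<close> must stay below \<open>c * e\<close>\<close>
    define \<delta> where "\<delta> = c * e / 4"
    have delta: "\<delta> > 0" using c e by (simp add: \<delta>_def)
    obtain F where F: "finite F" "F \<subseteq> adjoint_map \<tau> T ` U"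
      "\<forall>f\<in>adjoint_map \<tau> T ` U. \<exists>g\<in>F. \<forall>a\<in>A. norm (f a - g a) < \<delta>"
      using p_Vstar_set_totally_bounded_functionals[OF A pre delta] by (elim exE conjE)
    have "\<forall>g\<in>F. \<exists>M. \<forall>a\<in>A. norm (g a) \<le> M"
    proof
      fix g assume g: "g \<in> F"
      have "g \<in> dual s \<tau>" using F(2) pre g unfolding weakly_seq_p_precompact_def by auto
      from dual_bounded_on[OF this bd zero] show "\<exists>M. \<forall>a\<in>A. norm (g a) \<le> M" by metis
    qed
    from finite_cover_small_oscillation[OF F(1) this delta]
    obtain \<P> where P: "finite \<P>" "A \<subseteq> \<Union>\<P>"
      and osc: "\<forall>P\<in>\<P>. \<forall>a\<in>P. \<forall>b\<in>P. \<forall>g\<in>F. norm (g a - g b) < \<delta>"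
      by (elim exE conjE)
    define pick where "pick P = (SOME a. a \<in> P \<inter> A)" for P
    have pick: "pick P \<in> P \<inter> A" if "a \<in> P" "a \<in> A" for P a
      unfolding pick_def by (rule someI[of _ a]) (use that in simp)
    define K where "K = pick ` {P \<in> \<P>. P \<inter> A \<noteq> {}}"
    have "finite K" using P(1) by (simp add: K_def)
    moreover have "K \<subseteq> A" unfolding K_def using pick by blast
    moreover have "\<exists>b\<in>K. N (T a - T b) < e" if a: "a \<in> A" for a
    proof -
      obtain P where Pa: "P \<in> \<P>" "a \<in> P" using P(2) a by blast
      define b where "b = pick P"
      have b: "b \<in> P" "b \<in> A" "b \<in> K" using pick[OF Pa(2) a] Pa a by (auto simp: b_def K_def)
      define y where "y = T a - T b"
      have y: "y \<in> Y" using TY a b Y.diff_mem by (simp add: y_def)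
      obtain f where f: "\<And>x z. x \<in> Y \<Longrightarrow> z \<in> Y \<Longrightarrow> f (x + z) = f x + f z"
        "\<And>d x. x \<in> Y \<Longrightarrow> f (sY d x) = d * f x" "\<And>x. x \<in> Y \<Longrightarrow> norm (f x) \<le> N x" "N y \<le> norm (f y)"
        using Y.norming_functional[OF y] by blast
      define h where "h x = (if x \<in> Y then of_real c * f x else 0)" for x
      have h_le: "norm (h x) \<le> c * N x" if "x \<in> Y" for x
        using f(3)[OF that] c that by (simp add: h_def norm_mult)
      have h_dual: "h \<in> dual sY (norm_topology Y N)"
        unfolding Y.dual_iff_bounded
      proof (intro conjI)
        show "\<exists>C. \<forall>x\<in>Y. norm (h x) \<le> C * N x" using h_le by blast
      qed (simp_all add: h_def f Y.add_mem Y.scale_mem algebra_simps)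
      then have "h \<in> U" using h_le by (intro smallU) auto
      then obtain g where g: "g \<in> F" "\<forall>x\<in>A. norm (adjoint_map \<tau> T h x - g x) < \<delta>"
        using F(3) by blast
      have close: "norm (h (T x) - g x) < \<delta>" if "x \<in> A" for x
        using g(2) that AV by (auto simp: adjoint_map_def subset_iff)
      have "h y = h (T a) - h (T b)"
        using operator_diff[OF dual_operator[OF h_dual], of "T a" "T b"] TY a b Y.diff_mem by (simp add: y_def)
      also have "\<dots> = (h (T a) - g a) + ((g a - g b) + - (h (T b) - g b))" by simp
      finally have "norm (h y) \<le> norm (h (T a) - g a) + (norm (g a - g b) + norm (h (T b) - g b))"
        using norm_triangle_ineq[of "h (T a) - g a" "(g a - g b) + - (h (T b) - g b)"]
          norm_triangle_ineq[of "g a - g b" "- (h (T b) - g b)"]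
        unfolding norm_minus_cancel by simp
      also have "\<dots> < \<delta> + (\<delta> + \<delta>)"
        using close[OF a] close[OF b(2)] osc[rule_format, OF Pa b(1) g(1)] by linarith
      finally have "norm (h y) < 3 * \<delta>" by simp
      moreover have "norm (h y) = c * norm (f y)" using y c by (simp add: h_def norm_mult)
      moreover have "c * N y \<le> c * norm (f y)" using f(4) c by simp
      moreover have "3 * \<delta> \<le> c * e" using mult_pos_pos[OF c e] by (simp add: \<delta>_def)
      ultimately have "c * N y < c * e" by linarith
      then have "N y < e" using c by simp
      then show ?thesis using b by (auto simp: y_def)
    qed
    ultimately show "\<exists>K. finite K \<and> K \<subseteq> T ` A \<and> (\<forall>x\<in>T ` A. \<exists>y\<in>K. N (x - y) < e)"
      by (intro exI[of _ "T ` K"]) auto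
  qed
qed

section \<open>Coordinate projections in \<open>\<ell>\<^sub>p\<close>\<close>

abbreviation ell_topology :: "real \<Rightarrow> (nat \<Rightarrow> 'k::real_or_complex) topology" where
  "ell_topology p \<equiv> norm_topology (ell p) (ell_norm p)"

abbreviation ell_dual :: "real \<Rightarrow> ((nat \<Rightarrow> 'k::real_or_complex) \<Rightarrow> 'k) set" where
  "ell_dual p \<equiv> dual fscale (ell_topology p)"

definition cut :: "nat set \<Rightarrow> (nat \<Rightarrow> 'k::real_or_complex) \<Rightarrow> nat \<Rightarrow> 'k" where
  "cut I x = (\<lambda>i. if i \<in> I then x i else 0)"

definition unit :: "nat \<Rightarrow> nat \<Rightarrow> 'k::real_or_complex" where
  "unit i = cut {i} (\<lambda>_. 1)"

lemma sum_powr_cut: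
  "finite J \<Longrightarrow> (\<Sum>i\<in>J. norm (cut I x i) powr p) = (\<Sum>i\<in>J \<inter> I. norm (x i) powr p)"
  by (simp add: cut_def sum.inter_restrict if_distrib[of norm] if_distrib[of "\<lambda>t. t powr p"] cong: if_cong)

lemma ell_norm_cut:
  assumes "0 < p" "x \<in> ell p"
  shows cut_in_ell: "cut I x \<in> ell p" and "ell_norm p (cut I x) \<le> ell_norm p x"
proof -
  have "(\<Sum>n<N. norm (cut I x n) powr p) \<le> ell_norm p x powr p" for N
    using sum_le_ell_norm[OF assms, of "{..<N} \<inter> I"] by (simp add: sum_powr_cut)
  then show "cut I x \<in> ell p" "ell_norm p (cut I x) \<le> ell_norm p x"
    using ell_norm_leI[OF assms(1) ell_norm_nonneg[of p x], of "cut I x"] by blast+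
qed

lemma ell_norm_cut_finite:
  assumes "0 < p" "finite I"
  shows cut_finite_in_ell: "cut I x \<in> ell p"
    and "ell_norm p (cut I x) powr p = (\<Sum>i\<in>I. norm (x i) powr p)"
proof -
  have "(\<lambda>n. norm (cut I x n) powr p) sums (\<Sum>i\<in>I. norm (cut I x i) powr p)"
    using assms by (intro sums_finite) (auto simp: cut_def)
  then have s: "(\<lambda>n. norm (cut I x n) powr p) sums (\<Sum>i\<in>I. norm (x i) powr p)"
    using assms by (simp add: sum_powr_cut)
  then show "cut I x \<in> ell p" by (auto simp: ell_def summable_def)
  then show "ell_norm p (cut I x) powr p = (\<Sum>i\<in>I. norm (x i) powr p)"
    using ell_norm_powr[OF assms(1)] sums_unique[OF s] by metis
qed

lemma cut_Un: "I \<inter> J = {} \<Longrightarrow> cut (I \<union> J) x = cut I x + cut J x"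
  by (auto simp: cut_def fun_eq_iff)

lemma cut_UNIV: "cut UNIV x = x"
  by (simp add: cut_def)

lemma cut_empty: "cut {} x = 0"
  by (simp add: cut_def zero_fun_def)

lemma unit_in_ell: "0 < p \<Longrightarrow> unit i \<in> ell p"
  unfolding unit_def by (rule cut_finite_in_ell) auto

lemma ell_norm_tail_small:
  assumes p: "0 < p" and x: "x \<in> ell p" and e: "e > 0"
  shows "\<exists>M. \<forall>m\<ge>M. ell_norm p (cut {m..} x) \<le> e"
proof -
  have "summable (\<lambda>n. norm (x n) powr p)" using x by (simp add: ell_def)
  moreover have "e powr p > 0" using e by simp
  ultimately obtain M where M: "\<forall>m\<ge>M. \<forall>n. norm (\<Sum>i\<in>{m..<n}. norm (x i) powr p) < e powr p"
    unfolding summable_Cauchy by blast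
  have "ell_norm p (cut {m..} x) \<le> e" if m: "m \<ge> M" for m
  proof (rule ell_norm_leI)
    fix N
    have "{..<N} \<inter> {m..} = {m..<N}" by auto
    then have "(\<Sum>n<N. norm (cut {m..} x n) powr p) = (\<Sum>i\<in>{m..<N}. norm (x i) powr p)"
      by (simp add: sum_powr_cut)
    also have "\<dots> \<le> e powr p" using M[rule_format, OF m, of N] by simp
    finally show "(\<Sum>n<N. norm (cut {m..} x n) powr p) \<le> e powr p" .
  qed (use p e in auto)
  then show ?thesis by blast
qed

lemma ell_dominated:
  assumes "y \<in> ell p" "\<And>n. norm (x n) \<le> norm (y n)" "0 < p"
  shows "x \<in> ell p"
proof -
  have "summable (\<lambda>n. norm (y n) powr p)" using assms(1) by (simp add: ell_def)
  then have "summable (\<lambda>n. norm (x n) powr p)"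
    by (rule summable_comparison_test'[where N=0]) (use assms(2,3) in \<open>auto intro!: powr_mono2\<close>)
  then show ?thesis by (simp add: ell_def)
qed

lemma ell_subseq:
  assumes "x \<in> ell p" "strict_mono k" "0 < p"
  shows "(\<lambda>n. x (k n)) \<in> ell p"
proof (rule ell_memI[OF assms(3) ell_norm_nonneg[of p x]])
  fix N
  have "(\<Sum>n<N. norm (x (k n)) powr p) = (\<Sum>i\<in>k ` {..<N}. norm (x i) powr p)"
    using strict_mono_imp_inj_on[OF assms(2)] by (subst sum.reindex) (auto intro: inj_on_subset)
  also have "\<dots> \<le> ell_norm p x powr p"
    using assms by (intro sum_le_ell_norm) auto
  finally show "(\<Sum>n<N. norm (x (k n)) powr p) \<le> ell_norm p x powr p" .
qed

section \<open>The dual of \<open>\<ell>\<^sub>p\<close>\<close>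

lemma ell_dual_iff:
  assumes "1 \<le> p"
  shows "f \<in> ell_dual p \<longleftrightarrow>
    (\<forall>x\<in>ell p. \<forall>y\<in>ell p. f (x + y) = f x + f y) \<and> (\<forall>c. \<forall>x\<in>ell p. f (fscale c x) = c * f x) \<and>
    (\<forall>x. x \<notin> ell p \<longrightarrow> f x = 0) \<and> (\<exists>C. \<forall>x\<in>ell p. norm (f x) \<le> C * ell_norm p x)"
  by (rule banach_space.dual_iff_bounded[OF banach_space_ell[OF assms]])

lemma ell_dual_add: "1 \<le> p \<Longrightarrow> f \<in> ell_dual p \<Longrightarrow> x \<in> ell p \<Longrightarrow> y \<in> ell p \<Longrightarrow> f (x + y) = f x + f y"
  unfolding ell_dual_iff by blast

lemma ell_dual_scale: "1 \<le> p \<Longrightarrow> f \<in> ell_dual p \<Longrightarrow> x \<in> ell p \<Longrightarrow> f (fscale c x) = c * f x"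
  unfolding ell_dual_iff by blast

lemma ell_dual_zero: "1 \<le> p \<Longrightarrow> f \<in> ell_dual p \<Longrightarrow> f 0 = 0"
  using ell_dual_add[of p f 0 0] by (simp add: ell_def)

lemma ell_dual_bound:
  assumes "1 \<le> p" "f \<in> ell_dual p"
  obtains C where "C \<ge> 0" "\<forall>x\<in>ell p. norm (f x) \<le> C * ell_norm p x"
proof -
  obtain C where C: "\<forall>x\<in>ell p. norm (f x) \<le> C * ell_norm p x"
    using assms(2) unfolding ell_dual_iff[OF assms(1)] by blast
  have "norm (f x) \<le> \<bar>C\<bar> * ell_norm p x" if "x \<in> ell p" for x
    using bspec[OF C that] mult_right_mono[OF abs_ge_self[of C] ell_norm_nonneg[of p x]] by linarith
  then show thesis using that[of "\<bar>C\<bar>"] by simp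
qed

lemma ell_dual_cut_finite:
  assumes p: "1 \<le> p" and f: "f \<in> ell_dual p" and "finite I"
  shows "f (cut I x) = (\<Sum>i\<in>I. x i * f (unit i))"
  using assms(3)
proof (induction I)
  case empty
  show ?case unfolding cut_empty sum.empty by (rule ell_dual_zero[OF p f])
next
  case (insert i I)
  have "cut {i} x = fscale (x i) (unit i)"
    by (auto simp: cut_def unit_def fscale_def)
  then have "cut (insert i I) x = fscale (x i) (unit i) + cut I x"
    using cut_Un[of "{i}" I x] insert.hyps by simp
  moreover have "f (fscale (x i) (unit i) + cut I x) = x i * f (unit i) + f (cut I x)"
    using p insert.hyps
    by (simp add: ell_dual_add[OF p f] ell_dual_scale[OF p f] ell_scale unit_in_ell cut_finite_in_ell)
  ultimately show ?case by (simp only: insert.IH sum.insert[OF insert.hyps])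
qed

lemma ell_dual_cut_split:
  assumes p: "1 \<le> p" and f: "f \<in> ell_dual p" and x: "x \<in> ell p"
  shows "f (cut {m..} x) = f (cut {m..<m + n} x) + f (cut {m + n..} x)"
    and "f x = f (cut {..<n} x) + f (cut {n..} x)"
proof -
  have "{m..} = {m..<m + n} \<union> {m + n..}" by auto
  moreover have "{m..<m + n} \<inter> {m + n..} = {}" by auto
  ultimately have "cut {m..} x = cut {m..<m + n} x + cut {m + n..} x"
    using cut_Un[of "{m..<m + n}" "{m + n..}" x] by simp
  then show "f (cut {m..} x) = f (cut {m..<m + n} x) + f (cut {m + n..} x)"
    using p x by (simp add: ell_dual_add[OF p f] cut_in_ell)
  have "UNIV = {..<n} \<union> {n..}" "{..<n} \<inter> {n..} = {}" by auto
  then have "x = cut {..<n} x + cut {n..} x"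
    using cut_Un[of "{..<n}" "{n..}" x] cut_UNIV[of x] by simp
  moreover have "f (cut {..<n} x + cut {n..} x) = f (cut {..<n} x) + f (cut {n..} x)"
    using p x by (simp add: ell_dual_add[OF p f] cut_in_ell)
  ultimately show "f x = f (cut {..<n} x) + f (cut {n..} x)" by simp
qed

text \<open>The coefficients of a functional lie in \<open>\<ell>\<^sub>q\<close> for the conjugate exponent \<open>q = p / (p - 1)\<close>. By the converse
  of Hoelder's inequality, now with exponent \<open>q\<close>, it suffices to test with the vectors whose
  coordinates are \<open>dual_coeff q (v i)\<close>; their \<open>p\<close>-th powers are the \<open>q\<close>-th powers of \<open>v i\<close> because of
  \<open>(q - 1) * p = q\<close>.\<close>

lemma ell_dual_coefficients_summable:
  assumes p: "1 < p" and f: "f \<in> ell_dual p"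
  shows "summable (\<lambda>i. norm (f (unit i)) powr (p / (p - 1)))"
proof -
  define q where "q = p / (p - 1)"
  have q: "q > 0" "(q - 1) * p = q" using p by (auto simp: q_def field_simps)
  obtain C where C: "C \<ge> 0" "\<forall>x\<in>ell p. norm (f x) \<le> C * ell_norm p x"
    using ell_dual_bound[OF less_imp_le[OF p] f] .
  have le: "(\<Sum>i<N. norm (f (unit i)) powr q) \<le> C powr q" for N
  proof (rule sum_powr_le_of_dual_coeff[OF q(1) C(1)])
    fix v :: "nat \<Rightarrow> 'a" assume v: "(\<Sum>i<N. norm (v i) powr q) \<le> 1"
    let ?w = "cut {..<N} (\<lambda>i. dual_coeff q (v i))"
    have w: "?w \<in> ell p" using p by (intro cut_finite_in_ell) auto
    have "ell_norm p ?w \<le> 1"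
    proof (rule ell_norm_leI)
      fix K
      have "(\<Sum>n<K. norm (?w n) powr p) = (\<Sum>i\<in>{..<K} \<inter> {..<N}. norm (v i) powr q)"
        by (simp add: sum_powr_cut norm_dual_coeff powr_powr q(2))
      also have "\<dots> \<le> (\<Sum>i<N. norm (v i) powr q)" by (intro sum_mono2) auto
      finally show "(\<Sum>n<K. norm (?w n) powr p) \<le> 1 powr p" using v by simp
    qed (use p in auto)
    then have "norm (f ?w) \<le> C * 1"
      using bspec[OF C(2) w] mult_left_mono[OF _ C(1)] by (meson order_trans)
    then show "norm (\<Sum>i<N. dual_coeff q (v i) * f (unit i)) \<le> C"
      using ell_dual_cut_finite[OF less_imp_le[OF p] f, of "{..<N}"] by simp
  qed
  have "summable (\<lambda>i. norm (f (unit i)) powr q)"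
  proof (rule bounded_imp_summable)
    show "(\<Sum>k\<le>n. norm (f (unit k)) powr q) \<le> C powr q" for n
      using le[of "Suc n"] by (simp only: lessThan_Suc_atMost)
  qed simp
  then show ?thesis by (simp only: q_def)
qed

lemma mult_le_powr_add_powr:
  fixes a b :: real
  assumes "1 < p" "a \<ge> 0" "b \<ge> 0"
  shows "a * b \<le> a powr p + b powr (p / (p - 1))"
proof -
  have q: "p / (p - 1) > 1" "1 / p + 1 / (p / (p - 1)) = 1" using assms(1) by (auto simp: field_simps)
  have "a * b \<le> a powr p / p + b powr (p / (p - 1)) / (p / (p - 1))"
    using assms q by (intro Youngs_inequality)
  also have "\<dots> \<le> a powr p + b powr (p / (p - 1))"
  proof (rule add_mono)
    show "a powr p / p \<le> a powr p"
      using divide_left_mono[of 1 p "a powr p"] assms(1) by simp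
    show "b powr (p / (p - 1)) / (p / (p - 1)) \<le> b powr (p / (p - 1))"
      using divide_left_mono[of 1 "p / (p - 1)" "b powr (p / (p - 1))"] q(1) by (simp only: powr_ge_zero) simp
  qed
  finally show ?thesis .
qed

text \<open>The norm of a functional restricted to the late coordinates tends to zero; this is where \<open>p > 1\<close> is
  essential (on \<open>\<ell>\<^sub>1\<close> the sum of all coordinates is a counterexample). Splitting \<open>x i * y i\<close> as
  \<open>(t * x i) * (y i / t)\<close> with \<open>t powr p = e / 2\<close> lets the unit ball contribute at most \<open>e / 2\<close>,
  whatever the tail of the coefficients \<open>y\<close> then has to be.\<close>

lemma ell_dual_tail_small:
  assumes p: "1 < p" and f: "f \<in> ell_dual p" and e: "e > 0"
  shows "\<exists>M. \<forall>m\<ge>M. \<forall>x\<in>ell p. norm (f (cut {m..} x)) \<le> e * ell_norm p x"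
proof -
  have p1: "1 \<le> p" and p0: "0 < p" using p by auto
  define q where "q = p / (p - 1)"
  define t where "t = (e / 2) powr (1 / p)"
  have t: "t > 0" "t powr p = e / 2" using e p by (auto simp: t_def powr_powr)
  obtain C where C: "C \<ge> 0" "\<forall>x\<in>ell p. norm (f x) \<le> C * ell_norm p x"
    using ell_dual_bound[OF p1 f] .
  have "e / 2 * t powr q > 0" using e t by simp
  then obtain M where M: "\<forall>m\<ge>M. \<forall>n. norm (\<Sum>i\<in>{m..<n}. norm (f (unit i)) powr q) < e / 2 * t powr q"
    using ell_dual_coefficients_summable[OF p f] unfolding q_def[symmetric] summable_Cauchy by blast
  have block: "norm (f (cut {m..<n} x)) \<le> e" if m: "m \<ge> M" and x: "x \<in> ell p" "ell_norm p x \<le> 1" for m n x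
  proof -
    have "norm (f (cut {m..<n} x)) \<le> (\<Sum>i\<in>{m..<n}. norm (x i * f (unit i)))"
      unfolding ell_dual_cut_finite[OF p1 f finite_atLeastLessThan] by (rule norm_sum)
    also have "\<dots> \<le> (\<Sum>i\<in>{m..<n}. t powr p * norm (x i) powr p + norm (f (unit i)) powr q / t powr q)"
    proof (rule sum_mono)
      fix i
      have "norm (x i * f (unit i)) = (t * norm (x i)) * (norm (f (unit i)) / t)"
        using t by (simp add: norm_mult)
      also have "\<dots> \<le> (t * norm (x i)) powr p + (norm (f (unit i)) / t) powr q"
        unfolding q_def using p t by (intro mult_le_powr_add_powr) auto
      finally show "norm (x i * f (unit i)) \<le> t powr p * norm (x i) powr p + norm (f (unit i)) powr q / t powr q"
        using t(1) by (simp add: powr_mult powr_divide)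
    qed
    also have "\<dots> = t powr p * (\<Sum>i\<in>{m..<n}. norm (x i) powr p) + (\<Sum>i\<in>{m..<n}. norm (f (unit i)) powr q) / t powr q"
      by (simp add: sum.distrib sum_distrib_left sum_divide_distrib)
    also have "\<dots> \<le> t powr p * 1 + (e / 2 * t powr q) / t powr q"
    proof (intro add_mono mult_left_mono divide_right_mono)
      have "(\<Sum>i\<in>{m..<n}. norm (x i) powr p) \<le> ell_norm p x powr p"
        using p0 x(1) by (intro sum_le_ell_norm) auto
      also have "\<dots> \<le> 1" using x(2) p ell_norm_nonneg[of p x] by (simp add: powr_le1)
      finally show "(\<Sum>i\<in>{m..<n}. norm (x i) powr p) \<le> 1" .
      show "(\<Sum>i\<in>{m..<n}. norm (f (unit i)) powr q) \<le> e / 2 * t powr q"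
        using M[rule_format, OF m, of n] by simp
    qed auto
    finally show ?thesis using t by simp
  qed
  have unit_ball: "norm (f (cut {m..} x)) \<le> e" if m: "m \<ge> M" and x: "x \<in> ell p" "ell_norm p x \<le> 1" for m x
  proof (rule field_le_epsilon)
    fix d :: real assume d: "d > 0"
    have "d / (C + 1) > 0" using d C by simp
    then obtain n where n: "\<forall>k\<ge>n. ell_norm p (cut {k..} x) \<le> d / (C + 1)"
      using ell_norm_tail_small[OF p0 x(1)] by blast
    have "norm (f (cut {m + n..} x)) \<le> C * ell_norm p (cut {m + n..} x)"
      using C(2) cut_in_ell[OF p0 x(1)] by blast
    also have "\<dots> \<le> C * (d / (C + 1))" using n C(1) by (intro mult_left_mono) auto
    also have "\<dots> \<le> d" using C(1) d by (simp add: field_simps)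
    finally have "norm (f (cut {m + n..} x)) \<le> d" .
    then show "norm (f (cut {m..} x)) \<le> e + d"
      using ell_dual_cut_split(1)[OF p1 f x(1), of m n] block[OF m x, of "m + n"]
        norm_triangle_ineq[of "f (cut {m..<m + n} x)" "f (cut {m + n..} x)"] by simp
  qed
  have "norm (f (cut {m..} x)) \<le> e * ell_norm p x" if m: "m \<ge> M" and x: "x \<in> ell p" for m x
  proof (rule banach_space.norm_le_of_unit_ball[OF banach_space_ell[OF p1], of "\<lambda>x. f (cut {m..} x)" e x])
    fix c :: 'a and x :: "nat \<Rightarrow> 'a" assume x: "x \<in> ell p"
    have "cut {m..} (fscale c x) = fscale c (cut {m..} x)" by (auto simp: cut_def fscale_def)
    then show "f (cut {m..} (fscale c x)) = c * f (cut {m..} x)"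
      using ell_dual_scale[OF p1 f cut_in_ell[OF p0 x]] by simp
  qed (use unit_ball[OF m] x in auto)
  then show ?thesis by blast
qed

section \<open>Reflexivity of \<open>\<ell>\<^sub>p\<close>\<close>

lemma ell_dual_coordinate:
  assumes p: "1 \<le> p"
  shows "(\<lambda>x. if x \<in> ell p then x i else 0) \<in> ell_dual p"
  unfolding ell_dual_iff[OF p] using p
  by (auto simp: ell_add ell_scale fscale_apply norm_le_ell_norm intro!: exI[of _ 1])

lemma ell_dual_cut:
  assumes p: "1 \<le> p" and f: "f \<in> ell_dual p"
  shows "(\<lambda>x. if x \<in> ell p then f (cut I x) else 0) \<in> ell_dual p"
proof -
  have p0: "0 < p" using p by simp
  obtain C where C: "C \<ge> 0" "\<forall>x\<in>ell p. norm (f x) \<le> C * ell_norm p x"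
    using ell_dual_bound[OF p f] .
  have "norm (f (cut I x)) \<le> C * ell_norm p x" if "x \<in> ell p" for x
  proof -
    have "norm (f (cut I x)) \<le> C * ell_norm p (cut I x)" using C(2) cut_in_ell[OF p0 that] by blast
    also have "\<dots> \<le> C * ell_norm p x" using C(1) ell_norm_cut(2)[OF p0 that] by (rule mult_left_mono[rotated])
    finally show ?thesis .
  qed
  moreover have "cut I (x + y) = cut I x + cut I y" for x y :: "nat \<Rightarrow> 'a"
    by (auto simp: cut_def)
  moreover have "cut I (fscale c x) = fscale c (cut I x)" for c and x :: "nat \<Rightarrow> 'a"
    by (auto simp: cut_def fscale_def)
  ultimately show ?thesis
    unfolding ell_dual_iff[OF p]
    by (auto simp: ell_add[OF p] ell_scale ell_dual_add[OF p f] ell_dual_scale[OF p f] cut_in_ell[OF p0])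
qed

text \<open>Bounded sets of \<open>\<ell>\<^sub>p\<close> are norm bounded, so bidual elements are bounded for the dual norm. The dual norm
  itself is avoided: \<open>c\<close> stands for any bound of it.\<close>

lemma bidual_norm_bound:
  assumes p: "1 \<le> p" and \<phi>: "\<phi> \<in> dual fscale (strong_topology fscale (ell_topology p))"
  obtains R where "R \<ge> 0"
    "\<forall>c>0. \<forall>f\<in>ell_dual p. (\<forall>x\<in>ell p. norm (f x) \<le> c * ell_norm p x) \<longrightarrow> norm (\<phi> f) \<le> R * c"
proof -
  obtain B D where B: "bounded_in fscale (ell_topology p) B" and D: "D \<ge> 0"
    "\<forall>f\<in>ell_dual p. (\<forall>x\<in>B. norm (f x) \<le> 1) \<longrightarrow> norm (\<phi> f) \<le> D"
    and scale: "\<forall>c. \<forall>f\<in>ell_dual p. \<phi> (fscale c f) = c * \<phi> f"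
    using \<phi> unfolding bidual_iff by blast
  obtain M where M: "B \<subseteq> ell p" "\<forall>x\<in>B. ell_norm p x \<le> M"
    using B unfolding banach_space.bounded_in_norm_topology_iff[OF banach_space_ell[OF p]] by blast
  define L where "L = \<bar>M\<bar> + 1"
  have L: "L > 0" "\<forall>x\<in>B. ell_norm p x \<le> L" using M(2) by (auto simp: L_def)
  have "norm (\<phi> f) \<le> (D * L) * c" if c: "c > 0" and f: "f \<in> ell_dual p"
    and le: "\<forall>x\<in>ell p. norm (f x) \<le> c * ell_norm p x" for c f
  proof -
    define g where "g = fscale (of_real (1 / (c * L))) f"
    have g: "g \<in> ell_dual p" unfolding g_def by (rule fscale_in_dual[OF f])
    have "norm (g x) \<le> 1" if x: "x \<in> B" for x
    proof -
      have "norm (f x) \<le> c * ell_norm p x" using le x M by blast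
      also have "\<dots> \<le> c * L" using c L x by simp
      finally show ?thesis using c L(1) by (simp add: g_def fscale_def norm_mult norm_divide pos_divide_le_eq)
    qed
    then have "norm (\<phi> g) \<le> D" using D(2) g by blast
    moreover have "\<phi> g = of_real (1 / (c * L)) * \<phi> f" using scale f by (simp add: g_def)
    ultimately show ?thesis
      using c L(1) by (simp add: norm_mult norm_divide pos_divide_le_eq mult_ac)
  qed
  then show thesis using D(1) L(1) that[of "D * L"] by simp
qed

text \<open>The representing point has the coordinates \<open>z i = \<phi> (coord i)\<close>, with \<open>coord i\<close> the \<open>i\<close>-th coordinate
  functional. It lies in \<open>\<ell>\<^sub>p\<close> by the converse of Hoelder's inequality, as the combinations \<open>h\<close> of
  coordinate functionals with coefficients \<open>dual_coeff p (v i)\<close> have dual norm at most 2. Then \<open>\<phi> f\<close> and \<open>f z\<close> agree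
  for finite combinations of coordinate functionals, hence for all \<open>f\<close> because the tails of \<open>f\<close> are
  small.\<close>

lemma ell_reflexive:
  assumes p: "1 < p" and \<phi>: "\<phi> \<in> dual fscale (strong_topology fscale (ell_topology p))"
  shows "\<exists>z\<in>ell p. \<forall>f\<in>ell_dual p. \<phi> f = f z"
proof -
  have p1: "1 \<le> p" and p0: "0 < p" using p by auto
  have add: "\<phi> (f + g) = \<phi> f + \<phi> g" and scale: "\<phi> (fscale c f) = c * \<phi> f"
    if "f \<in> ell_dual p" "g \<in> ell_dual p" for f g c
    using \<phi> that unfolding bidual_iff by blast+
  have phi0: "\<phi> 0 = 0" using add[OF zero_in_dual zero_in_dual] by simp
  obtain R where R: "R \<ge> 0" and est: "\<forall>c>0. \<forall>f\<in>ell_dual p.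
      (\<forall>x\<in>ell p. norm (f x) \<le> c * ell_norm p x) \<longrightarrow> norm (\<phi> f) \<le> R * c"
    using bidual_norm_bound[OF p1 \<phi>] .
  define coord :: "nat \<Rightarrow> (nat \<Rightarrow> 'a) \<Rightarrow> 'a" where "coord i = (\<lambda>x. if x \<in> ell p then x i else 0)" for i
  have coord: "coord i \<in> ell_dual p" for i unfolding coord_def by (rule ell_dual_coordinate[OF p1])
  define z where "z i = \<phi> (coord i)" for i
  have comb: "(\<Sum>i<N. fscale (c i) (coord i)) \<in> ell_dual p" for c and N :: nat
    by (intro sum_in_dual fscale_in_dual coord)
  have comb_apply: "(\<Sum>i<N. fscale (c i) (coord i)) x = (\<Sum>i<N. c i * x i)" if "x \<in> ell p" for c x and N :: nat
    using that by (simp add: sum_fun_apply fscale_def coord_def)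
  have phi_comb: "\<phi> (\<Sum>i<N. fscale (c i) (coord i)) = (\<Sum>i<N. c i * z i)" for c and N :: nat
  proof (induction N)
    case 0
    show ?case by (simp add: phi0 flip: zero_fun_def)
  next
    case (Suc N)
    have "\<phi> (\<Sum>i<Suc N. fscale (c i) (coord i)) = \<phi> ((\<Sum>i<N. fscale (c i) (coord i)) + fscale (c N) (coord N))"
      by simp
    also have "\<dots> = \<phi> (\<Sum>i<N. fscale (c i) (coord i)) + \<phi> (fscale (c N) (coord N))"
      by (rule add[OF comb fscale_in_dual[OF coord]])
    also have "\<phi> (fscale (c N) (coord N)) = c N * z N"
      using scale[OF coord coord] by (simp add: z_def)
    finally show ?case unfolding Suc by (simp only: sum.lessThan_Suc)
  qed
  have "(\<Sum>i<N. norm (z i) powr p) \<le> (R * 2) powr p" for N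
  proof (rule sum_powr_le_of_dual_coeff[OF p0])
    show "R * 2 \<ge> 0" using R by simp
    fix v :: "nat \<Rightarrow> 'a" assume v: "(\<Sum>i<N. norm (v i) powr p) \<le> 1"
    let ?h = "\<Sum>i<N. fscale (dual_coeff p (v i)) (coord i)"
    have "norm (?h x) \<le> 2 * ell_norm p x" if x: "x \<in> ell p" for x
    proof (rule banach_space.norm_le_of_unit_ball[OF banach_space_ell[OF p1] _ _ x])
      show "?h (fscale c x) = c * ?h x" if "x \<in> ell p" for c x
        by (rule ell_dual_scale[OF p1 comb that])
      fix x :: "nat \<Rightarrow> 'a" assume x: "x \<in> ell p" "ell_norm p x \<le> 1"
      have "norm (?h x) \<le> (\<Sum>i<N. norm (dual_coeff p (v i) * x i))"
        unfolding comb_apply[OF x(1)] by (rule norm_sum)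
      also have "\<dots> \<le> (\<Sum>i<N. norm (v i) powr p + norm (x i) powr p)"
        using p by (intro sum_mono norm_dual_coeff_mult_le) auto
      also have "\<dots> = (\<Sum>i<N. norm (v i) powr p) + (\<Sum>i<N. norm (x i) powr p)"
        by (rule sum.distrib)
      also have "\<dots> \<le> 1 + ell_norm p x powr p"
        using v sum_le_ell_norm[OF p0 x(1), of "{..<N}"] by simp
      also have "ell_norm p x powr p \<le> 1" using x(2) p ell_norm_nonneg[of p x] by (simp add: powr_le1)
      finally show "norm (?h x) \<le> 2" by simp
    qed
    then have "norm (\<phi> ?h) \<le> R * 2" using est[rule_format, of 2 ?h] comb by simp
    then show "norm (\<Sum>i<N. dual_coeff p (v i) * z i) \<le> R * 2" by (simp only: phi_comb)
  qed
  then have z: "z \<in> ell p" using p0 R by (intro ell_memI[of p "R * 2"]) auto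
  have "\<phi> f = f z" if f: "f \<in> ell_dual p" for f
  proof -
    have "norm (\<phi> f - f z) \<le> 0 + e" if e: "e > 0" for e
    proof -
      define d where "d = e / (R + ell_norm p z + 1)"
      have pos: "R + ell_norm p z + 1 > 0" using R ell_norm_nonneg[of p z] by simp
      then have d: "d > 0" using e by (simp add: d_def)
      obtain M where M: "\<forall>m\<ge>M. \<forall>x\<in>ell p. norm (f (cut {m..} x)) \<le> d * ell_norm p x"
        using ell_dual_tail_small[OF p f d] by blast
      define t where "t = (\<lambda>x. if x \<in> ell p then f (cut {M..} x) else 0)"
      have t: "t \<in> ell_dual p" unfolding t_def by (rule ell_dual_cut[OF p1 f])
      have "f = (\<Sum>i<M. fscale (f (unit i)) (coord i)) + t"
      proof
        fix x
        show "f x = ((\<Sum>i<M. fscale (f (unit i)) (coord i)) + t) x"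
        proof (cases "x \<in> ell p")
          case True
          have "f (cut {..<M} x) = (\<Sum>i<M. fscale (f (unit i)) (coord i)) x"
            unfolding comb_apply[OF True] ell_dual_cut_finite[OF p1 f finite_lessThan]
            by (simp add: mult.commute)
          then show ?thesis
            using ell_dual_cut_split(2)[OF p1 f True, of M] True by (simp add: t_def)
        next
          case False
          then show ?thesis
            using f unfolding ell_dual_iff[OF p1] by (simp add: t_def sum_fun_apply fscale_def coord_def)
        qed
      qed
      then have "\<phi> f = \<phi> (\<Sum>i<M. fscale (f (unit i)) (coord i)) + \<phi> t"
        using add[OF comb t] by metis
      also have "\<phi> (\<Sum>i<M. fscale (f (unit i)) (coord i)) = f (cut {..<M} z)"
        unfolding phi_comb ell_dual_cut_finite[OF p1 f finite_lessThan] by (simp add: mult.commute)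
      finally have "\<phi> f - f z = \<phi> t - f (cut {M..} z)"
        using ell_dual_cut_split(2)[OF p1 f z, of M] by simp
      also have "norm \<dots> \<le> norm (\<phi> t) + norm (f (cut {M..} z))" by (rule norm_triangle_ineq4)
      also have "\<dots> \<le> R * d + d * ell_norm p z"
      proof (rule add_mono)
        show "norm (\<phi> t) \<le> R * d" using est[rule_format, OF d t] M by (simp add: t_def)
        show "norm (f (cut {M..} z)) \<le> d * ell_norm p z" using M z by blast
      qed
      also have "\<dots> = d * (R + ell_norm p z)" by (simp add: algebra_simps)
      also have "\<dots> \<le> d * (R + ell_norm p z + 1)" using d by simp
      also have "\<dots> = e" using pos by (simp add: d_def)
      finally show ?thesis by simp
    qed
    then have "norm (\<phi> f - f z) \<le> 0" by (rule field_le_epsilon)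
    then show ?thesis by simp
  qed
  with z show ?thesis by blast
qed

section \<open>Bounded sequences of functionals on \<open>\<ell>\<^sub>p\<close>\<close>

text \<open>A diagonal sequence converges at all unit vectors, hence at all finite sequences. The common norm
  bound carries convergence over to their closure, which is the whole space.\<close>

lemma ell_dual_pointwise_convergent_subsequence:
  fixes f :: "nat \<Rightarrow> (nat \<Rightarrow> 'k::real_or_complex) \<Rightarrow> 'k"
  assumes p: "1 \<le> p" and f: "\<And>n. f n \<in> ell_dual p"
    and C: "C \<ge> 0" "\<And>n x. x \<in> ell p \<Longrightarrow> norm (f n x) \<le> C * ell_norm p x"
  obtains r :: "nat \<Rightarrow> nat" and g where "strict_mono r" "g \<in> ell_dual p" "\<forall>x\<in>ell p. norm (g x) \<le> C * ell_norm p x"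
    "\<forall>x\<in>ell p. (\<lambda>n. f (r n) x) \<longlonglongrightarrow> g x"
proof -
  have p0: "0 < p" using p by simp
  interpret S: subseqs "\<lambda>i s. convergent (\<lambda>n. f (s n) (unit i))"
  proof
    fix i and s :: "nat \<Rightarrow> nat"
    have "bounded (range (\<lambda>n. f (s n) (unit i)))"
      unfolding bounded_iff using C(2)[OF unit_in_ell[OF p0]] by blast
    then obtain l r' where "strict_mono r'" "((\<lambda>n. f (s n) (unit i)) \<circ> r') \<longlonglongrightarrow> l"
      using bounded_imp_convergent_subsequence by blast
    then show "\<exists>r'. strict_mono r' \<and> convergent (\<lambda>n. f ((s \<circ> r') n) (unit i))"
      by (auto simp: convergent_def comp_def)
  qed
  define r where "r = S.diagseq"
  have conv_unit: "convergent (\<lambda>n. f (r n) (unit i))" for i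
  proof -
    have "convergent (\<lambda>n. f ((r \<circ> (+) (Suc i)) n) (unit i))"
      unfolding r_def
    proof (rule S.diagseq_holds)
      fix r' s :: "nat \<Rightarrow> nat" and n
      assume "strict_mono r'" "convergent (\<lambda>k. f (s k) (unit n))"
      then show "convergent (\<lambda>k. f ((s \<circ> r') k) (unit n))"
        using convergent_subseq_convergent[of "\<lambda>k. f (s k) (unit n)" r'] by (simp add: comp_def)
    qed
    then show ?thesis
      using convergent_ignore_initial_segment[of "\<lambda>n. f (r n) (unit i)" "Suc i"] by (simp add: add.commute)
  qed
  have "Cauchy (\<lambda>n. f (r n) x)" if x: "x \<in> ell p" for x
  proof (rule metric_CauchyI)
    fix e :: real assume e: "e > 0"
    have "e / (4 * (C + 1)) > 0" using e C by simp
    then obtain M where "\<forall>m\<ge>M. ell_norm p (cut {m..} x) \<le> e / (4 * (C + 1))"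
      using ell_norm_tail_small[OF p0 x] by blast
    then have M: "ell_norm p (cut {M..} x) \<le> e / (4 * (C + 1))" by blast
    have tail: "norm (f n (cut {M..} x)) \<le> e / 4" for n
    proof -
      have "norm (f n (cut {M..} x)) \<le> C * ell_norm p (cut {M..} x)"
        by (rule C(2)[OF cut_in_ell[OF p0 x]])
      also have "\<dots> \<le> C * (e / (4 * (C + 1)))" using M C(1) by (intro mult_left_mono)
      also have "\<dots> \<le> e / 4" using C(1) e by (simp add: field_simps)
      finally show ?thesis .
    qed
    have "convergent (\<lambda>n. f (r n) (cut {..<M} x))"
      unfolding ell_dual_cut_finite[OF p f finite_lessThan]
      by (intro convergent_sum convergent_mult convergent_const conv_unit)
    then have "Cauchy (\<lambda>n. f (r n) (cut {..<M} x))" by (rule convergent_Cauchy)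
    then obtain N where N: "\<forall>m\<ge>N. \<forall>n\<ge>N. dist (f (r m) (cut {..<M} x)) (f (r n) (cut {..<M} x)) < e / 2"
      using metric_CauchyD[of _ "e / 2"] e by (meson half_gt_zero)
    have "dist (f (r m) x) (f (r n) x) < e" if mn: "m \<ge> N" "n \<ge> N" for m n
    proof -
      have split: "f k x = f k (cut {..<M} x) + f k (cut {M..} x)" for k
        by (rule ell_dual_cut_split(2)[OF p f x])
      have "dist (f (r m) x) (f (r n) x) \<le> dist (f (r m) (cut {..<M} x)) (f (r n) (cut {..<M} x))
          + dist (f (r m) (cut {M..} x)) (f (r n) (cut {M..} x))"
        unfolding split by (rule dist_triangle_add)
      also have "dist (f (r m) (cut {M..} x)) (f (r n) (cut {M..} x)) \<le> e / 4 + e / 4"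
        unfolding dist_norm using norm_triangle_ineq4[of "f (r m) (cut {M..} x)" "f (r n) (cut {M..} x)"]
          tail[of "r m"] tail[of "r n"] by linarith
      also have "dist (f (r m) (cut {..<M} x)) (f (r n) (cut {..<M} x)) < e / 2" using N mn by blast
      finally show ?thesis by simp
    qed
    then show "\<exists>M. \<forall>m\<ge>M. \<forall>n\<ge>M. dist (f (r m) x) (f (r n) x) < e" by blast
  qed
  then have "\<forall>x. \<exists>l. x \<in> ell p \<longrightarrow> (\<lambda>n. f (r n) x) \<longlonglongrightarrow> l"
    by (auto simp: Cauchy_convergent_iff convergent_def)
  then obtain g0 where "\<forall>x. x \<in> ell p \<longrightarrow> (\<lambda>n. f (r n) x) \<longlonglongrightarrow> g0 x" by (rule choice[THEN exE])
  then have g0: "(\<lambda>n. f (r n) x) \<longlonglongrightarrow> g0 x" if "x \<in> ell p" for x using that by blast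
  define g where "g x = (if x \<in> ell p then g0 x else 0)" for x
  have lim: "(\<lambda>n. f (r n) x) \<longlonglongrightarrow> g x" if "x \<in> ell p" for x
    using g0[OF that] that by (simp add: g_def)
  have le: "norm (g x) \<le> C * ell_norm p x" if "x \<in> ell p" for x
    by (rule tendsto_upperbound[OF tendsto_norm[OF lim[OF that]]]) (use C(2)[OF that] in auto)
  have "g \<in> ell_dual p"
    unfolding ell_dual_iff[OF p]
  proof (intro conjI ballI allI impI)
    fix x y :: "nat \<Rightarrow> 'k" assume x: "x \<in> ell p" and y: "y \<in> ell p"
    have "(\<lambda>n. f (r n) (x + y)) \<longlonglongrightarrow> g x + g y"
      unfolding ell_dual_add[OF p f x y] by (intro tendsto_add lim x y)
    then show "g (x + y) = g x + g y"
      using lim[OF ell_add[OF p x y]] LIMSEQ_unique by blast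
  next
    fix c and x :: "nat \<Rightarrow> 'k" assume x: "x \<in> ell p"
    have "(\<lambda>n. f (r n) (fscale c x)) \<longlonglongrightarrow> c * g x"
      unfolding ell_dual_scale[OF p f x] by (intro tendsto_mult tendsto_const lim x)
    then show "g (fscale c x) = c * g x"
      using lim[OF ell_scale[OF x]] LIMSEQ_unique by blast
  next
    show "\<exists>C. \<forall>x\<in>ell p. norm (g x) \<le> C * ell_norm p x" using le by blast
  qed (simp add: g_def)
  moreover have "strict_mono r" unfolding r_def by (rule S.subseq_diagseq)
  ultimately show thesis using that lim le by blast
qed

text \<open>The blocks are disjoint, so the \<open>p\<close>-th powers of their norms add up to at most that of \<open>z\<close>.\<close>

lemma block_norms_in_ell:
  assumes p: "0 < p" and z: "z \<in> ell p" and m: "\<And>k. m k \<le> m (Suc k)"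
  shows "(\<lambda>k. of_real (ell_norm p (cut {m k..<m (Suc k)} z)) :: 'k::real_or_complex) \<in> ell p"
proof (rule ell_memI[OF p ell_norm_nonneg[of p z]])
  fix K
  have mono: "m 0 \<le> m k" for k by (rule lift_Suc_mono_le[of m]) (use m in auto)
  have "(\<Sum>k<K. norm (of_real (ell_norm p (cut {m k..<m (Suc k)} z)) :: 'k) powr p)
      = (\<Sum>k<K. \<Sum>i\<in>{m k..<m (Suc k)}. norm (z i) powr p)"
    by (simp add: ell_norm_nonneg ell_norm_cut_finite(2)[OF p])
  also have "\<dots> = (\<Sum>i\<in>{m 0..<m K}. norm (z i) powr p)"
  proof (induction K)
    case (Suc K)
    then show ?case
      using sum.atLeastLessThan_concat[OF mono[of K] m[of K], of "\<lambda>i. norm (z i) powr p"] by simp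
  qed simp
  also have "\<dots> \<le> ell_norm p z powr p" by (rule sum_le_ell_norm[OF p z]) simp
  finally show "(\<Sum>k<K. norm (of_real (ell_norm p (cut {m k..<m (Suc k)} z)) :: 'k) powr p) \<le> ell_norm p z powr p" .
qed

lemma geometric_in_ell:
  assumes "1 \<le> p"
  shows "(\<lambda>k. of_real ((1 / 2) ^ k) :: 'k::real_or_complex) \<in> ell p"
proof -
  have "summable (\<lambda>k. (1 / 2 :: real) ^ k)" by (simp add: summable_geometric)
  then have "summable (\<lambda>k. norm (of_real ((1 / 2) ^ k) :: 'k) powr p)"
  proof (rule summable_comparison_test'[where N=0])
    fix k :: nat
    have "((1 / 2 :: real) ^ k) powr p \<le> ((1 / 2) ^ k) powr 1"
      using assms by (intro powr_mono') (auto simp: power_le_one)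
    then show "norm (norm (of_real ((1 / 2) ^ k) :: 'k) powr p) \<le> (1 / 2) ^ k"
      by (simp add: norm_power norm_divide)
  qed
  then show ?thesis by (simp add: ell_def)
qed

text \<open>A gliding hump. Since the \<open>g n\<close> tend to zero pointwise, late ones are tiny on any fixed finite block of
  coordinates; since each single one is tiny on late coordinates, a subsequence \<open>g (r k)\<close> lives, up to
  errors \<open>(1 / 2) ^ k\<close>, on consecutive blocks \<open>{m k..<m (Suc k)}\<close>. So \<open>g (r k) z\<close> is at most
  a geometric term plus \<open>C\<close> times the norm of the \<open>k\<close>-th block of \<open>z\<close>, and both are sequences in
  \<open>\<ell>\<^sub>p\<close>.\<close>

lemma pointwise_null_subsequence_weakly_p_summable:
  fixes g :: "nat \<Rightarrow> (nat \<Rightarrow> 'k::real_or_complex) \<Rightarrow> 'k"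
  assumes p: "1 < p" and g: "\<And>n. g n \<in> ell_dual p"
    and C: "C \<ge> 0" "\<And>n x. x \<in> ell p \<Longrightarrow> norm (g n x) \<le> C * ell_norm p x"
    and null: "\<And>x. x \<in> ell p \<Longrightarrow> (\<lambda>n. g n x) \<longlonglongrightarrow> 0"
  obtains r :: "nat \<Rightarrow> nat" where "strict_mono r" "\<forall>z\<in>ell p. (\<lambda>k. g (r k) z) \<in> ell p"
proof -
  have p1: "1 \<le> p" and p0: "0 < p" using p by auto
  define head where "head k n m \<longleftrightarrow> (\<forall>x\<in>ell p. norm (g n (cut {..<m} x)) \<le> (1 / 2) ^ k * ell_norm p x)" for k n m
  define tail where "tail k n m \<longleftrightarrow> (\<forall>x\<in>ell p. norm (g n (cut {m..} x)) \<le> (1 / 2) ^ k * ell_norm p x)" for k n m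
  have ex_tail: "\<exists>M. \<forall>m\<ge>M. tail k n m" for k n
    unfolding tail_def using p by (intro ell_dual_tail_small g) auto
  have ex_head: "\<exists>N. \<forall>n\<ge>N. head k n m" for k m
  proof -
    have "(\<lambda>n. \<Sum>i<m. norm (g n (unit i))) \<longlonglongrightarrow> (\<Sum>i<m. 0)"
      by (intro tendsto_sum tendsto_norm_zero null unit_in_ell p0)
    then have "\<forall>\<^sub>F n in sequentially. (\<Sum>i<m. norm (g n (unit i))) < (1 / 2) ^ k"
      by (intro order_tendstoD(2)[of _ 0]) auto
    then obtain N where N: "\<forall>n\<ge>N. (\<Sum>i<m. norm (g n (unit i))) < (1 / 2) ^ k"
      unfolding eventually_sequentially by blast
    have "norm (g n (cut {..<m} x)) \<le> (1 / 2) ^ k * ell_norm p x" if n: "n \<ge> N" and x: "x \<in> ell p" for n x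
    proof -
      have "norm (g n (cut {..<m} x)) \<le> (\<Sum>i<m. norm (x i * g n (unit i)))"
        unfolding ell_dual_cut_finite[OF p1 g finite_lessThan] by (rule norm_sum)
      also have "\<dots> \<le> (\<Sum>i<m. ell_norm p x * norm (g n (unit i)))"
        unfolding norm_mult by (intro sum_mono mult_right_mono norm_le_ell_norm p0 x) auto
      also have "\<dots> = ell_norm p x * (\<Sum>i<m. norm (g n (unit i)))" by (rule sum_distrib_left[symmetric])
      also have "\<dots> \<le> ell_norm p x * (1 / 2) ^ k"
        using N n by (intro mult_left_mono ell_norm_nonneg) (auto intro: less_imp_le)
      finally show ?thesis by (simp add: mult.commute)
    qed
    then show ?thesis unfolding head_def by blast
  qed
  have "\<exists>w. \<forall>k. (case w k of (n, m) \<Rightarrow> head k n m) \<and>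
      (case w k of (n, m) \<Rightarrow> case w (Suc k) of (n', m') \<Rightarrow> n < n' \<and> m \<le> m' \<and> tail k n m')"
  proof (rule dependent_nat_choice)
    have "head 0 0 0" by (simp add: head_def cut_empty ell_dual_zero[OF p1 g] ell_norm_nonneg del: zero_fun_apply)
    then show "\<exists>w. case w of (n, m) \<Rightarrow> head 0 n m" by blast
    fix w k assume "case w of (n, m) \<Rightarrow> head k n m"
    obtain n m where w: "w = (n, m)" by (cases w)
    obtain M where M: "\<forall>m\<ge>M. tail k n m" using ex_tail by blast
    obtain N where N: "\<forall>n\<ge>N. head (Suc k) n (max m M)" using ex_head by blast
    show "\<exists>y. (case y of (n, m) \<Rightarrow> head (Suc k) n m) \<and>
        (case w of (n, m) \<Rightarrow> case y of (n', m') \<Rightarrow> n < n' \<and> m \<le> m' \<and> tail k n m')"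
      using M N by (intro exI[of _ "(max N (Suc n), max m M)"]) (simp add: w)
  qed
  then obtain w where "\<forall>k. (case w k of (n, m) \<Rightarrow> head k n m) \<and>
      (case w k of (n, m) \<Rightarrow> case w (Suc k) of (n', m') \<Rightarrow> n < n' \<and> m \<le> m' \<and> tail k n m')" ..
  then have w: "head k (fst (w k)) (snd (w k))" "fst (w k) < fst (w (Suc k))"
    "snd (w k) \<le> snd (w (Suc k))" "tail k (fst (w k)) (snd (w (Suc k)))" for k
    by (simp_all add: case_prod_beta)
  define r where "r k = fst (w k)" for k
  define m where "m k = snd (w k)" for k
  have r: "strict_mono r" using w(2) by (simp add: r_def strict_mono_Suc_iff)
  have m: "m k \<le> m (Suc k)" for k using w(3) by (simp add: m_def)
  have "(\<lambda>k. g (r k) z) \<in> ell p" if z: "z \<in> ell p" for z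
  proof (rule ell_dominated)
    let ?y = "fscale (of_real (2 * ell_norm p z)) (\<lambda>k. of_real ((1 / 2) ^ k) :: 'k)
        + fscale (of_real C) (\<lambda>k. of_real (ell_norm p (cut {m k..<m (Suc k)} z)))"
    show "?y \<in> ell p"
      by (intro ell_add p1 ell_scale geometric_in_ell block_norms_in_ell p0 z m)
    fix k
    have split: "g (r k) z = g (r k) (cut {..<m k} z) + (g (r k) (cut {m k..<m (Suc k)} z) + g (r k) (cut {m (Suc k)..} z))"
      using ell_dual_cut_split(2)[OF p1 g z, of "r k" "m k"]
        ell_dual_cut_split(1)[OF p1 g z, of "r k" "m k" "m (Suc k) - m k"] m[of k] by simp
    have "norm (g (r k) z) \<le> norm (g (r k) (cut {..<m k} z)) +
        (norm (g (r k) (cut {m k..<m (Suc k)} z)) + norm (g (r k) (cut {m (Suc k)..} z)))"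
      unfolding split by (intro norm_triangle_le add_mono norm_triangle_ineq order_refl)
    also have "\<dots> \<le> (1 / 2) ^ k * ell_norm p z + (C * ell_norm p (cut {m k..<m (Suc k)} z) + (1 / 2) ^ k * ell_norm p z)"
    proof (intro add_mono)
      show "norm (g (r k) (cut {..<m k} z)) \<le> (1 / 2) ^ k * ell_norm p z"
        using w(1) z unfolding head_def r_def m_def by blast
      show "norm (g (r k) (cut {m (Suc k)..} z)) \<le> (1 / 2) ^ k * ell_norm p z"
        using w(4) z unfolding tail_def r_def m_def by blast
      show "norm (g (r k) (cut {m k..<m (Suc k)} z)) \<le> C * ell_norm p (cut {m k..<m (Suc k)} z)"
        by (rule C(2)[OF cut_in_ell[OF p0 z]])
    qed
    also have "\<dots> = norm (?y k)"
    proof -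
      have "?y k = of_real (2 * ell_norm p z * (1 / 2) ^ k + C * ell_norm p (cut {m k..<m (Suc k)} z))"
        by (simp add: fscale_def)
      moreover have "2 * ell_norm p z * (1 / 2) ^ k + C * ell_norm p (cut {m k..<m (Suc k)} z) \<ge> 0"
        using C(1) by (intro add_nonneg_nonneg mult_nonneg_nonneg ell_norm_nonneg) auto
      ultimately show ?thesis by (simp only: norm_of_real abs_of_nonneg) simp
    qed
    finally show "norm (g (r k) z) \<le> norm (?y k)" .
  qed (rule p0)
  with r show thesis by (intro that[of r]) auto
qed

text \<open>The polar of a bounded set need not be open; requiring a bound strictly below 1 makes it so.\<close>

lemma openin_strong_unit_ball:
  assumes B: "bounded_in s \<tau> B"
  shows "openin (strong_topology s \<tau>) {f \<in> dual s \<tau>. \<exists>r<1. \<forall>x\<in>B. norm (f x) \<le> r}"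
  unfolding openin_strong_topology
proof (intro conjI ballI)
  fix f assume "f \<in> {f \<in> dual s \<tau>. \<exists>r<1. \<forall>x\<in>B. norm (f x) \<le> r}"
  then obtain r where r: "r < 1" "\<forall>x\<in>B. norm (f x) \<le> r" by blast
  have "\<exists>r<1. \<forall>x\<in>B. norm (g x) \<le> r" if "\<forall>x\<in>B. norm (g x - f x) < (1 - r) / 2" for g
  proof (intro exI conjI ballI)
    show "(1 + r) / 2 < 1" using r by simp
    fix x assume "x \<in> B"
    then have "norm (g x - f x) < (1 - r) / 2" "norm (f x) \<le> r" using that r by auto
    then show "norm (g x) \<le> (1 + r) / 2"
      using norm_triangle_ineq[of "g x - f x" "f x"] by (simp add: field_simps)
  qed
  with B r show "\<exists>B' \<epsilon>. bounded_in s \<tau> B' \<and> 0 < \<epsilon> \<and> {g \<in> dual s \<tau>. \<forall>x\<in>B'. norm (g x - f x) < \<epsilon>}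
      \<subseteq> {f \<in> dual s \<tau>. \<exists>r<1. \<forall>x\<in>B. norm (f x) \<le> r}"
    by (intro exI[of _ B] exI[of _ "(1 - r) / 2"]) auto
qed auto

text \<open>A sequence \<open>f\<close> in the unit ball of the dual has a pointwise convergent subsequence, with limit \<open>h\<close>. Along a
  further subsequence the differences to \<open>h\<close> are \<open>p\<close>-summable at every point of \<open>\<ell>\<^sub>p\<close>, that is, by
  reflexivity, weakly \<open>p\<close>-summable. This remains true for subsequences of it, and the difference of two
  of these no longer involves \<open>h\<close>.\<close>

lemma identity_ell_dual_weakly_seq_p_precompact:
  assumes p: "1 < p"
  shows "weakly_seq_p_precompact_operator p
    fscale (strong_topology fscale (ell_topology p :: (nat \<Rightarrow> 'k::real_or_complex) topology))
    fscale (strong_topology fscale (ell_topology p)) (\<lambda>f. f)"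
proof -
  have p1: "1 \<le> p" and p0: "0 < p" using p by auto
  interpret ell: banach_space "ell p :: (nat \<Rightarrow> 'k) set" fscale "ell_norm p"
    by (rule banach_space_ell[OF p1])
  let ?B = "{x \<in> ell p :: (nat \<Rightarrow> 'k) set. ell_norm p x \<le> 1}"
  have B: "bounded_in fscale (ell_topology p) ?B"
    unfolding ell.bounded_in_norm_topology_iff by auto
  let ?U = "{f \<in> ell_dual p. \<exists>r<1. \<forall>x\<in>?B. norm (f x) \<le> r}"
  have U: "openin (strong_topology fscale (ell_topology p)) ?U" by (rule openin_strong_unit_ball[OF B])
  have zero: "0 \<in> ?U" by (auto simp: zero_in_dual intro!: exI[of _ 0])
  have "\<exists>r. strict_mono r \<and> weakly_p_Cauchy p fscale (strong_topology fscale (ell_topology p)) (f \<circ> r)"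
    if f: "range f \<subseteq> ?U" for f :: "nat \<Rightarrow> (nat \<Rightarrow> 'k) \<Rightarrow> 'k"
  proof -
    have fd: "f n \<in> ell_dual p" for n using f by blast
    have fle: "norm (f n x) \<le> 1 * ell_norm p x" if x: "x \<in> ell p" for n x
    proof (rule ell.norm_le_of_unit_ball[OF _ _ x])
      show "f n (fscale c x) = c * f n x" if "x \<in> ell p" for c x by (rule ell_dual_scale[OF p1 fd that])
      show "norm (f n x) \<le> 1" if "x \<in> ell p" "ell_norm p x \<le> 1" for x
      proof -
        have "f n \<in> ?U" using f by blast
        then obtain r where "r < 1" "\<forall>x\<in>?B. norm (f n x) \<le> r" by blast
        then show ?thesis using that by force
      qed
    qed
    obtain r1 :: "nat \<Rightarrow> nat" and h where r1: "strict_mono r1" and h: "h \<in> ell_dual p"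
      "\<forall>x\<in>ell p. norm (h x) \<le> 1 * ell_norm p x" and lim: "\<forall>x\<in>ell p. (\<lambda>n. f (r1 n) x) \<longlonglongrightarrow> h x"
      by (rule ell_dual_pointwise_convergent_subsequence[of p f 1, OF p1 fd _ fle]) simp_all
    define g where "g n = f (r1 n) - h" for n
    have gd: "g n \<in> ell_dual p" for n unfolding g_def by (rule diff_in_dual[OF fd h(1)])
    have gle: "norm (g n x) \<le> 2 * ell_norm p x" if x: "x \<in> ell p" for n x
      using norm_triangle_ineq4[of "f (r1 n) x" "h x"] fle[OF x, of "r1 n"] bspec[OF h(2) x] by (simp add: g_def)
    have gnull: "(\<lambda>n. g n x) \<longlonglongrightarrow> 0" if x: "x \<in> ell p" for x
      using tendsto_diff[OF bspec[OF lim x] tendsto_const[of "h x"]] by (simp add: g_def)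
    obtain r2 :: "nat \<Rightarrow> nat" where r2: "strict_mono r2" and summ: "\<forall>z\<in>ell p. (\<lambda>k. g (r2 k) z) \<in> ell p"
      by (rule pointwise_null_subsequence_weakly_p_summable[of p g 2, OF p gd _ gle gnull]) simp_all
    have "weakly_p_Cauchy p fscale (strong_topology fscale (ell_topology p)) (f \<circ> (r1 \<circ> r2))"
      unfolding weakly_p_Cauchy_def topspace_strong_topology
    proof (intro conjI allI impI)
      show "range (f \<circ> (r1 \<circ> r2)) \<subseteq> ell_dual p" using fd by auto
      fix k j :: "nat \<Rightarrow> nat" assume kj: "strict_mono k \<and> strict_mono j"
      let ?d = "\<lambda>n. (f \<circ> (r1 \<circ> r2)) (k n) - (f \<circ> (r1 \<circ> r2)) (j n)"
      have d: "?d n \<in> ell_dual p" for n unfolding comp_def by (intro diff_in_dual fd)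
      show "weakly_p_summable p fscale (strong_topology fscale (ell_topology p)) ?d"
        unfolding weakly_p_summable_def topspace_strong_topology
      proof (intro conjI ballI)
        show "range ?d \<subseteq> ell_dual p" using d by auto
        fix \<phi> assume "\<phi> \<in> dual fscale (strong_topology fscale (ell_topology p :: (nat \<Rightarrow> 'k) topology))"
        then obtain z where z: "z \<in> ell p" "\<forall>f\<in>ell_dual p. \<phi> f = f z"
          using ell_reflexive[OF p] by blast
        have "(\<lambda>n. \<phi> (?d n)) = (\<lambda>n. g (r2 (k n)) z) - (\<lambda>n. g (r2 (j n)) z)"
          using bspec[OF z(2) d] by (auto simp: g_def)
        moreover have "(\<lambda>n. g (r2 (k n)) z) - (\<lambda>n. g (r2 (j n)) z) \<in> ell p"
          using kj ell_subseq[OF bspec[OF summ z(1)] _ p0] by (intro ell_diff p1) auto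
        ultimately show "(\<lambda>n. \<phi> (?d n)) \<in> ell p" by simp
      qed
    qed
    then show ?thesis using strict_mono_o[OF r1 r2] by blast
  qed
  then have pre: "weakly_seq_p_precompact p fscale (strong_topology fscale (ell_topology p)) ((\<lambda>f. f) ` ?U)"
    by (auto simp: weakly_seq_p_precompact_def)
  have "operator fscale (strong_topology fscale (ell_topology p)) fscale (strong_topology fscale (ell_topology p))
      (\<lambda>f :: (nat \<Rightarrow> 'k) \<Rightarrow> 'k. f)"
    by (simp add: operator_def)
  with U zero pre show ?thesis
    unfolding weakly_seq_p_precompact_operator_def by blast
qed

section \<open>Adjoints of operators into \<open>\<ell>\<^sub>p\<close>\<close>

text \<open>The adjoint factors through the identity of the dual of \<open>\<ell>\<^sub>p\<close>, which is weakly sequentially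
  \<open>p\<close>-precompact.\<close>

lemma adjoint_weakly_seq_p_precompact:
  assumes p: "1 < p" and V: "vector_space_on (topspace \<tau>) s"
    and T: "operator s \<tau> fscale (ell_topology p) T"
  shows "weakly_seq_p_precompact_operator p fscale (strong_topology fscale (ell_topology p))
    fscale (strong_topology s \<tau>) (adjoint_map \<tau> T)"
proof -
  have "vector_space_on (topspace (strong_topology fscale (ell_topology p))) fscale"
    unfolding topspace_strong_topology by (rule vector_space_on_dual)
  from weakly_seq_p_precompact_operator_postcompose[OF identity_ell_dual_weakly_seq_p_precompact[OF p] operator_adjoint[OF T V] this]
  show ?thesis by (simp add: comp_def)
qed

text \<open>Transports a Banach space along a linear injection \<open>\<iota>\<close> with left inverse \<open>\<pi>\<close>. It is used to place
  \<open>\<ell>\<^sub>p\<close> inside the product type over which Banach spaces range in the theorem.\<close>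

locale isometric_copy = banach_space V s N
  for V :: "'v::ab_group_add set" and s :: "'k::real_or_complex \<Rightarrow> 'v \<Rightarrow> 'v" and N :: "'v \<Rightarrow> real" +
  fixes \<iota> :: "'v \<Rightarrow> 'w::ab_group_add" and \<pi> :: "'w \<Rightarrow> 'v"
  assumes embed_add: "x \<in> V \<Longrightarrow> y \<in> V \<Longrightarrow> \<iota> (x + y) = \<iota> x + \<iota> y"
    and project_embed: "x \<in> V \<Longrightarrow> \<pi> (\<iota> x) = x"
begin

abbreviation "copy_scale \<equiv> \<lambda>c y. \<iota> (s c (\<pi> y))"

abbreviation "copy_norm \<equiv> \<lambda>y. N (\<pi> y)"

lemma embed_zero: "\<iota> 0 = 0"
  using embed_add[OF zero_mem zero_mem] by simp

lemma embed_diff: "x \<in> V \<Longrightarrow> y \<in> V \<Longrightarrow> \<iota> x - \<iota> y = \<iota> (x - y)"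
  using embed_add[of "x - y" y] by (simp add: diff_mem)

lemma norm_dist_embed: "x \<in> V \<Longrightarrow> y \<in> V \<Longrightarrow> norm_dist (\<iota> ` V) copy_norm (\<iota> x) (\<iota> y) = norm_dist V N x y"
  by (simp add: norm_dist_def embed_diff project_embed diff_mem)

lemma Metric_space_copy: "Metric_space (\<iota> ` V) (norm_dist (\<iota> ` V) copy_norm)"
proof
  fix y y' :: 'w
  have "0 \<le> norm_dist (\<iota> ` V) copy_norm y y' \<and>
      norm_dist (\<iota> ` V) copy_norm y y' = norm_dist (\<iota> ` V) copy_norm y' y"
  proof (cases "y \<in> \<iota> ` V \<and> y' \<in> \<iota> ` V")
    case True
    then show ?thesis by (auto simp: norm_dist_embed metric.commute)
  next
    case False
    then show ?thesis by (auto simp: norm_dist_def)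
  qed
  then show "0 \<le> norm_dist (\<iota> ` V) copy_norm y y'"
    "norm_dist (\<iota> ` V) copy_norm y y' = norm_dist (\<iota> ` V) copy_norm y' y"
    by simp_all
next
  fix y y' assume "y \<in> \<iota> ` V" "y' \<in> \<iota> ` V"
  then obtain x x' where "x \<in> V" "x' \<in> V" "y = \<iota> x" "y' = \<iota> x'" by blast
  then show "(norm_dist (\<iota> ` V) copy_norm y y' = 0) = (y = y')"
    using project_embed by (metis metric.zero norm_dist_embed)
next
  fix y y' y'' assume "y \<in> \<iota> ` V" "y' \<in> \<iota> ` V" "y'' \<in> \<iota> ` V"
  then show "norm_dist (\<iota> ` V) copy_norm y y'' \<le> norm_dist (\<iota> ` V) copy_norm y y' + norm_dist (\<iota> ` V) copy_norm y' y''"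
    by (auto simp: norm_dist_embed intro: metric.triangle)
qed

lemma mcomplete_copy: "Metric_space.mcomplete (\<iota> ` V) (norm_dist (\<iota> ` V) copy_norm)"
proof -
  interpret Y: Metric_space "\<iota> ` V" "norm_dist (\<iota> ` V) copy_norm" by (rule Metric_space_copy)
  show ?thesis
    unfolding Y.mcomplete_def
  proof (intro allI impI)
    fix \<sigma> assume \<sigma>: "Y.MCauchy \<sigma>"
    then have "\<sigma> n \<in> \<iota> ` V" for n by (auto simp: Y.MCauchy_def)
    then have "\<forall>n. \<exists>x. x \<in> V \<and> \<sigma> n = \<iota> x" by blast
    then obtain x where x: "\<forall>n. x n \<in> V \<and> \<sigma> n = \<iota> (x n)" by (rule choice[THEN exE])
    have "metric.MCauchy x"
      using \<sigma> x unfolding Y.MCauchy_def metric.MCauchy_def by (auto simp: norm_dist_embed)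
    then obtain l where l: "limitin metric.mtopology x l sequentially"
      using complete unfolding metric.mcomplete_def by blast
    then have "limitin Y.mtopology \<sigma> (\<iota> l) sequentially"
      using x unfolding metric.limit_metric_sequentially Y.limit_metric_sequentially
      by (auto simp: norm_dist_embed)
    then show "\<exists>l. limitin Y.mtopology \<sigma> l sequentially" ..
  qed
qed

lemma banach_space_copy: "banach_space (\<iota> ` V) copy_scale copy_norm"
proof
  show "0 \<in> \<iota> ` V" using zero_mem embed_zero by force
  show "x + y \<in> \<iota> ` V" if "x \<in> \<iota> ` V" "y \<in> \<iota> ` V" for x y
    using that by (auto simp: embed_add[symmetric] add_mem)
  show "copy_norm x = 0 \<longleftrightarrow> x = 0" if x: "x \<in> \<iota> ` V" for x
  proof -
    obtain v where v: "v \<in> V" "x = \<iota> v" using x by blast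
    have "v = 0 \<longleftrightarrow> \<iota> v = 0" using embed_zero project_embed[OF v(1)] project_embed[OF zero_mem] by metis
    then show ?thesis using v by (simp add: project_embed norm_eq_0)
  qed
qed (auto simp: project_embed embed_add[symmetric] add_mem scale_mem scale_add_right scale_add_left
    scale_scale scale_one norm_ge_0 norm_scale norm_triangle mcomplete_copy)

lemma operator_embed: "operator s (norm_topology V N) copy_scale (norm_topology (\<iota> ` V) copy_norm) \<iota>"
proof -
  interpret Y: banach_space "\<iota> ` V" copy_scale copy_norm by (rule banach_space_copy)
  have "openin (norm_topology V N) {x \<in> V. \<iota> x \<in> U}" if U: "openin (norm_topology (\<iota> ` V) copy_norm) U" for U
    unfolding openin_norm_topology
  proof (intro conjI ballI)
    fix x assume x: "x \<in> {x \<in> V. \<iota> x \<in> U}"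
    then obtain r where r: "r > 0" "\<forall>y\<in>\<iota> ` V. copy_norm (y - \<iota> x) < r \<longrightarrow> y \<in> U"
      using U unfolding Y.openin_norm_topology by blast
    then show "\<exists>r>0. \<forall>y\<in>V. N (y - x) < r \<longrightarrow> y \<in> {x \<in> V. \<iota> x \<in> U}"
      using x by (intro exI[of _ r]) (auto simp: embed_diff project_embed diff_mem)
  qed auto
  then have "continuous_map (norm_topology V N) (norm_topology (\<iota> ` V) copy_norm) \<iota>"
    unfolding continuous_map by simp
  then show ?thesis by (simp add: operator_def embed_add project_embed)
qed

lemma continuous_map_project: "continuous_map (norm_topology (\<iota> ` V) copy_norm) (norm_topology V N) \<pi>"
proof -
  interpret Y: banach_space "\<iota> ` V" copy_scale copy_norm by (rule banach_space_copy)
  have "openin (norm_topology (\<iota> ` V) copy_norm) {y \<in> \<iota> ` V. \<pi> y \<in> U}" if U: "openin (norm_topology V N) U" for U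
    unfolding Y.openin_norm_topology
  proof (intro conjI ballI)
    fix y assume "y \<in> {y \<in> \<iota> ` V. \<pi> y \<in> U}"
    then obtain x where x: "x \<in> V" "y = \<iota> x" "x \<in> U" by (auto simp: project_embed)
    obtain r where r: "r > 0" "\<forall>x'\<in>V. N (x' - x) < r \<longrightarrow> x' \<in> U"
      using U x unfolding openin_norm_topology by blast
    then show "\<exists>r>0. \<forall>y'\<in>\<iota> ` V. copy_norm (y' - y) < r \<longrightarrow> y' \<in> {y \<in> \<iota> ` V. \<pi> y \<in> U}"
      using x by (intro exI[of _ r]) (auto simp: embed_diff project_embed diff_mem)
  qed auto
  then show ?thesis
    unfolding continuous_map by (auto simp: project_embed)
qed

end

text \<open>The hypothesis on Banach spaces is applied to the copy of \<open>\<ell>\<^sub>p\<close> in the second factor of the product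
  and to \<open>Pair 0 \<circ> T\<close>. The adjoint of this composition is the adjoint of \<open>T\<close> after that of
  \<open>Pair 0\<close>, hence weakly sequentially \<open>p\<close>-precompact; relative compactness is projected back.\<close>

lemma relatively_compact_ell_image_of_banach_images:
  fixes s :: "'k::real_or_complex \<Rightarrow> 'e::ab_group_add \<Rightarrow> 'e"
  assumes p: "1 < p" and V: "vector_space_on (topspace \<tau>) s"
    and T: "operator s \<tau> fscale (ell_topology p) T"
    and rc: "\<And>(Y :: ('u::ab_group_add, 'k) banach_universe set) sY N T.
         banach_space Y sY N \<Longrightarrow>
         operator s \<tau> sY (norm_topology Y N) T \<Longrightarrow>
         weakly_seq_p_precompact_operator p
           fscale (strong_topology sY (norm_topology Y N)) fscale (strong_topology s \<tau>)
           (adjoint_map \<tau> T) \<Longrightarrow>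
         relatively_compact_in (norm_topology Y N) (T ` A)"
    and A: "A \<subseteq> topspace \<tau>"
  shows "relatively_compact_in (ell_topology p) (T ` A)"
proof -
  have p1: "1 \<le> p" using p by simp
  interpret ell: banach_space "ell p :: (nat \<Rightarrow> 'k) set" fscale "ell_norm p"
    by (rule banach_space_ell[OF p1])
  interpret C: isometric_copy "ell p :: (nat \<Rightarrow> 'k) set" fscale "ell_norm p" "Pair (0::'u)" snd
    by unfold_locales simp_all
  let ?Y = "Pair (0::'u) ` (ell p :: (nat \<Rightarrow> 'k) set)"
  have T': "operator s \<tau> C.copy_scale (norm_topology ?Y C.copy_norm) (Pair 0 \<circ> T)"
    by (rule operator_compose[OF T C.operator_embed])
  have "(adjoint_map \<tau> (Pair 0 \<circ> T) :: ('u \<times> (nat \<Rightarrow> 'k) \<Rightarrow> 'k) \<Rightarrow> 'e \<Rightarrow> 'k) = adjoint_map \<tau> T \<circ> adjoint_map (ell_topology p) (Pair (0::'u))"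
    using operator_mem[OF T] by (auto simp: adjoint_map_def fun_eq_iff)
  moreover have "weakly_seq_p_precompact_operator p fscale (strong_topology C.copy_scale (norm_topology ?Y C.copy_norm))
      fscale (strong_topology s \<tau>) (adjoint_map \<tau> T \<circ> adjoint_map (ell_topology p) (Pair (0::'u)))"
  proof (rule weakly_seq_p_precompact_operator_precompose)
    show "operator fscale (strong_topology C.copy_scale (norm_topology ?Y C.copy_norm))
        fscale (strong_topology fscale (ell_topology p)) (adjoint_map (ell_topology p) (Pair (0::'u)))"
      using ell.vector_space_on_axioms by (intro operator_adjoint[OF C.operator_embed]) simp
    show "weakly_seq_p_precompact_operator p fscale (strong_topology fscale (ell_topology p))
        fscale (strong_topology s \<tau>) (adjoint_map \<tau> T)"
      by (rule adjoint_weakly_seq_p_precompact[OF p V T])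
  qed (simp add: zero_in_dual)
  ultimately have "relatively_compact_in (norm_topology ?Y C.copy_norm) ((Pair 0 \<circ> T) ` A)"
    by (intro rc[OF C.banach_space_copy T']) simp
  then have "relatively_compact_in (ell_topology p) (snd ` ((Pair (0::'u) \<circ> T) ` A))"
    using ell.metric.Hausdorff_space_mtopology unfolding norm_topology_def[symmetric]
    by (intro relatively_compact_in_continuous_image[OF C.continuous_map_project])
  then show ?thesis by (simp add: image_comp comp_def)
qed

section \<open>The characterization of p-(V*) sets\<close>

theorem theorem14p16:
  fixes p :: real
    and s :: "'k::real_or_complex \<Rightarrow> 'e::ab_group_add \<Rightarrow> 'e" and \<tau> :: "'e topology"
    and A :: "'e set"
  assumes "1 < p"
    and "locally_convex_space s \<tau>"
    and "quasibarrelled s \<tau>"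
    and "linf_Vp_barrelled p fscale (strong_topology s \<tau>)"
    and "A \<noteq> {}"
    and "bounded_in s \<tau> A"
  shows
    "(p_Vstar_set p s \<tau> A \<longleftrightarrow>
      (\<forall>(Y :: ('u::ab_group_add, 'k) banach_universe set) sY N T.
         banach_space Y sY N \<longrightarrow>
         operator s \<tau> sY (norm_topology Y N) T \<longrightarrow>
         weakly_seq_p_precompact_operator p
           fscale (strong_topology sY (norm_topology Y N)) fscale (strong_topology s \<tau>)
           (adjoint_map \<tau> T) \<longrightarrow>
         relatively_compact_in (norm_topology Y N) (T ` A))) \<and>
     (p_Vstar_set p s \<tau> A \<longleftrightarrow>
      (\<forall>T. operator s \<tau> fscale (norm_topology (ell p) (ell_norm p)) T \<longrightarrow>
         relatively_compact_in (norm_topology (ell p) (ell_norm p)) (T ` A)))"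
    (is "(?i \<longleftrightarrow> ?ii) \<and> (?i \<longleftrightarrow> ?iii)")
proof -
  interpret locally_convex_space s \<tau> by fact
  have p1: "1 \<le> p" using assms(1) by simp
  have AV: "A \<subseteq> topspace \<tau>" using assms(6) by (simp add: bounded_in_def)
  have i_ii: "relatively_compact_in (norm_topology Y N) (T ` A)"
    if "?i" "banach_space Y sY N" "operator s \<tau> sY (norm_topology Y N) T"
      "weakly_seq_p_precompact_operator p fscale (strong_topology sY (norm_topology Y N))
        fscale (strong_topology s \<tau>) (adjoint_map \<tau> T)"
    for Y :: "('u, 'k) banach_universe set" and sY N T
    by (rule relatively_compact_image_of_p_Vstar_set[OF that(1) assms(6) zero_mem that(2-4)])
  have ii_iii: "relatively_compact_in (ell_topology p) (T ` A)"
    if ?ii "operator s \<tau> fscale (ell_topology p) T" for T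
    by (rule relatively_compact_ell_image_of_banach_images[OF assms(1) vector_space_on_axioms that(2) _ AV])
      (use that(1) in blast)
  have iii_i: "?i" if ?iii
    using p_Vstar_set_of_relatively_compact_images[OF p1 assms(3,5) AV] that by blast
  show ?thesis
    using i_ii ii_iii iii_i by blast
qed

end
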